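(* Let the number of colours $m$ be a constant, let $\beta>1$ be the desired colour stretch, and let $\varepsilon>0$ be fixed. There is an algorithm, running in time polynomial in the number $n$ of items, that given any instance $I$ admitting a packing of colour stretch at most $\beta$, finds a packing $P$ of $I$ such that $P(I)\le(1+O(\varepsilon))\,\mathrm{OPT}_\beta(I)+O(1)$ and $P_c(I)\le\beta(1+O(\varepsilon))\,\mathrm{OPT}(I_c)+O(1)$ for every colour $c$.
   Context: Coloured bin packing: an instance $I$ is a finite set of $n$ items, each item $e$ having a size $s(e)\in(0,1]$ and a colour $c(e)\in\{1,\dots,m\}$; items are packed into unit-capacity bins. $I_c$ is the set of colour-$c$ items; $\mathrm{OPT}(I)$, $\mathrm{OPT}(I_c)$ are the minimum numbers of bins needed to pack $I$, $I_c$. For a packing $P$, $P(I)$ is the number of bins used and $P_c(I)$ the number of bins containing at least one colour-$c$ item. A packing has colour stretch at most $\beta$ if $P_c(I)\le\beta\,\mathrm{OPT}(I_c)$ for every colour $c$. $\mathrm{OPT}_\beta(I)$ denotes the smallest number of bins of a packing of $I$ with colour stretch at most $\beta$. Constants in $O(\cdot)$ are independent of the instance (they may depend on $\varepsilon$, $m$, $\beta$). *)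

theory Defs
  imports Complex_Main "HOL-Computational_Algebra.Polynomial"
begin

section \<open>Coloured bin packing\<close>

record 'e bp_instance =
  items :: "'e set"
  item_size :: "'e \<Rightarrow> real"
  item_colour :: "'e \<Rightarrow> nat"

definition valid_instance :: "nat \<Rightarrow> 'e bp_instance \<Rightarrow> bool" where
  "valid_instance m I \<longleftrightarrow> finite (items I) \<and>
     (\<forall>e\<in>items I. 0 < item_size I e \<and> item_size I e \<le> 1 \<and> item_colour I e \<in> {1..m})"

definition colour_part :: "'e bp_instance \<Rightarrow> nat \<Rightarrow> 'e bp_instance" where
  "colour_part I c = I\<lparr>items := {e \<in> items I. item_colour I e = c}\<rparr>"

text \<open>A packing assigns to each item the (arbitrary) label of its bin. Labels to which no item
  is assigned are not used bins and are not counted.\<close>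

definition packing :: "'e bp_instance \<Rightarrow> ('e \<Rightarrow> nat) \<Rightarrow> bool" where
  "packing I P \<longleftrightarrow> (\<forall>b. (\<Sum>e\<in>{e \<in> items I. P e = b}. item_size I e) \<le> 1)"

definition num_bins :: "'e bp_instance \<Rightarrow> ('e \<Rightarrow> nat) \<Rightarrow> nat" where
  "num_bins I P = card (P ` items I)"

definition OPT :: "'e bp_instance \<Rightarrow> nat" where
  "OPT I = (LEAST k. \<exists>P. packing I P \<and> num_bins I P = k)"

definition num_bins_colour :: "'e bp_instance \<Rightarrow> nat \<Rightarrow> ('e \<Rightarrow> nat) \<Rightarrow> nat" where
  "num_bins_colour I c P = card {b. \<exists>e\<in>items I. P e = b \<and> item_colour I e = c}"

definition colour_stretch_le :: "nat \<Rightarrow> 'e bp_instance \<Rightarrow> ('e \<Rightarrow> nat) \<Rightarrow> real \<Rightarrow> bool" where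
  "colour_stretch_le m I P \<beta> \<longleftrightarrow>
     (\<forall>c\<in>{1..m}. real (num_bins_colour I c P) \<le> \<beta> * real (OPT (colour_part I c)))"

definition OPT_stretch :: "nat \<Rightarrow> real \<Rightarrow> 'e bp_instance \<Rightarrow> nat" where
  "OPT_stretch m \<beta> I =
     (LEAST k. \<exists>P. packing I P \<and> colour_stretch_le m I P \<beta> \<and> num_bins I P = k)"


section \<open>Programs on a real RAM\<close>

text \<open>Item sizes are real numbers and running time is measured in the number of items only, so the
  machine model is the unit-cost real RAM, presented as a structured language with finitely many
  named arrays of natural numbers and of reals; a scalar variable is an array accessed at one
  index. Natural numbers serve as indices and counters. They cannot be multiplied (which at unit
  cost would create numbers of exponential bit length), and a real influences them only through
  comparisons; in particular there is no floor function. Real literals are rational, so that a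
  program cannot hide infinite advice in its text.\<close>

type_synonym vname = string

datatype iexp =
    IConst nat
  | IArr vname iexp
  | IPlus iexp iexp
  | IMinus iexp iexp

datatype rexp =
    RConst rat
  | RArr vname iexp
  | RPlus rexp rexp
  | RMinus rexp rexp
  | RTimes rexp rexp
  | RDivide rexp rexp

datatype bexp =
    ILess iexp iexp
  | RLess rexp rexp
  | BNot bexp
  | BAnd bexp bexp

datatype com =
    Skip
  | IAssign vname iexp iexp
  | RAssign vname iexp rexp
  | Seq com com
  | Cond bexp com com
  | While bexp com

record state =
  nats :: "vname \<Rightarrow> nat \<Rightarrow> nat"
  reals :: "vname \<Rightarrow> nat \<Rightarrow> real"

fun ival :: "iexp \<Rightarrow> state \<Rightarrow> nat" where
  "ival (IConst k) s = k"
| "ival (IArr x a) s = nats s x (ival a s)"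
| "ival (IPlus a b) s = ival a s + ival b s"
| "ival (IMinus a b) s = ival a s - ival b s"

fun rval :: "rexp \<Rightarrow> state \<Rightarrow> real" where
  "rval (RConst q) s = of_rat q"
| "rval (RArr x a) s = reals s x (ival a s)"
| "rval (RPlus a b) s = rval a s + rval b s"
| "rval (RMinus a b) s = rval a s - rval b s"
| "rval (RTimes a b) s = rval a s * rval b s"
| "rval (RDivide a b) s = rval a s / rval b s"

fun bval :: "bexp \<Rightarrow> state \<Rightarrow> bool" where
  "bval (ILess a b) s \<longleftrightarrow> ival a s < ival b s"
| "bval (RLess a b) s \<longleftrightarrow> rval a s < rval b s"
| "bval (BNot b) s \<longleftrightarrow> \<not> bval b s"
| "bval (BAnd a b) s \<longleftrightarrow> bval a s \<and> bval b s"

definition nat_store :: "vname \<Rightarrow> nat \<Rightarrow> nat \<Rightarrow> state \<Rightarrow> state" where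
  "nat_store x i v s = s\<lparr>nats := (nats s)(x := (nats s x)(i := v))\<rparr>"

definition real_store :: "vname \<Rightarrow> nat \<Rightarrow> real \<Rightarrow> state \<Rightarrow> state" where
  "real_store x i v s = s\<lparr>reals := (reals s)(x := (reals s x)(i := v))\<rparr>"

text \<open>\<open>runs c s t s'\<close>: started in \<open>s\<close>, program \<open>c\<close> halts in \<open>s'\<close> after \<open>t\<close> steps. Every assignment
  and every test is one step: the expressions occurring in a fixed program have bounded size, so
  charging for each operation inside them would change \<open>t\<close> by a constant factor only.\<close>

inductive runs :: "com \<Rightarrow> state \<Rightarrow> nat \<Rightarrow> state \<Rightarrow> bool" where
  Skip: "runs Skip s 1 s"
| IAssign: "runs (IAssign x a e) s 1 (nat_store x (ival a s) (ival e s) s)"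
| RAssign: "runs (RAssign x a e) s 1 (real_store x (ival a s) (rval e s) s)"
| Seq: "runs c1 s t1 s' \<Longrightarrow> runs c2 s' t2 s'' \<Longrightarrow> runs (Seq c1 c2) s (t1 + t2) s''"
| CondTrue: "bval b s \<Longrightarrow> runs c1 s t s' \<Longrightarrow> runs (Cond b c1 c2) s (Suc t) s'"
| CondFalse: "\<not> bval b s \<Longrightarrow> runs c2 s t s' \<Longrightarrow> runs (Cond b c1 c2) s (Suc t) s'"
| WhileFalse: "\<not> bval b s \<Longrightarrow> runs (While b c) s 1 s"
| WhileTrue: "bval b s \<Longrightarrow> runs c s t1 s' \<Longrightarrow> runs (While b c) s' t2 s'' \<Longrightarrow>
    runs (While b c) s (Suc (t1 + t2)) s''"

inductive_cases Skip_runsE: "runs Skip s t s'"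
inductive_cases IAssign_runsE: "runs (IAssign x a e) s t s'"
inductive_cases RAssign_runsE: "runs (RAssign x a e) s t s'"
inductive_cases Seq_runsE: "runs (Seq c1 c2) s t s'"
inductive_cases Cond_runsE: "runs (Cond b c1 c2) s t s'"
inductive_cases While_runsE: "runs (While b c) s t s'"

lemma runs_deterministic:
  "runs c s t s' \<Longrightarrow> runs c s u s'' \<Longrightarrow> u = t \<and> s'' = s'"
proof (induction arbitrary: u s'' rule: runs.induct)
  case (Skip s)
  then show ?case by (rule Skip_runsE) simp
next
  case (IAssign x a e s)
  then show ?case by (rule IAssign_runsE) simp
next
  case (RAssign x a e s)
  then show ?case by (rule RAssign_runsE) simp
next
  case (Seq c1 s t1 s' c2 t2 s2)
  from Seq.prems show ?case by (rule Seq_runsE) (use Seq.IH in blast)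
next
  case (CondTrue b s c1 t s' c2)
  from CondTrue.prems show ?case by (rule Cond_runsE) (use CondTrue.hyps CondTrue.IH in blast)+
next
  case (CondFalse b s c2 t s' c1)
  from CondFalse.prems show ?case by (rule Cond_runsE) (use CondFalse.hyps CondFalse.IH in blast)+
next
  case (WhileFalse b s c)
  from WhileFalse.prems show ?case by (rule While_runsE) (use WhileFalse.hyps in simp_all)
next
  case (WhileTrue b s c t1 s' t2 s2)
  from WhileTrue.prems show ?case
    by (rule While_runsE) (use WhileTrue.hyps WhileTrue.IH in blast)+
qed

text \<open>The input consists of the items, numbered \<open>0, \<dots>, n - 1\<close>. The fixed real parameters
  \<open>\<beta>\<close> and \<open>\<epsilon>\<close> are preloaded since they need not be rational literals. All other cells contain 0.
  The resulting packing is read off the array \<open>bin\<close>.\<close>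

definition input_state :: "real \<Rightarrow> real \<Rightarrow> nat \<Rightarrow> nat bp_instance \<Rightarrow> state" where
  "input_state \<beta> \<epsilon> n I =
     \<lparr>nats = (\<lambda>x i.
        if x = ''n'' \<and> i = 0 then n
        else if x = ''colour'' \<and> i < n then item_colour I i
        else 0),
      reals = (\<lambda>x i.
        if x = ''beta'' \<and> i = 0 then \<beta>
        else if x = ''epsilon'' \<and> i = 0 then \<epsilon>
        else if x = ''size'' \<and> i < n then item_size I i
        else 0)\<rparr>"

definition output_packing :: "state \<Rightarrow> nat \<Rightarrow> nat" where
  "output_packing s i = nats s ''bin'' i"

end

theory Submission
  imports Defs "HOL-Combinatorics.List_Permutation"
begin

text \<open>Large items (size above \<open>1 / N\<^sup>2\<close>) are sorted by colour and decreasing size and get their rank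
  as a key; the small items of each colour are greedily glued to blocks of size at most \<open>1 / N\<close>, and
  all items of a block share a key. By linear grouping within each colour (every large item moves to
  the bin of the item one group earlier, the first group and the surplus blocks go to fresh bins),
  any packing induces an assignment of keys to bins that stays feasible when keys of the same group
  are permuted, and every count of bins grows by a factor \<open>1 + O(1 / N)\<close> and \<open>O(1)\<close>. As only
  constantly many types of bins occur, numbering the bins type by type turns the assignment, up to
  such a permutation, into a concatenation of constantly many runs of consecutive bins.
  The program enumerates all such lists of runs, of which there are polynomially many. A first
  search finds for each colour the least number of bins met, an estimate of \<open>OPT(I\<^sub>c)\<close>; a second
  one minimises the number of bins subject to the colour stretch relative to these estimates.\<close>

section \<open>Rearranging an assignment into few runs\<close>

text \<open>Groups, bin types and permutations exist only in the analysis; the program computes keys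
  and tries run lists blindly, so the machine never has to round a real or divide. The thresholds
  fit together: every key reserves at least 1 / N^2 of a bin, so a bin holds at most N^2 keys and
  the number of types is a constant; a glued item is at most 1 / N^2, so a finished block wastes at
  most a fraction 1 / N of its size; and since a colour of volume V has at most N^2 V large items,
  N^3 groups leave at most V / N + 1 items per group. The colour stretch shapes the rest. Shifting
  and permuting must stay within a colour, and blocks of colour c may refill only the room left by
  small items of colour c; otherwise bins would acquire new colours and the number of bins of a
  colour could not be controlled. As OPT(I_c) itself is unknown, the estimates are taken over
  guesses that pack all of I, and different colours may attain theirs at different guesses.\<close>

fun eval_runs :: "(nat \<times> nat) list \<Rightarrow> nat \<Rightarrow> nat" where
  "eval_runs [] q = 0"
| "eval_runs ((a, l) # ps) q = (if q < l then a + q else eval_runs ps (q - l))"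

text \<open>A list of runs is a run-length encoding of a list of labels, and
  \<open>eval_runs\<close> decodes one position without expanding it. Beyond the end it falls back
  to 0, hence the bound on q.\<close>

lemma eval_runs_nth:
  assumes "q < length (concat (map (\<lambda>(a, l). [a..<a + l]) ps))"
  shows "eval_runs ps q = concat (map (\<lambda>(a, l). [a..<a + l]) ps) ! q"
  using assms by (induction ps q rule: eval_runs.induct) (auto simp: nth_append)

lemma count_list_concat: "count_list (concat xss) x = (\<Sum>xs\<leftarrow>xss. count_list xs x)"
  by (induction xss) auto

lemma count_list_distinct: "distinct xs \<Longrightarrow> count_list xs x = of_bool (x \<in> set xs)"
  by (induction xs) auto

text \<open>Number each bin by its position in the concatenated list: every segment
  \<open>L T\<close> then occupies consecutive positions.\<close>

lemma map_concat_consecutive: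
  assumes "distinct (concat (map L ts))"
  obtains lab :: "'b \<Rightarrow> nat" where
    "inj_on lab (set (concat (map L ts)))"
    "\<And>T. T \<in> set ts \<Longrightarrow> \<exists>a \<le> length (concat (map L ts)). map lab (L T) = [a..<a + length (L T)]"
proof -
  define bl where "bl = concat (map L ts)"
  define lab where "lab b = (THE i. i < length bl \<and> bl ! i = b)" for b
  have d: "distinct bl" using assms by (simp add: bl_def)
  have lab_nth: "lab (bl ! i) = i" if "i < length bl" for i
    unfolding lab_def using that d by (intro the_equality) (auto simp: nth_eq_iff_index_eq)
  have lab: "lab b < length bl \<and> bl ! lab b = b" if "b \<in> set bl" for b
    using that lab_nth by (metis in_set_conv_nth)
  show ?thesis
  proof (rule that[of lab, folded bl_def])
    show "inj_on lab (set bl)" by (rule inj_on_inverseI[of _ "\<lambda>i. bl ! i"]) (use lab in auto)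
    fix T assume "T \<in> set ts"
    then obtain us vs where "ts = us @ T # vs" by (meson split_list)
    then have bl: "bl = concat (map L us) @ L T @ concat (map L vs)" by (simp add: bl_def)
    have "map lab (L T) = [length (concat (map L us))..<length (concat (map L us)) + length (L T)]"
    proof (rule nth_equalityI; simp)
      fix i assume "i < length (L T)"
      then show "lab (L T ! i) = length (concat (map L us)) + i"
        using lab_nth[of "length (concat (map L us)) + i"] by (simp add: bl nth_append)
    qed
    then show "\<exists>a\<le>length bl. map lab (L T) = [a..<a + length (L T)]"
      by (intro exI[of _ "length (concat (map L us))"]) (simp add: bl)
  qed
qed

lemma sorted_concat_class:
  assumes "\<And>h x y. (x, y) \<in> set (g h) \<Longrightarrow> y = h"
  shows "sorted (map snd (concat (map g [0..<H])))"
proof (induction H)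
  case (Suc H)
  have "map snd (g H) = replicate (length (g H)) H"
    using assms by (intro replicate_eqI) auto
  then have "sorted (map snd (g H))" by simp
  moreover have "\<forall>y\<in>snd ` set (concat (map g [0..<H])). y < H" using assms by fastforce
  moreover have "\<forall>y\<in>snd ` set (g H). y = H" using assms by auto
  ultimately show ?case using Suc by (auto simp: sorted_append less_imp_le)
qed auto

lemma distinct_concat_map:
  assumes "distinct ts" "\<And>T. T \<in> set ts \<Longrightarrow> distinct (L T)"
    and "\<And>T T' b. b \<in> set (L T) \<Longrightarrow> b \<in> set (L T') \<Longrightarrow> T = T'"
  shows "distinct (concat (map L ts))"
  using assms(1,2) by (induction ts) (use assms(3) in auto)

lemma concat_map_concat: "concat (map f (concat xss)) = concat (map (\<lambda>xs. concat (map f xs)) xss)"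
  by (induction xss) auto

text \<open>Bins with the same number of keys in each class are numbered consecutively, so one copy
  of class h in every bin of a type is a single run. Listing these runs class by class uses up
  exactly the keys of each class in their order, because \<open>cl\<close> is monotone;
  \<open>\<rho>\<close> records whose place a key takes. The number of runs does not depend on
  K.\<close>

lemma few_runs:
  fixes cl :: "nat \<Rightarrow> nat" and F\<^sub>0 :: "nat \<Rightarrow> 'b"
  assumes mono: "mono_on {..<K} cl" and cl: "\<And>\<kappa>. \<kappa> < K \<Longrightarrow> cl \<kappa> < H"
    and R: "\<And>b h. card {\<kappa>. \<kappa> < K \<and> F\<^sub>0 \<kappa> = b \<and> cl \<kappa> = h} \<le> R"
  obtains ps \<pi> \<rho> where
    "length ps = H * ((R + 1) ^ H * R)" "\<And>a l. (a, l) \<in> set ps \<Longrightarrow> a \<le> K \<and> l \<le> K"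
    "inj_on \<pi> (F\<^sub>0 ` {..<K})" "bij_betw \<rho> {..<K} {..<K}"
    "\<And>\<kappa>. \<kappa> < K \<Longrightarrow> cl (\<rho> \<kappa>) = cl \<kappa>"
    "\<And>\<kappa>. \<kappa> < K \<Longrightarrow> eval_runs ps \<kappa> = \<pi> (F\<^sub>0 (\<rho> \<kappa>))"
proof -
  define mult where "mult b h = card {\<kappa>. \<kappa> < K \<and> F\<^sub>0 \<kappa> = b \<and> cl \<kappa> = h}" for b h
  define BB where "BB = F\<^sub>0 ` {..<K}"
  \<comment> \<open>\<open>restrict\<close> makes the type of a bin an element of an extensional
    function space, which is finite and can be listed in \<open>ts\<close>.\<close>
  define tv where "tv b = restrict (mult b) {..<H}" for b
  have finB: "finite BB" and cardB: "card BB \<le> K"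
    unfolding BB_def using card_image_le[of "{..<K}" F\<^sub>0] by auto
  have "finite ({..<H} \<rightarrow>\<^sub>E {..R})" by (intro finite_PiE) auto
  from finite_distinct_list[OF this]
  obtain ts where ts: "set ts = {..<H} \<rightarrow>\<^sub>E {..R}" "distinct ts" by blast
  have len_ts: "length ts = (R + 1) ^ H"
    using distinct_card[OF ts(2)] by (simp add: ts(1) card_funcsetE)
  have tv: "tv b \<in> set ts" for b
    unfolding ts tv_def mult_def using R by auto
  have "\<exists>L. \<forall>T. set (L T) = {b \<in> BB. tv b = T} \<and> distinct (L T)"
    by (intro choice allI finite_distinct_list) (use finB in auto)
  then obtain L where L: "\<And>T. set (L T) = {b \<in> BB. tv b = T}" "\<And>T. distinct (L T)" by blast
  have dbl: "distinct (concat (map L ts))"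
    by (rule distinct_concat_map) (use ts L in auto)
  have sbl: "set (concat (map L ts)) = BB" using L tv by auto
  have lbl: "length (concat (map L ts)) \<le> K"
    using distinct_card[OF dbl] sbl cardB by simp
  obtain lab where lab: "inj_on lab BB"
    and lab_upt: "\<And>T. T \<in> set ts \<Longrightarrow> \<exists>a \<le> K. map lab (L T) = [a..<a + length (L T)]"
    using map_concat_consecutive[OF dbl] unfolding sbl using lbl by (metis order_trans)
  obtain st where st: "\<And>T. T \<in> set ts \<Longrightarrow> st T \<le> K \<and> map lab (L T) = [st T..<st T + length (L T)]"
    using lab_upt by metis
  have lenL: "length (L T) \<le> K" for T
  proof -
    have "length (L T) = card {b \<in> BB. tv b = T}" using L distinct_card by metis
    also have "\<dots> \<le> card BB" by (intro card_mono finB) auto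
    finally show ?thesis using cardB by simp
  qed
  \<comment> \<open>The pair (T, r) stands for the r-th copy placed in all bins of type T. Letting r
    range up to R for every T, with an empty run when r \<ge> T h, gives the same number of runs for
    every input.\<close>
  define pr where "pr = List.product ts [0..<R]"
  define g where "g h = concat (map (\<lambda>(T, r). if r < T h then map (\<lambda>b. (b, h)) (L T) else []) pr)" for h
  define xs where "xs = concat (map g [0..<H])"
  define ys where "ys = map (\<lambda>\<kappa>. (F\<^sub>0 \<kappa>, cl \<kappa>)) [0..<K]"
  define ps where "ps = concat (map (\<lambda>h. map (\<lambda>(T, r). (st T, if r < T h then length (L T) else 0)) pr) [0..<H])"
  have pr: "distinct pr" "set pr = set ts \<times> {..<R}" "length pr = (R + 1) ^ H * R"
    unfolding pr_def using ts by (auto simp: distinct_product len_ts)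
  have g_snd: "y = h" if "(x, y) \<in> set (g h)" for x y h
    using that unfolding g_def by (auto split: if_splits)
  \<comment> \<open>A bin occurs in \<open>g h\<close> only through its own type
    \<open>tv b\<close>, once for each r below the multiplicity of h in that type.\<close>
  have cnt_g: "count_list (g h') (b, h) = (if h' = h \<and> b \<in> BB then mult b h else 0)" if "h' < H" for b h h'
  proof -
    have 1: "count_list (map (\<lambda>b. (b, h')) (L T)) (b, h) = of_bool (h' = h \<and> b \<in> BB \<and> tv b = T)" for T
      using L by (subst count_list_distinct) (auto simp: distinct_map inj_on_def)
    have "count_list (g h') (b, h) =
        (\<Sum>(T, r)\<leftarrow>pr. if r < T h' then of_bool (h' = h \<and> b \<in> BB \<and> tv b = T) else 0)"
      unfolding g_def count_list_concat map_map
      by (intro arg_cong[of _ _ sum_list] map_cong refl) (auto simp: 1)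
    also have "\<dots> = (\<Sum>(T, r)\<in>set pr. if r < T h' then of_bool (h' = h \<and> b \<in> BB \<and> tv b = T) else 0)"
      using pr(1) by (simp add: sum.distinct_set_conv_list)
    also have "\<dots> = (\<Sum>T\<in>set ts. \<Sum>r<R. if r < T h' then of_bool (h' = h \<and> b \<in> BB \<and> tv b = T) else 0)"
      unfolding pr by (rule sum.cartesian_product[symmetric])
    also have "\<dots> = (\<Sum>T\<in>set ts. if T = tv b then \<Sum>r<R. if r < tv b h' then of_bool (h' = h \<and> b \<in> BB) else 0 else 0)"
      by (intro sum.cong) auto
    also have "\<dots> = (\<Sum>r<R. if r < tv b h' then of_bool (h' = h \<and> b \<in> BB) else 0)"
      using tv by simp
    also have "\<dots> = (\<Sum>r\<in>{..<R} \<inter> {r. r < mult b h'}. of_bool (h' = h \<and> b \<in> BB))"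
      using that by (subst sum.inter_restrict) (auto simp: tv_def intro!: sum.cong)
    also have "{..<R} \<inter> {r. r < mult b h'} = {..<mult b h'}"
      using R[of b h'] by (auto simp: mult_def)
    finally show ?thesis by simp
  qed
  have mult0: "mult b h = 0" if "\<not> (h < H \<and> b \<in> BB)" for b h
    using that cl by (auto simp: mult_def BB_def)
  have "count_list xs (b, h) = count_list ys (b, h)" for b h
  proof -
    have "count_list xs (b, h) = (\<Sum>h'<H. count_list (g h') (b, h))"
      unfolding xs_def count_list_concat by (simp add: sum_list_distinct_conv_sum_set atLeast0LessThan comp_def)
    also have "\<dots> = (\<Sum>h'<H. if h' = h then (if b \<in> BB then mult b h else 0) else 0)"
      by (intro sum.cong) (auto simp: cnt_g)
    also have "\<dots> = mult b h" using mult0[of h b] by auto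
    also have "\<dots> = length (filter (\<lambda>\<kappa>. (b, h) = (F\<^sub>0 \<kappa>, cl \<kappa>)) [0..<K])"
      unfolding mult_def by (subst distinct_card[symmetric]) (auto intro!: arg_cong[of _ _ card])
    also have "\<dots> = count_list ys (b, h)"
      unfolding ys_def count_list_eq_length_filter by (simp add: filter_map comp_def)
    finally show ?thesis .
  qed
  \<comment> \<open>Both lists are sorted by class and contain the same pairs, so their class
    sequences coincide position by position, and any permutation matching the lists preserves
    classes.\<close>
  then have ms: "mset xs = mset ys"
    by (intro multiset_eqI) (auto simp: count_mset)
  have len: "length xs = K" using mset_eq_length[OF ms] by (simp add: ys_def)
  have "sorted (map snd xs)" unfolding xs_def by (rule sorted_concat_class) (rule g_snd)
  moreover have "sorted (map snd ys)"
    using mono by (auto simp: ys_def sorted_iff_nth_mono monotone_on_def)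
  moreover have "mset (map snd xs) = mset (map snd ys)" using ms by (simp only: mset_map)
  ultimately have "map snd xs = map snd ys"
    by (metis properties_for_sort sorted_sort_id)
  then have snd_xs: "snd (xs ! \<kappa>) = cl \<kappa>" if "\<kappa> < K" for \<kappa>
    using that len by (metis (no_types, lifting) add_0 diff_zero length_map length_upt nth_map nth_upt snd_conv ys_def)
  from permutation_Ex_bij[OF ms] obtain \<rho>
    where \<rho>: "bij_betw \<rho> {..<K} {..<K}" "\<And>i. i < K \<Longrightarrow> xs ! i = ys ! \<rho> i"
    using len by (auto simp: ys_def)
  have \<rho>K: "\<rho> i < K" if "i < K" for i using \<rho>(1) that by (auto simp: bij_betw_def)
  have "concat (map (\<lambda>(a, l). [a..<a + l]) ps) = map lab (map fst xs)"
  proof -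
    have "concat (map (\<lambda>(a, l). [a..<a + l]) (map (\<lambda>(T, r). (st T, if r < T h then length (L T) else 0)) pr))
       = map lab (map fst (g h))" for h
      unfolding g_def map_concat map_map
      by (intro arg_cong[of _ _ concat] map_cong refl) (use st pr(2) in \<open>auto simp: comp_def\<close>)
    then have "concat (map (\<lambda>h. concat (map (\<lambda>(a, l). [a..<a + l])
        (map (\<lambda>(T, r). (st T, if r < T h then length (L T) else 0)) pr))) [0..<H]) =
      concat (map (\<lambda>h. map lab (map fst (g h))) [0..<H])" by (simp only:)
    moreover have "map lab (map fst xs) = concat (map (\<lambda>h. map lab (map fst (g h))) [0..<H])"
      unfolding xs_def by (simp only: map_concat map_map comp_def)
    ultimately show ?thesis
      unfolding ps_def concat_map_concat by (simp only: map_map comp_def)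
  qed
  note runs_eq = this
  show ?thesis
  proof (rule that[of ps lab \<rho>])
    show "length ps = H * ((R + 1) ^ H * R)"
      unfolding ps_def by (simp add: length_concat comp_def pr sum_list_triv)
    show "a \<le> K \<and> l \<le> K" if "(a, l) \<in> set ps" for a l
      using that st lenL pr(2) by (auto simp: ps_def split: if_splits)
    show "inj_on lab (F\<^sub>0 ` {..<K})" using lab by (simp add: BB_def)
    show "bij_betw \<rho> {..<K} {..<K}" by fact
    show "cl (\<rho> \<kappa>) = cl \<kappa>" if "\<kappa> < K" for \<kappa>
      using snd_xs[OF that] \<rho>(2)[OF that] \<rho>K[OF that] by (simp add: ys_def)
    show "eval_runs ps \<kappa> = lab (F\<^sub>0 (\<rho> \<kappa>))" if "\<kappa> < K" for \<kappa>
      using \<rho>(2)[OF that] \<rho>K[OF that] that len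
      by (subst eval_runs_nth) (simp_all add: runs_eq ys_def del: map_map)
  qed
qed

section \<open>From packings to assignments of keys\<close>

definition large_item :: "nat \<Rightarrow> (nat \<Rightarrow> real) \<Rightarrow> nat \<Rightarrow> bool" where
  "large_item N sz e \<longleftrightarrow> 1 / real N ^ 2 < sz e"

text \<open>Colour comes first, so that each colour owns an interval of keys; ties in size are
  broken by the index, which makes the order strict and total and the ranks distinct.\<close>

definition before :: "(nat \<Rightarrow> nat) \<Rightarrow> (nat \<Rightarrow> real) \<Rightarrow> nat \<Rightarrow> nat \<Rightarrow> bool" where
  "before col sz f e \<longleftrightarrow>
     col f < col e \<or> (col f = col e \<and> (sz e < sz f \<or> (\<not> sz f < sz e \<and> f < e)))"

text \<open>The blocks of colour c are numbered by the half-open interval from a to b. The last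
  block is exempt from the lower bound, and a < b grants every colour at least one block, possibly
  empty.\<close>

definition block_keys ::
  "nat \<Rightarrow> nat \<Rightarrow> (nat \<Rightarrow> nat) \<Rightarrow> (nat \<Rightarrow> real) \<Rightarrow> (nat \<Rightarrow> nat) \<Rightarrow> nat \<Rightarrow> nat \<Rightarrow> nat \<Rightarrow> bool" where
  "block_keys N n col sz key c a b \<longleftrightarrow> a < b \<and>
     (\<forall>e<n. \<not> large_item N sz e \<and> col e = c \<longrightarrow> a \<le> key e \<and> key e < b) \<and>
     (\<forall>\<kappa>. a \<le> \<kappa> \<and> \<kappa> < b \<longrightarrow>
        (\<Sum>e | e < n \<and> \<not> large_item N sz e \<and> col e = c \<and> key e = \<kappa>. sz e) \<le> 1 / N \<and>
        (Suc \<kappa> < b \<longrightarrow> 1 / N - 1 / real N ^ 2 \<le>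
           (\<Sum>e | e < n \<and> \<not> large_item N sz e \<and> col e = c \<and> key e = \<kappa>. sz e)))"

text \<open>The analysis holds for any keys meeting this specification, so it can ignore how the
  program computes them. The value of \<open>st 0\<close> places the blocks directly after the ranks
  of the large items.\<close>

definition valid_keys ::
  "nat \<Rightarrow> nat \<Rightarrow> nat \<Rightarrow> (nat \<Rightarrow> nat) \<Rightarrow> (nat \<Rightarrow> real) \<Rightarrow> (nat \<Rightarrow> nat) \<Rightarrow> (nat \<Rightarrow> nat) \<Rightarrow> bool" where
  "valid_keys N m n col sz key st \<longleftrightarrow>
     (\<forall>e<n. large_item N sz e \<longrightarrow> key e = card {f. f < n \<and> large_item N sz f \<and> before col sz f e}) \<and>
     st 0 = card {e. e < n \<and> large_item N sz e} \<and>
     (\<forall>c\<le>m. block_keys N n col sz key c (st c) (st (Suc c)))"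

text \<open>Lay intervals of length \<open>cap b\<close> end to end and send each slot t to the
  owner of its interval.\<close>

lemma spread:
  fixes cap :: "'b \<Rightarrow> nat"
  assumes "finite B"
  obtains g where "\<And>t. t < sum cap B \<Longrightarrow> g t \<in> B"
    "\<And>b. card {t. t < sum cap B \<and> g t = b} \<le> cap b"
proof -
  have "\<exists>g. (\<forall>t < sum cap B. g t \<in> B \<and> 0 < cap (g t)) \<and> (\<forall>b. card {t. t < sum cap B \<and> g t = b} \<le> cap b)"
    using assms
  proof (induction B)
    case (insert a B)
    then obtain g where g: "\<And>t. t < sum cap B \<Longrightarrow> g t \<in> B \<and> 0 < cap (g t)"
      "\<And>b. card {t. t < sum cap B \<and> g t = b} \<le> cap b" by blast
    define g' where "g' t = (if t < sum cap B then g t else a)" for t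
    have "card {t. t < sum cap (insert a B) \<and> g' t = b} \<le> cap b" for b
    proof (cases "b = a")
      case True
      have "{t. t < sum cap (insert a B) \<and> g' t = b} \<subseteq> {sum cap B..<sum cap B + cap a}"
        using insert(2) g(1) by (fastforce simp: g'_def True insert(1) split: if_splits)
      then have "card {t. t < sum cap (insert a B) \<and> g' t = b} \<le> card {sum cap B..<sum cap B + cap a}"
        by (intro card_mono) auto
      then show ?thesis by (simp add: True)
    next
      case False
      then have "{t. t < sum cap (insert a B) \<and> g' t = b} \<subseteq> {t. t < sum cap B \<and> g t = b}"
        by (auto simp: g'_def split: if_splits)
      then have "card {t. t < sum cap (insert a B) \<and> g' t = b} \<le> card {t. t < sum cap B \<and> g t = b}"
        by (intro card_mono) auto
      then show ?thesis using g(2)[of b] by simp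
    qed
    moreover have "\<forall>t < sum cap (insert a B). g' t \<in> insert a B \<and> 0 < cap (g' t)"
      using insert(1,2) g(1) by (auto simp: g'_def)
    ultimately show ?case by blast
  qed auto
  then show ?thesis using that by blast
qed

lemma sum_group_image:
  fixes f :: "'a \<Rightarrow> real"
  assumes "finite A" "finite B" "\<And>e. e \<in> A \<Longrightarrow> g e \<in> B"
  shows "(\<Sum>b\<in>B. \<Sum>e | e \<in> A \<and> g e = b. f e) = sum f A"
  using assms by (intro sum.group) auto

locale keyed_instance =
  fixes N m n :: nat and col :: "nat \<Rightarrow> nat" and sz :: "nat \<Rightarrow> real" and key st :: "nat \<Rightarrow> nat"
  assumes N: "2 \<le> N"
    and sz_pos: "\<And>e. e < n \<Longrightarrow> 0 < sz e" and sz_le: "\<And>e. e < n \<Longrightarrow> sz e \<le> 1"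
    and col_le: "\<And>e. e < n \<Longrightarrow> col e \<le> m"
    and keys: "valid_keys N m n col sz key st"
begin

abbreviation "lg \<equiv> large_item N sz"
abbreviation "bef \<equiv> before col sz"

text \<open>Linear grouping: the large items of colour \<open>c\<close> have the keys from \<open>S c\<close> on and form at most \<open>G\<close>
  groups of \<open>kk c\<close> items. Keys are interchangeable if \<open>cl\<close> agrees on them.\<close>

definition "LL = {e. e < n \<and> lg e}"
definition "nL = card LL"
definition "S c = card {e \<in> LL. col e < c}"
definition "K = st (Suc m)"
definition "it \<kappa> = inv_into LL key \<kappa>"
definition "w \<kappa> = (\<Sum>e | e < n \<and> key e = \<kappa>. sz e)"
definition "cs \<kappa> = (LEAST c. \<kappa> < st (Suc c))"
definition "kcol \<kappa> = (if \<kappa> < nL then col (it \<kappa>) else cs \<kappa>)"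
definition "nc c = card {e \<in> LL. col e = c}"
definition "G = N ^ 3"
definition "kk c = nc c div G + 1"
definition "cl \<kappa> = (if \<kappa> < nL then col (it \<kappa>) * G + (\<kappa> - S (col (it \<kappa>))) div kk (col (it \<kappa>))
   else (m + 1) * G + cs \<kappa>)"

section \<open>Ranks, colour intervals and classes of keys\<close>

lemma finLL: "finite LL" by (simp add: LL_def)

lemma key_LL: "e \<in> LL \<Longrightarrow> key e = card {f \<in> LL. bef f e}"
  using keys by (auto simp: valid_keys_def LL_def conj_ac)

lemma bef_irrefl: "\<not> bef e e" by (simp add: before_def)
lemma bef_trans: "bef e f \<Longrightarrow> bef f g \<Longrightarrow> bef e g" by (auto simp: before_def)
lemma bef_total: "e \<noteq> f \<Longrightarrow> bef e f \<or> bef f e" by (auto simp: before_def)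

lemma key_mono: assumes "e \<in> LL" "f \<in> LL" "bef e f" shows "key e < key f"
proof -
  have "{g \<in> LL. bef g e} \<subset> {g \<in> LL. bef g f}"
    using assms bef_irrefl bef_trans by blast
  then show ?thesis using assms by (simp add: key_LL psubset_card_mono finLL)
qed

lemma key_less_iff: "e \<in> LL \<Longrightarrow> f \<in> LL \<Longrightarrow> key e < key f \<longleftrightarrow> bef e f"
  by (metis bef_total key_mono less_irrefl less_asym)

lemma bij_key: "bij_betw key LL {..<nL}"
proof -
  have inj: "inj_on key LL"
    by (rule inj_onI) (metis bef_total key_mono less_irrefl_nat)
  have "key ` LL \<subseteq> {..<nL}"
  proof safe
    fix e assume "e \<in> LL"
    then have "{f \<in> LL. bef f e} \<subset> LL" using bef_irrefl by blast
    then show "key e < nL" using \<open>e \<in> LL\<close> by (simp add: key_LL nL_def psubset_card_mono finLL)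
  qed
  moreover have "card (key ` LL) = nL" using inj by (simp add: card_image nL_def)
  ultimately have "key ` LL = {..<nL}" by (simp add: card_subset_eq)
  then show ?thesis using inj by (simp add: bij_betw_def)
qed

lemma it: assumes "\<kappa> < nL" shows "it \<kappa> \<in> LL" "key (it \<kappa>) = \<kappa>"
proof -
  have "\<kappa> \<in> key ` LL" using bij_key assms by (auto simp: bij_betw_def)
  then show "it \<kappa> \<in> LL" "key (it \<kappa>) = \<kappa>" by (auto simp: it_def inv_into_into f_inv_into_f)
qed

lemma it_key: "e \<in> LL \<Longrightarrow> it (key e) = e"
  using bij_key by (simp add: it_def bij_betw_def)

lemma key_nL: "e \<in> LL \<Longrightarrow> key e < nL" using bij_key by (auto simp: bij_betw_def)

lemma S_mono: "c \<le> c' \<Longrightarrow> S c \<le> S c'"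
  unfolding S_def by (intro card_mono) (auto simp: finLL)

lemma S_Suc: "S (Suc c) = S c + nc c"
proof -
  have "{e \<in> LL. col e < Suc c} = {e \<in> LL. col e < c} \<union> {e \<in> LL. col e = c}" by auto
  then show ?thesis unfolding S_def nc_def by (simp, subst card_Un_disjoint) (auto simp: finLL)
qed

lemma S_key: assumes "e \<in> LL" shows "S (col e) \<le> key e" "key e < S (Suc (col e))"
proof -
  show "S (col e) \<le> key e" unfolding S_def key_LL[OF assms]
    by (intro card_mono) (auto simp: finLL before_def)
  have "{f \<in> LL. bef f e} \<subset> {f \<in> LL. col f < Suc (col e)}"
    using assms bef_irrefl by (auto simp: before_def)
  then show "key e < S (Suc (col e))" unfolding S_def key_LL[OF assms]
    by (intro psubset_card_mono) (auto simp: finLL)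
qed

lemma col_eq: assumes "e \<in> LL" "S c \<le> key e" "key e < S (Suc c)" shows "col e = c"
proof (rule ccontr)
  assume "col e \<noteq> c"
  then consider "Suc (col e) \<le> c" | "Suc c \<le> col e" by linarith
  then show False using S_key[OF assms(1)] S_mono assms(2,3) by cases (metis leD le_trans, metis leD le_trans)
qed

lemma S_it: assumes "\<kappa> < nL" shows "S (col (it \<kappa>)) \<le> \<kappa>" "\<kappa> < S (col (it \<kappa>)) + nc (col (it \<kappa>))"
  using S_key[OF it(1)[OF assms]] it(2)[OF assms] by (auto simp: S_Suc)

lemma kk_pos: "0 < kk c" by (simp add: kk_def)

lemma G_pos: "0 < G" using N by (simp add: G_def)

text \<open>The summand 1 in \<open>kk\<close> rounds the group size up, so G groups always cover
  the large items of the colour.\<close>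

lemma group_less: assumes "\<kappa> < nL"
  shows "(\<kappa> - S (col (it \<kappa>))) div kk (col (it \<kappa>)) < G"
proof -
  define c where "c = col (it \<kappa>)"
  have "\<kappa> - S c < nc c" using S_it[OF assms] by (simp add: c_def)
  also have "nc c < G * kk c" using G_pos dividend_less_times_div[of G "nc c"] by (simp add: kk_def algebra_simps)
  finally show ?thesis by (simp add: c_def less_mult_imp_div_less mult.commute)
qed

text \<open>Going back one group size from a key outside the first group cannot leave the interval
  of keys of its colour; truncated subtraction is exact here.\<close>

lemma prev_item:
  assumes "\<kappa> < nL" and "kk (col (it \<kappa>)) \<le> \<kappa> - S (col (it \<kappa>))"
  shows "col (it (\<kappa> - kk (col (it \<kappa>)))) = col (it \<kappa>)" "\<kappa> - kk (col (it \<kappa>)) < nL"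
    "kk (col (it \<kappa>)) \<le> \<kappa>" 
proof -
  define c where "c = col (it \<kappa>)"
  note s = S_it[OF assms(1), folded c_def]
  have 1: "\<kappa> - kk c < nL" "kk c \<le> \<kappa>" using assms by (auto simp: c_def)
  show "col (it (\<kappa> - kk (col (it \<kappa>)))) = col (it \<kappa>)"
    unfolding c_def[symmetric]
    by (rule col_eq) (use it[OF 1(1)] s assms(2) in \<open>auto simp: S_Suc c_def[symmetric]\<close>)
  show "\<kappa> - kk (col (it \<kappa>)) < nL" "kk (col (it \<kappa>)) \<le> \<kappa>" using 1 by (auto simp: c_def)
qed

lemma sz_antimono:
  assumes "\<kappa> \<le> \<kappa>'" "\<kappa>' < nL" "col (it \<kappa>) = col (it \<kappa>')"
  shows "sz (it \<kappa>') \<le> sz (it \<kappa>)"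
proof (cases "\<kappa> = \<kappa>'")
  case False
  then have "bef (it \<kappa>) (it \<kappa>')"
    using key_less_iff[of "it \<kappa>" "it \<kappa>'"] it[of \<kappa>] it[of \<kappa>'] assms by simp
  then show ?thesis using assms(3) by (auto simp: before_def)
qed auto

lemma st0: "st 0 = nL"
  using keys by (auto simp: valid_keys_def nL_def LL_def)

lemma st_less: "c \<le> m \<Longrightarrow> st c < st (Suc c)" using keys by (simp add: valid_keys_def block_keys_def)

lemma st_mono: "c \<le> c' \<Longrightarrow> c' \<le> Suc m \<Longrightarrow> st c \<le> st c'"
proof (induction c' rule: dec_induct)
  case (step c') then show ?case using st_less[of c'] by simp
qed auto

lemma nL_le_K: "nL < K"
  using st_mono[of 1 "Suc m"] st_less[of 0] by (simp add: K_def st0)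

lemma cs: assumes "nL \<le> \<kappa>" "\<kappa> < K"
  shows "cs \<kappa> \<le> m" "st (cs \<kappa>) \<le> \<kappa>" "\<kappa> < st (Suc (cs \<kappa>))"
proof -
  have ex: "\<kappa> < st (Suc m)" using assms by (simp add: K_def)
  show "\<kappa> < st (Suc (cs \<kappa>))" unfolding cs_def by (rule LeastI[of _ m]) (rule ex)
  show "cs \<kappa> \<le> m" unfolding cs_def by (rule Least_le) (rule ex)
  show "st (cs \<kappa>) \<le> \<kappa>"
  proof (cases "cs \<kappa>")
    case (Suc c)
    then have "\<not> \<kappa> < st (Suc c)" unfolding cs_def by (intro not_less_Least) simp
    then show ?thesis by (simp add: Suc)
  qed (simp add: st0 assms)
qed

lemma cs_eq: assumes "c \<le> m" "st c \<le> \<kappa>" "\<kappa> < st (Suc c)" shows "cs \<kappa> = c" "nL \<le> \<kappa>" "\<kappa> < K"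
proof -
  show "nL \<le> \<kappa>" using st_mono[of 0 c] assms by (simp add: st0)
  show "\<kappa> < K" using st_mono[of "Suc c" "Suc m"] assms by (simp add: K_def)
  show "cs \<kappa> = c" unfolding cs_def
  proof (rule Least_equality)
    show "\<kappa> < st (Suc c)" by (rule assms(3))
  next
    fix c' assume "\<kappa> < st (Suc c')"
    then show "c \<le> c'" using st_mono[of "Suc c'" c] assms by (metis le_trans linorder_not_less nat_le_linear not_less_eq_eq le_SucI leD)
  qed
qed

lemma small_key: assumes "e < n" "\<not> lg e"
  shows "st (col e) \<le> key e" "key e < st (Suc (col e))" "cs (key e) = col e" "nL \<le> key e" "key e < K"
proof -
  show 1: "st (col e) \<le> key e" "key e < st (Suc (col e))"
    using keys assms col_le[OF assms(1)] by (auto simp: valid_keys_def block_keys_def)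
  show "cs (key e) = col e" "nL \<le> key e" "key e < K"
    by (rule cs_eq[OF col_le[OF assms(1)] 1])+
qed

lemma key_K: assumes "e < n" shows "key e < K"
  using small_key(5)[OF assms] key_nL[of e] nL_le_K assms by (cases "lg e") (auto simp: LL_def)

lemma kcol_key: assumes "e < n" shows "kcol (key e) = col e"
proof (cases "lg e")
  case True
  then have "e \<in> LL" using assms by (simp add: LL_def)
  then show ?thesis by (simp add: kcol_def key_nL it_key)
qed (use small_key[OF assms] in \<open>simp add: kcol_def\<close>)

lemma w_large: assumes "\<kappa> < nL" shows "w \<kappa> = sz (it \<kappa>)"
proof -
  have "{e. e < n \<and> key e = \<kappa>} = {it \<kappa>}"
    using it[OF assms] it_key small_key(4) assms by (fastforce simp: LL_def)
  then show ?thesis by (simp add: w_def)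
qed

lemma w_small_eq: assumes "nL \<le> \<kappa>" "\<kappa> < K"
  shows "w \<kappa> = (\<Sum>e | e < n \<and> \<not> lg e \<and> col e = cs \<kappa> \<and> key e = \<kappa>. sz e)"
proof -
  have "{e. e < n \<and> key e = \<kappa>} = {e. e < n \<and> \<not> lg e \<and> col e = cs \<kappa> \<and> key e = \<kappa>}"
    using small_key(3) key_nL assms by (fastforce simp: LL_def)
  then show ?thesis by (simp add: w_def)
qed

lemma w_small: assumes "nL \<le> \<kappa>" "\<kappa> < K"
  shows "w \<kappa> \<le> 1 / N" "Suc \<kappa> < st (Suc (cs \<kappa>)) \<Longrightarrow> 1 / N - 1 / real N ^ 2 \<le> w \<kappa>"
  using cs[OF assms] keys unfolding w_small_eq[OF assms] valid_keys_def block_keys_def by blast+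

lemma cl_large_less: assumes "\<kappa> < nL" shows "cl \<kappa> < (m + 1) * G"
proof -
  have "cl \<kappa> < Suc (col (it \<kappa>)) * G" using group_less[OF assms] assms by (simp add: cl_def)
  also have "\<dots> \<le> (m + 1) * G"
    using it(1)[OF assms] col_le by (intro mult_le_mono1) (simp add: LL_def)
  finally show ?thesis .
qed

lemma cl_less: assumes "\<kappa> < K" shows "cl \<kappa> < (m + 1) * G + (m + 1)"
proof (cases "\<kappa> < nL")
  case False
  then show ?thesis using cs[of \<kappa>] assms by (simp add: cl_def)
qed (use cl_large_less[of \<kappa>] in linarith)

text \<open>Large keys precede blocks, both are ordered by colour, and groups are intervals within a
  colour. So each class is an interval of keys, as the rearrangement into runs requires.\<close>

lemma cl_mono: "mono_on {..<K} cl"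
proof (rule mono_onI)
  fix \<kappa> \<kappa>' assume *: "\<kappa> \<in> {..<K}" "\<kappa>' \<in> {..<K}" "\<kappa> \<le> \<kappa>'"
  consider "\<kappa>' < nL" | "\<kappa> < nL" "nL \<le> \<kappa>'" | "nL \<le> \<kappa>" using * by linarith
  then show "cl \<kappa> \<le> cl \<kappa>'"
  proof cases
    case 1
    then have 2: "\<kappa> < nL" using * by simp
    have "\<not> bef (it \<kappa>') (it \<kappa>)"
      using key_less_iff[of "it \<kappa>'" "it \<kappa>"] it[OF 1] it[OF 2] * by simp
    then have "col (it \<kappa>) \<le> col (it \<kappa>')" by (auto simp: before_def)
    then consider "col (it \<kappa>) = col (it \<kappa>')" | "Suc (col (it \<kappa>)) \<le> col (it \<kappa>')" by linarith
    then show ?thesis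
    proof cases
      case 1
      then show ?thesis using * 2 \<open>\<kappa>' < nL\<close> by (auto simp: cl_def intro!: div_le_mono diff_le_mono)
    next
      case 2
      then have "Suc (col (it \<kappa>)) * G \<le> col (it \<kappa>') * G" by (rule mult_le_mono1)
      then show ?thesis using group_less[OF \<open>\<kappa> < nL\<close>] \<open>\<kappa> < nL\<close> 1 by (simp add: cl_def)
    qed
  next
    case 2
    then show ?thesis using cl_large_less[of \<kappa>] by (simp add: cl_def)
  next
    case 3
    then have "\<kappa> < st (Suc (cs \<kappa>'))" using cs(3)[of \<kappa>'] * by simp
    then have "cs \<kappa> \<le> cs \<kappa>'" unfolding cs_def[of \<kappa>] by (rule Least_le)
    then show ?thesis using 3 * by (simp add: cl_def)
  qed
qed

lemma cl_eq_large:
  assumes "\<kappa> < nL" "\<kappa>' < K" "cl \<kappa> = cl \<kappa>'"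
  shows "\<kappa>' < nL" "col (it \<kappa>') = col (it \<kappa>)"
    "(\<kappa>' - S (col (it \<kappa>))) div kk (col (it \<kappa>)) = (\<kappa> - S (col (it \<kappa>))) div kk (col (it \<kappa>))"
proof -
  show l: "\<kappa>' < nL" using cl_large_less[OF assms(1)] assms by (auto simp: cl_def split: if_splits)
  have eq: "col (it \<kappa>) * G + (\<kappa> - S (col (it \<kappa>))) div kk (col (it \<kappa>)) =
    col (it \<kappa>') * G + (\<kappa>' - S (col (it \<kappa>'))) div kk (col (it \<kappa>'))"
    using assms l by (simp add: cl_def)
  \<comment> \<open>Group indices are below G, so division by G recovers the colour from the class
    number.\<close>
  have "col (it \<kappa>) = (col (it \<kappa>) * G + (\<kappa> - S (col (it \<kappa>))) div kk (col (it \<kappa>))) div G"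
    using group_less[OF assms(1)] by simp
  also have "\<dots> = col (it \<kappa>')" unfolding eq using group_less[OF l] by simp
  finally show c: "col (it \<kappa>') = col (it \<kappa>)" by simp
  show "(\<kappa>' - S (col (it \<kappa>))) div kk (col (it \<kappa>)) = (\<kappa> - S (col (it \<kappa>))) div kk (col (it \<kappa>))"
    using eq c by simp
qed

lemma cl_eq_small:
  assumes "nL \<le> \<kappa>" "\<kappa>' < K" "cl \<kappa> = cl \<kappa>'"
  shows "nL \<le> \<kappa>'" "cs \<kappa>' = cs \<kappa>"
  using assms cl_large_less[of \<kappa>'] by (auto simp: cl_def split: if_splits)

lemma kcol_cl: "\<kappa> < K \<Longrightarrow> \<kappa>' < K \<Longrightarrow> cl \<kappa> = cl \<kappa>' \<Longrightarrow> kcol \<kappa>' = kcol \<kappa>"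
  using cl_eq_large[of \<kappa> \<kappa>'] cl_eq_small[of \<kappa> \<kappa>'] by (cases "\<kappa> < nL") (auto simp: kcol_def)

text \<open>A key without an item can only be the last block of a colour, and there are m + 1 of
  those. This keeps the search range linear in n.\<close>

lemma K_le: "K \<le> n + m + 1"
proof -
  have "{..<K} \<subseteq> key ` {..<n} \<union> (\<lambda>c. st (Suc c) - 1) ` {..m}"
  proof
    fix \<kappa> assume "\<kappa> \<in> {..<K}"
    then have K: "\<kappa> < K" by simp
    show "\<kappa> \<in> key ` {..<n} \<union> (\<lambda>c. st (Suc c) - 1) ` {..m}"
    proof (cases "\<kappa> < nL")
      case True
      then show ?thesis using it[OF True] by (auto simp: LL_def intro!: image_eqI[of _ _ "it \<kappa>"])
    next
      case False
      show ?thesis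
      proof (cases "Suc \<kappa> < st (Suc (cs \<kappa>))")
        case True
        \<comment> \<open>By N \<ge> 2, a block that is not the last of its colour has positive load
          and hence an item.\<close>
        have "0 < 1 / real N - 1 / real N ^ 2" using N by (simp add: field_simps power2_eq_square)
        also have "\<dots> \<le> w \<kappa>" using w_small(2)[of \<kappa>] True False K by simp
        finally have "{e. e < n \<and> key e = \<kappa>} \<noteq> {}" unfolding w_def by (metis less_irrefl sum.empty)
        then show ?thesis by auto
      next
        case F: False
        then have "\<kappa> = st (Suc (cs \<kappa>)) - 1" using cs(3)[of \<kappa>] False K by simp
        then show ?thesis using cs(1)[of \<kappa>] False K by auto
      qed
    qed
  qed
  then have "card {..<K} \<le> card (key ` {..<n} \<union> (\<lambda>c. st (Suc c) - 1) ` {..m})"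
    by (intro card_mono) auto
  also have "\<dots> \<le> card (key ` {..<n}) + card ((\<lambda>c. st (Suc c) - 1) ` {..m})" by (rule card_Un_le)
  also have "\<dots> \<le> n + (m + 1)"
    using card_image_le[of "{..<n}" key] card_image_le[of "{..m}" "\<lambda>c. st (Suc c) - 1"] by simp
  finally show ?thesis by simp
qed

section \<open>Volume bounds on group sizes and block numbers\<close>

definition "vol c = (\<Sum>e | e < n \<and> col e = c. sz e)"
definition "W c = (\<Sum>e | e < n \<and> \<not> lg e \<and> col e = c. sz e)"

lemma W_le_vol: "W c \<le> vol c"
  unfolding W_def vol_def by (intro sum_mono2) (auto intro: less_imp_le sz_pos)

lemma nc_le_vol: "nc c \<le> real N ^ 2 * vol c"
proof -
  have "real (nc c) * (1 / real N ^ 2) \<le> (\<Sum>e | e \<in> LL \<and> col e = c. sz e)"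
    unfolding nc_def by (rule sum_bounded_below) (auto simp: LL_def large_item_def)
  also have "\<dots> \<le> vol c"
    unfolding vol_def by (intro sum_mono2) (auto simp: LL_def intro: less_imp_le sz_pos)
  finally show ?thesis using N by (simp add: field_simps)
qed

text \<open>Each large item exceeds 1 / N^2, so their number is at most N^2 times the volume, and
  dividing by G = N^3 leaves volume / N. This is the price of sending the first group to fresh
  bins.\<close>

lemma kk_le: "kk c \<le> vol c / N + 1"
proof -
  have "real (nc c div G) \<le> nc c / G" by (rule of_nat_div_le_of_nat)
  also have "\<dots> \<le> real N ^ 2 * vol c / G" using nc_le_vol by (intro divide_right_mono) auto
  also have "\<dots> = vol c / N" using N by (simp add: G_def power2_eq_square power3_eq_cube)
  finally show ?thesis by (simp add: kk_def)
qed

text \<open>Every block but the last has load at least (N - 1) / N^2, and all these loads together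
  are at most \<open>W c\<close>.\<close>

lemma blocks_le:
  assumes "c \<le> m"
  shows "real (st (Suc c) - st c - 1) \<le> W c * real N ^ 2 / (real N - 1)"
proof -
  define X where "X = {st c..<st (Suc c) - 1}"
  have "card X * (1 / N - 1 / real N ^ 2) \<le> sum w X"
  proof (rule sum_bounded_below)
    fix \<kappa> assume "\<kappa> \<in> X"
    then have 1: "st c \<le> \<kappa>" "Suc \<kappa> < st (Suc c)" by (auto simp: X_def)
    then have 2: "cs \<kappa> = c" "nL \<le> \<kappa>" "\<kappa> < K" using cs_eq[OF assms, of \<kappa>] by auto
    show "1 / N - 1 / real N ^ 2 \<le> w \<kappa>" using w_small(2)[OF 2(2,3)] 1 2 by simp
  qed
  also have "sum w X = (\<Sum>\<kappa>\<in>X. \<Sum>e | e \<in> {e. e < n \<and> \<not> lg e \<and> col e = c \<and> key e \<in> X} \<and> key e = \<kappa>. sz e)"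
  proof (rule sum.cong)
    fix \<kappa> assume X: "\<kappa> \<in> X"
    then have 1: "st c \<le> \<kappa>" "\<kappa> < st (Suc c)" by (auto simp: X_def)
    then have 2: "cs \<kappa> = c" "nL \<le> \<kappa>" "\<kappa> < K" using cs_eq[OF assms, of \<kappa>] by auto
    show "w \<kappa> = (\<Sum>e | e \<in> {e. e < n \<and> \<not> lg e \<and> col e = c \<and> key e \<in> X} \<and> key e = \<kappa>. sz e)"
      unfolding w_small_eq[OF 2(2,3)] by (rule sum.cong) (use X 2 in auto)
  qed simp
  also have "\<dots> = (\<Sum>e | e < n \<and> \<not> lg e \<and> col e = c \<and> key e \<in> X. sz e)"
    by (rule sum_group_image) (auto simp: X_def)
  also have "\<dots> \<le> W c"
    unfolding W_def by (intro sum_mono2) (auto intro: less_imp_le sz_pos)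
  finally have "real (st (Suc c) - st c - 1) * (1 / N - 1 / real N ^ 2) \<le> W c"
    by (simp add: X_def)
  moreover have "1 / real N - 1 / real N ^ 2 = (real N - 1) / real N ^ 2"
    using N by (simp add: field_simps power2_eq_square)
  ultimately show ?thesis using N by (simp add: field_simps)
qed

section \<open>The assignment induced by a packing, its loads and its cost\<close>

context
  fixes Q :: "nat \<Rightarrow> nat"
  assumes Q: "\<And>b. (\<Sum>e | e < n \<and> Q e = b. sz e) \<le> 1"
begin

definition "QB = Q ` {..<n}"
definition "Qc c = Q ` {e. e < n \<and> col e = c}"
definition "wb c b = (\<Sum>e | e < n \<and> \<not> lg e \<and> col e = c \<and> Q e = b. sz e)"
text \<open>The number of blocks of size 1 / N that fit into the room which the small items of
  colour c leave in bin b; rounding down keeps the bin feasible and loses less than one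
  block.\<close>

definition "cap c b = nat \<lfloor>N * wb c b\<rfloor>"
definition "len c = sum (cap c) QB"
definition "g c = (SOME g. (\<forall>t < len c. g t \<in> QB) \<and> (\<forall>b. card {t. t < len c \<and> g t = b} \<le> cap c b))"

lemma finQB: "finite QB" by (simp add: QB_def)
lemma finQc: "finite (Qc c)" by (simp add: Qc_def)
lemma Qc_sub: "Qc c \<subseteq> QB" by (auto simp: Qc_def QB_def)

lemma vol_le: "vol c \<le> card (Qc c)"
proof -
  have "vol c = (\<Sum>b\<in>Qc c. \<Sum>e | e \<in> {e. e < n \<and> col e = c} \<and> Q e = b. sz e)"
    unfolding vol_def by (rule sum_group_image[symmetric]) (auto simp: Qc_def)
  also have "\<dots> \<le> (\<Sum>b\<in>Qc c. 1)"
  proof (rule sum_mono)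
    fix b
    have "(\<Sum>e | e \<in> {e. e < n \<and> col e = c} \<and> Q e = b. sz e) \<le> (\<Sum>e | e < n \<and> Q e = b. sz e)"
      by (intro sum_mono2) (auto intro: less_imp_le sz_pos)
    then show "(\<Sum>e | e \<in> {e. e < n \<and> col e = c} \<and> Q e = b. sz e) \<le> 1" using Q[of b] by linarith
  qed
  finally show ?thesis by simp
qed

lemma wb_nonneg: "0 \<le> wb c b"
  unfolding wb_def by (intro sum_nonneg) (auto intro: less_imp_le sz_pos)

lemma cap_le: "real (cap c b) \<le> N * wb c b"
  using wb_nonneg[of c b] by (simp add: cap_def)

lemma g: "t < len c \<Longrightarrow> g c t \<in> QB" "card {t. t < len c \<and> g c t = b} \<le> cap c b"
proof -
  have "\<exists>g. (\<forall>t < len c. g t \<in> QB) \<and> (\<forall>b. card {t. t < len c \<and> g t = b} \<le> cap c b)"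
    using spread[OF finQB, of "cap c"] unfolding len_def by metis
  from someI_ex[OF this] show "t < len c \<Longrightarrow> g c t \<in> QB" "card {t. t < len c \<and> g c t = b} \<le> cap c b"
    unfolding g_def by blast+
qed

text \<open>A bin without colour c offers no room for it, so its capacity is 0. Blocks therefore
  never bring a colour into an old bin that lacked it.\<close>

lemma g_Qc: assumes "t < len c" shows "g c t \<in> Qc c"
proof (rule ccontr)
  assume "g c t \<notin> Qc c"
  moreover have "Q e \<in> Qc c" if "e < n" "col e = c" for e using that by (auto simp: Qc_def)
  ultimately have "{e. e < n \<and> \<not> lg e \<and> col e = c \<and> Q e = g c t} = {}" by force
  then have "wb c (g c t) = 0" by (simp add: wb_def del: Collect_empty_eq)
  then have "cap c (g c t) = 0" by (simp add: cap_def)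
  moreover have "t \<in> {t'. t' < len c \<and> g c t' = g c t}" using assms by simp
  then have "card {t'. t' < len c \<and> g c t' = g c t} > 0" by (subst card_gt_0_iff) auto
  ultimately show False using g(2)[where b = "g c t" and c = c] by simp
qed

text \<open>The room for colour c lies in the bins of \<open>Qc c\<close>, and rounding costs each
  of them at most one block.\<close>

lemma len_ge: "N * W c - card (Qc c) \<le> len c"
proof -
  have "N * W c - card (Qc c) = N * (\<Sum>b\<in>Qc c. \<Sum>e | e \<in> {e. e < n \<and> \<not> lg e \<and> col e = c} \<and> Q e = b. sz e) - card (Qc c)"
    unfolding W_def by (subst sum_group_image) (auto simp: Qc_def)
  also have "\<dots> = (\<Sum>b\<in>Qc c. N * wb c b - 1)"
    by (simp add: sum_subtractf sum_distrib_left wb_def conj_ac)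
  also have "\<dots> \<le> (\<Sum>b\<in>Qc c. real (cap c b))"
    by (intro sum_mono) (use wb_nonneg in \<open>simp add: cap_def; linarith\<close>)
  also have "\<dots> \<le> (\<Sum>b\<in>QB. real (cap c b))"
    by (intro sum_mono2 finQB Qc_sub) auto
  finally show ?thesis by (simp add: len_def)
qed

text \<open>\<open>Inl b\<close> is the bin \<open>b\<close> of \<open>Q\<close>; \<open>Inr (c, False, i)\<close> and \<open>Inr (c, True, i)\<close> are the fresh bins for
  the first group and for the surplus blocks of colour \<open>c\<close>.\<close>

definition F\<^sub>0 :: "nat \<Rightarrow> nat + nat \<times> bool \<times> nat" where
  "F\<^sub>0 \<kappa> = (if \<kappa> < nL
     then let c = col (it \<kappa>) in
       if \<kappa> - S c < kk c then Inr (c, False, \<kappa> - S c) else Inl (Q (it (\<kappa> - kk c)))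
     else let c = cs \<kappa>; t = \<kappa> - st c in
       if t < len c then Inl (g c t) else Inr (c, True, (t - len c) div N))"

text \<open>The space that \<open>F\<^sub>0\<close> sets aside for a key, large enough for every key
  of its class: a whole bin for the first group, the size of the item one group earlier for later
  groups, the maximal block size for blocks.\<close>

definition v :: "nat \<Rightarrow> real" where
  "v \<kappa> = (if \<kappa> < nL
     then let c = col (it \<kappa>) in if \<kappa> - S c < kk c then 1 else sz (it (\<kappa> - kk c))
     else 1 / N)"

lemma it_n: "\<kappa> < nL \<Longrightarrow> it \<kappa> < n" using it(1) by (simp add: LL_def)

text \<open>Two keys of one group differ by less than the group size, so stepping back one group
  from \<open>\<kappa>\<close> lands at or before \<open>\<kappa>'\<close>, where items are at least
  as large.\<close>

lemma w_le_v: assumes "\<kappa> < K" "\<kappa>' < K" "cl \<kappa> = cl \<kappa>'" shows "w \<kappa>' \<le> v \<kappa>"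
proof (cases "\<kappa> < nL")
  case True
  define c where "c = col (it \<kappa>)"
  note eq = cl_eq_large[OF True assms(2,3), folded c_def]
  have w: "w \<kappa>' = sz (it \<kappa>')" using eq by (simp add: w_large)
  show ?thesis
  proof (cases "\<kappa> - S c < kk c")
    case first: True
    have "sz (it \<kappa>') \<le> 1" using it_n[OF eq(1)] sz_le by simp
    then show ?thesis using True first by (simp add: v_def w c_def)
  next
    case False
    then have 1: "kk c \<le> \<kappa> - S c" by simp
    note p = prev_item[OF True, folded c_def, OF 1]
    have "\<kappa> - kk c \<le> \<kappa>'"
    proof -
      have sk: "S c \<le> \<kappa>'" "S c \<le> \<kappa>" using S_it(1)[OF eq(1)] S_it(1)[OF True] eq(2) by (simp_all add: c_def)
      have "\<kappa> - S c < Suc ((\<kappa> - S c) div kk c) * kk c"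
        using kk_pos[of c] by (metis dividend_less_div_times add.commute mult_Suc)
      also have "(\<kappa> - S c) div kk c * kk c \<le> \<kappa>' - S c"
        using eq(3) by (metis div_times_less_eq_dividend)
      then have "Suc ((\<kappa> - S c) div kk c) * kk c \<le> \<kappa>' - S c + kk c" by simp
      finally show ?thesis using sk by linarith
    qed
    then have "sz (it \<kappa>') \<le> sz (it (\<kappa> - kk c))"
      using p(1) eq(2) by (intro sz_antimono[OF _ eq(1)]) simp_all
    then show ?thesis using True False by (simp add: v_def w c_def)
  qed
next
  case False
  then show ?thesis using cl_eq_small[of \<kappa> \<kappa>'] assms w_small(1)[of \<kappa>'] by (simp add: v_def)
qed

lemma v_ge: assumes "\<kappa> < K" shows "1 / real N ^ 2 \<le> v \<kappa>"
proof (cases "\<kappa> < nL")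
  case True
  have "1 / real N ^ 2 \<le> 1" using N by (simp add: field_simps)
  moreover have "1 / real N ^ 2 \<le> sz (it (\<kappa> - kk (col (it \<kappa>))))" if "\<not> \<kappa> - S (col (it \<kappa>)) < kk (col (it \<kappa>))"
    using it(1)[OF prev_item(2)[OF True]] that by (auto simp: LL_def large_item_def)
  ultimately show ?thesis using True by (simp add: v_def Let_def)
next
  case False
  then show ?thesis using N by (simp add: v_def field_simps power2_eq_square)
qed

text \<open>Stepping back one group maps the large keys placed in bin b injectively to large items
  which \<open>Q\<close> had there, and each key reserves exactly the size of its image.\<close>

lemma load_large:
  "(\<Sum>\<kappa> | \<kappa> < nL \<and> F\<^sub>0 \<kappa> = Inl b. v \<kappa>) \<le> (\<Sum>e | e < n \<and> lg e \<and> Q e = b. sz e)"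
proof -
  define A where "A = {\<kappa>. \<kappa> < nL \<and> F\<^sub>0 \<kappa> = Inl b}"
  define \<phi> where "\<phi> \<kappa> = it (\<kappa> - kk (col (it \<kappa>)))" for \<kappa>
  have A: "\<kappa> < nL \<and> kk (col (it \<kappa>)) \<le> \<kappa> - S (col (it \<kappa>)) \<and> Q (\<phi> \<kappa>) = b \<and> v \<kappa> = sz (\<phi> \<kappa>)" if "\<kappa> \<in> A" for \<kappa>
    using that by (auto simp: A_def F\<^sub>0_def v_def \<phi>_def Let_def split: if_splits)
  have inj: "inj_on \<phi> A"
  proof (rule inj_onI)
    fix \<kappa> \<kappa>' assume *: "\<kappa> \<in> A" "\<kappa>' \<in> A" "\<phi> \<kappa> = \<phi> \<kappa>'"
    note p = prev_item[of \<kappa>] prev_item[of \<kappa>'] A[OF *(1)] A[OF *(2)]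
    \<comment> \<open>Equal predecessors have equal colours, hence equal group sizes; the
      subtraction is exact and can be undone.\<close>
    have "col (it \<kappa>) = col (it \<kappa>')" using p *(3) by (metis \<phi>_def)
    moreover have "\<kappa> - kk (col (it \<kappa>)) = \<kappa>' - kk (col (it \<kappa>'))"
      using p *(3) it(2) by (metis \<phi>_def)
    ultimately show "\<kappa> = \<kappa>'" using p by (metis le_add_diff_inverse)
  qed
  have "(\<Sum>\<kappa>\<in>A. v \<kappa>) = (\<Sum>e\<in>\<phi> ` A. sz e)"
    by (simp add: sum.reindex[OF inj] A)
  also have "\<dots> \<le> (\<Sum>e | e < n \<and> lg e \<and> Q e = b. sz e)"
  proof (rule sum_mono2)
    show "\<phi> ` A \<subseteq> {e. e < n \<and> lg e \<and> Q e = b}"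
      using A it(1)[OF prev_item(2)] by (auto simp: LL_def \<phi>_def)
  qed (auto intro: less_imp_le sz_pos)
  finally show ?thesis by (simp add: A_def)
qed

text \<open>At most \<open>cap c b\<close> blocks of colour c enter the bin, so they reserve no more
  than its small items of that colour occupied; the colours are then summed up.\<close>

lemma load_small:
  "(\<Sum>\<kappa> | nL \<le> \<kappa> \<and> \<kappa> < K \<and> F\<^sub>0 \<kappa> = Inl b. v \<kappa>) \<le> (\<Sum>e | e < n \<and> \<not> lg e \<and> Q e = b. sz e)"
proof -
  define A where "A = {\<kappa>. nL \<le> \<kappa> \<and> \<kappa> < K \<and> F\<^sub>0 \<kappa> = Inl b}"
  have "(\<Sum>\<kappa>\<in>A. v \<kappa>) = (\<Sum>c\<le>m. \<Sum>\<kappa> | \<kappa> \<in> A \<and> cs \<kappa> = c. v \<kappa>)"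
    by (rule sum_group_image[symmetric]) (auto simp: A_def cs)
  also have "\<dots> \<le> (\<Sum>c\<le>m. wb c b)"
  proof (rule sum_mono)
    fix c
    have A: "st c \<le> \<kappa> \<and> \<kappa> - st c < len c \<and> g c (\<kappa> - st c) = b" if "\<kappa> \<in> A" "cs \<kappa> = c" for \<kappa>
      using that cs(2)[of \<kappa>] by (auto simp: A_def F\<^sub>0_def Let_def split: if_splits)
    have "card {\<kappa>. \<kappa> \<in> A \<and> cs \<kappa> = c} \<le> card {t. t < len c \<and> g c t = b}"
    proof (rule card_inj_on_le)
      show "inj_on (\<lambda>\<kappa>. \<kappa> - st c) {\<kappa>. \<kappa> \<in> A \<and> cs \<kappa> = c}" using A by (auto intro!: inj_onI) (metis eq_diff_iff)
    qed (use A in auto)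
    then have "card {\<kappa>. \<kappa> \<in> A \<and> cs \<kappa> = c} \<le> cap c b" using g(2) le_trans by blast
    then have "card {\<kappa>. \<kappa> \<in> A \<and> cs \<kappa> = c} \<le> N * wb c b" using cap_le[of c b] by linarith
    then have "card {\<kappa>. \<kappa> \<in> A \<and> cs \<kappa> = c} * (1 / N) \<le> wb c b" using N by (simp add: field_simps)
    moreover have "(\<Sum>\<kappa> | \<kappa> \<in> A \<and> cs \<kappa> = c. v \<kappa>) = card {\<kappa>. \<kappa> \<in> A \<and> cs \<kappa> = c} * (1 / N)"
      by (simp add: A_def v_def)
    ultimately show "(\<Sum>\<kappa> | \<kappa> \<in> A \<and> cs \<kappa> = c. v \<kappa>) \<le> wb c b" by simp
  qed
  also have "\<dots> = (\<Sum>c\<le>m. \<Sum>e | e \<in> {e. e < n \<and> \<not> lg e \<and> Q e = b} \<and> col e = c. sz e)"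
    by (intro sum.cong refl) (auto simp: wb_def intro!: sum.cong)
  also have "\<dots> = (\<Sum>e | e < n \<and> \<not> lg e \<and> Q e = b. sz e)"
    by (rule sum_group_image) (auto simp: col_le)
  finally show ?thesis by (simp add: A_def)
qed

lemma load_le: "(\<Sum>\<kappa> | \<kappa> < K \<and> F\<^sub>0 \<kappa> = b. v \<kappa>) \<le> 1"
proof (cases b)
  case (Inl q)
  define A B where "A = {\<kappa>. \<kappa> < nL \<and> F\<^sub>0 \<kappa> = Inl q}"
    and "B = {\<kappa>. nL \<le> \<kappa> \<and> \<kappa> < K \<and> F\<^sub>0 \<kappa> = Inl q}"
  have "{\<kappa>. \<kappa> < K \<and> F\<^sub>0 \<kappa> = b} = A \<union> B"
    unfolding A_def B_def Inl using nL_le_K by fastforce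
  moreover have "finite A" "finite B" "A \<inter> B = {}" by (auto simp: A_def B_def)
  ultimately have "(\<Sum>\<kappa> | \<kappa> < K \<and> F\<^sub>0 \<kappa> = b. v \<kappa>) =
      (\<Sum>\<kappa> | \<kappa> < nL \<and> F\<^sub>0 \<kappa> = Inl q. v \<kappa>) + (\<Sum>\<kappa> | nL \<le> \<kappa> \<and> \<kappa> < K \<and> F\<^sub>0 \<kappa> = Inl q. v \<kappa>)"
    by (simp add: sum.union_disjoint flip: A_def B_def)
  also have "\<dots> \<le> (\<Sum>e | e < n \<and> lg e \<and> Q e = q. sz e) + (\<Sum>e | e < n \<and> \<not> lg e \<and> Q e = q. sz e)"
    by (intro add_mono load_large load_small)
  also have "\<dots> = (\<Sum>e | e < n \<and> Q e = q. sz e)"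
    by (subst sum.union_disjoint[symmetric]) (auto intro!: sum.cong)
  finally show ?thesis using Q[of q] by linarith
next
  case (Inr z)
  obtain c t i where z: "z = (c, t, i)" by (cases z)
  show ?thesis
  proof (cases t)
    case False
    define A where "A = {\<kappa>. \<kappa> < K \<and> F\<^sub>0 \<kappa> = b}"
    \<comment> \<open>Colour and index determine the key, so a fresh bin of a first group holds at
      most one.\<close>
    have A: "\<kappa> < nL \<and> \<kappa> - S (col (it \<kappa>)) < kk (col (it \<kappa>)) \<and> \<kappa> = S c + i" if "\<kappa> \<in> A" for \<kappa>
      using that S_it(1)[of \<kappa>] by (auto simp: A_def Inr z False F\<^sub>0_def Let_def split: if_splits)
    then have "card A \<le> card {S c + i}" by (intro card_mono) auto
    moreover have "(\<Sum>\<kappa>\<in>A. v \<kappa>) = (\<Sum>\<kappa>\<in>A. 1)"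
    proof (rule sum.cong)
      fix \<kappa> assume "\<kappa> \<in> A"
      then have "\<kappa> < nL" "\<kappa> - S (col (it \<kappa>)) < kk (col (it \<kappa>))" using A by blast+
      then show "v \<kappa> = 1" by (simp add: v_def Let_def)
    qed simp
    ultimately show ?thesis by (simp add: A_def)
  next
    case True
    define A where "A = {\<kappa>. \<kappa> < K \<and> F\<^sub>0 \<kappa> = b}"
    \<comment> \<open>The quotient i confines the keys to a window of N consecutive blocks, each
      reserving 1 / N.\<close>
    have A: "A \<subseteq> {st c + len c + i * N..<st c + len c + i * N + N} \<inter> {nL..}"
    proof
      fix \<kappa> assume "\<kappa> \<in> A"
      then have 1: "nL \<le> \<kappa>" "\<kappa> < K" "cs \<kappa> = c" "\<not> \<kappa> - st c < len c" "(\<kappa> - st c - len c) div N = i"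
        by (auto simp: A_def Inr z True F\<^sub>0_def Let_def split: if_splits)
      have 2: "st c \<le> \<kappa>" using cs(2)[OF 1(1,2)] 1 by simp
      have "i * N \<le> \<kappa> - st c - len c" "\<kappa> - st c - len c < i * N + N"
        using div_times_less_eq_dividend[of "\<kappa> - st c - len c" N]
          dividend_less_div_times[of N "\<kappa> - st c - len c"] N
        unfolding 1(5) by (simp_all add: add.commute)
      then show "\<kappa> \<in> {st c + len c + i * N..<st c + len c + i * N + N} \<inter> {nL..}"
        using 1(1,4) 2 unfolding Int_iff atLeastLessThan_iff atLeast_iff by linarith
    qed
    then have "card A \<le> N"
      using card_mono[of "{st c + len c + i * N..<st c + len c + i * N + N}" A] by auto
    then have "card A / N \<le> 1" using N by (simp add: divide_le_eq)
    moreover have "(\<Sum>\<kappa>\<in>A. v \<kappa>) = (\<Sum>\<kappa>\<in>A. 1 / N)" by (rule sum.cong) (use A in \<open>auto simp: v_def\<close>)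
    ultimately show ?thesis by (simp add: A_def)
  qed
qed

text \<open>Every key reserves at least 1 / N^2, so even all classes together contribute at most N^2
  keys to a bin. This is the multiplicity bound R for the runs.\<close>

lemma mult_le: "card {\<kappa>. \<kappa> < K \<and> F\<^sub>0 \<kappa> = b \<and> cl \<kappa> = h} \<le> N ^ 2"
proof -
  have "card {\<kappa>. \<kappa> < K \<and> F\<^sub>0 \<kappa> = b \<and> cl \<kappa> = h} \<le> card {\<kappa>. \<kappa> < K \<and> F\<^sub>0 \<kappa> = b}"
    by (intro card_mono) auto
  moreover have "card {\<kappa>. \<kappa> < K \<and> F\<^sub>0 \<kappa> = b} * (1 / real N ^ 2) \<le> (\<Sum>\<kappa> | \<kappa> < K \<and> F\<^sub>0 \<kappa> = b. v \<kappa>)"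
    by (intro sum_bounded_below v_ge) auto
  then have "card {\<kappa>. \<kappa> < K \<and> F\<^sub>0 \<kappa> = b} * (1 / real N ^ 2) \<le> 1" using load_le[of b] by linarith
  then have "real (card {\<kappa>. \<kappa> < K \<and> F\<^sub>0 \<kappa> = b}) \<le> real (N ^ 2)"
    using N by (simp add: pos_divide_le_eq)
  then have "card {\<kappa>. \<kappa> < K \<and> F\<^sub>0 \<kappa> = b} \<le> N ^ 2" by (simp only: of_nat_le_iff)
  ultimately show ?thesis by linarith
qed

text \<open>The quotient belongs to the last surplus block, so the number of bins is its successor;
  truncated subtraction grants one such bin even when there is no surplus.\<close>

definition fresh :: "nat \<Rightarrow> (nat + nat \<times> bool \<times> nat) set" where
  "fresh c = {Inr (c, False, q) | q. q < kk c} \<union>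
  {Inr (c, True, i) | i. i < Suc ((st (Suc c) - st c - 1 - len c) div N)}"

lemma F\<^sub>0_range: assumes "\<kappa> < K" shows "F\<^sub>0 \<kappa> \<in> Inl ` Qc (kcol \<kappa>) \<union> fresh (kcol \<kappa>)"
proof (cases "\<kappa> < nL")
  case True
  then show ?thesis
    using prev_item[OF True] it_n[OF prev_item(2)[OF True]]
    by (auto simp: F\<^sub>0_def kcol_def Let_def fresh_def Qc_def)
next
  case False
  define c where "c = cs \<kappa>"
  have "st c \<le> \<kappa>" "\<kappa> < st (Suc c)" using cs[of \<kappa>] False assms by (auto simp: c_def)
  then have "(\<kappa> - st c - len c) div N \<le> (st (Suc c) - st c - 1 - len c) div N"
    by (intro div_le_mono) simp
  then show ?thesis using False g_Qc[of "\<kappa> - st c" c]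
    by (auto simp: F\<^sub>0_def kcol_def Let_def fresh_def c_def[symmetric])
qed

text \<open>Of the factor 4, one part pays for the first group and three parts pay for the surplus
  blocks; the 2 collects the two roundings.\<close>

lemma card_fresh: assumes "c \<le> m" shows "finite (fresh c)" "card (fresh c) \<le> 4 / N * card (Qc c) + 2"
proof -
  define y where "y = st (Suc c) - st c - 1 - len c"
  have fr: "fresh c = (\<lambda>q. Inr (c, False, q)) ` {..<kk c} \<union> (\<lambda>i. Inr (c, True, i)) ` {..<Suc (y div N)}"
    by (auto simp: fresh_def y_def)
  then show "finite (fresh c)" by simp
  have "card (fresh c) \<le> kk c + Suc (y div N)"
    unfolding fr by (rule order_trans[OF card_Un_le])
      (intro add_mono; rule order_trans[OF card_image_le]; simp)
  moreover have "real (y div N) \<le> y / N" by (rule of_nat_div_le_of_nat)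
  moreover have "real y \<le> 3 * card (Qc c)"
  proof (cases "len c \<le> st (Suc c) - st c - 1")
    case True
    have "real y = real (st (Suc c) - st c - 1) - len c" using True by (simp add: y_def)
    \<comment> \<open>Refilled room absorbs almost all blocks: N times \<open>W c\<close> cancels,
      leaving \<open>W c\<close> times N / (N - 1), at most twice the number of bins, plus one block
      lost per bin.\<close>
    also have "\<dots> \<le> W c * real N ^ 2 / (real N - 1) - (N * W c - card (Qc c))"
      using blocks_le[OF assms] len_ge[of c] by linarith
    also have "\<dots> = W c * (N / (real N - 1)) + card (Qc c)"
      using N by (simp add: field_simps power2_eq_square)
    also have "W c * (N / (real N - 1)) \<le> real (card (Qc c)) * 2"
    proof (rule mult_mono)
      show "W c \<le> card (Qc c)" using W_le_vol[of c] vol_le[of c] by linarith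
    qed (use N in \<open>auto simp: field_simps\<close>)
    finally show ?thesis by simp
  qed (simp add: y_def)
  then have "y / N \<le> 3 / N * card (Qc c)" using N by (simp add: field_simps)
  moreover have "vol c / N \<le> 1 / N * card (Qc c)" using vol_le[of c] N by (simp add: field_simps)
  moreover have "4 / N * real (card (Qc c)) = 1 / N * card (Qc c) + 3 / N * card (Qc c)"
    by (simp add: field_simps)
  ultimately show "card (fresh c) \<le> 4 / N * card (Qc c) + 2" using kk_le[of c] by linarith
qed

lemma card_colour_bins: assumes "c \<le> m"
  shows "card (F\<^sub>0 ` {\<kappa>. \<kappa> < K \<and> kcol \<kappa> = c}) \<le> (1 + 4 / N) * card (Qc c) + 2"
proof -
  have "F\<^sub>0 ` {\<kappa>. \<kappa> < K \<and> kcol \<kappa> = c} \<subseteq> Inl ` Qc c \<union> fresh c" using F\<^sub>0_range by auto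
  then have "card (F\<^sub>0 ` {\<kappa>. \<kappa> < K \<and> kcol \<kappa> = c}) \<le> card (Inl ` Qc c \<union> fresh c)"
    by (intro card_mono) (auto simp: finQc card_fresh assms)
  also have "\<dots> \<le> card (Qc c) + card (fresh c)"
    using card_Un_le[of "Inl ` Qc c" "fresh c"] by (simp add: card_image)
  finally show ?thesis using card_fresh(2)[OF assms] by (simp add: algebra_simps)
qed

lemma kcol_le: "\<kappa> < K \<Longrightarrow> kcol \<kappa> \<le> m"
  using cs[of \<kappa>] it_n[of \<kappa>] col_le by (auto simp: kcol_def)

text \<open>A bin may contain every colour, so the fresh bins of each of the m + 1 colours 0, ..., m
  are charged separately to the total; this produces the factor 4 (m + 1) / N.\<close>

lemma card_bins: "card (F\<^sub>0 ` {..<K}) \<le> (1 + 4 * (m + 1) / N) * card QB + 2 * (m + 1)"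
proof -
  have "F\<^sub>0 ` {..<K} \<subseteq> Inl ` QB \<union> (\<Union>c\<le>m. fresh c)" using F\<^sub>0_range Qc_sub kcol_le by fastforce
  then have "card (F\<^sub>0 ` {..<K}) \<le> card (Inl ` QB \<union> (\<Union>c\<le>m. fresh c))"
    by (intro card_mono) (auto simp: finQB card_fresh)
  also have "\<dots> \<le> card QB + (\<Sum>c\<le>m. card (fresh c))"
    using card_Un_le[of "Inl ` QB" "\<Union>c\<le>m. fresh c"] card_UN_le[of "{..m}" fresh]
    by (simp add: card_image)
  finally have "real (card (F\<^sub>0 ` {..<K})) \<le> card QB + (\<Sum>c\<le>m. real (card (fresh c)))"
    by (simp flip: of_nat_sum of_nat_add)
  also have "\<dots> \<le> card QB + (\<Sum>c\<le>m. 4 / N * card QB + 2)"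
  proof (intro add_left_mono sum_mono)
    fix c assume "c \<in> {..m}"
    then have "card (fresh c) \<le> 4 / N * card (Qc c) + 2" using card_fresh by simp
    also have "\<dots> \<le> 4 / N * card QB + 2"
      using card_mono[OF finQB Qc_sub] by (intro add_right_mono mult_left_mono) auto
    finally show "card (fresh c) \<le> 4 / N * card QB + 2" .
  qed
  also have "\<dots> = (1 + 4 * (m + 1) / N) * card QB + 2 * (m + 1)" by (simp add: field_simps)
  finally show ?thesis .
qed

text \<open>The replacement \<open>\<rho>\<close> stays within classes, so every key fits the space
  reserved for the key whose place it takes, and has the same colour. Hence the load and colour
  bounds of \<open>F\<^sub>0\<close> carry over to the runs.\<close>

lemma run_packing:
  obtains ps where
    "length ps = ((m + 1) * G + (m + 1)) * ((N ^ 2 + 1) ^ ((m + 1) * G + (m + 1)) * N ^ 2)"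
    "\<And>a l. (a, l) \<in> set ps \<Longrightarrow> a \<le> n + m + 1 \<and> l \<le> n + m + 1"
    "\<And>b. (\<Sum>e | e < n \<and> eval_runs ps (key e) = b. sz e) \<le> 1"
    "card ((\<lambda>e. eval_runs ps (key e)) ` {..<n}) \<le> (1 + 4 * (m + 1) / N) * card (Q ` {..<n}) + 2 * (m + 1)"
    "\<And>c. c \<le> m \<Longrightarrow> card ((\<lambda>e. eval_runs ps (key e)) ` {e. e < n \<and> col e = c})
        \<le> (1 + 4 / N) * card (Q ` {e. e < n \<and> col e = c}) + 2"
proof -
  obtain ps \<pi> \<rho> where ps: "length ps = ((m + 1) * G + (m + 1)) * ((N ^ 2 + 1) ^ ((m + 1) * G + (m + 1)) * N ^ 2)"
      "\<And>a l. (a, l) \<in> set ps \<Longrightarrow> a \<le> K \<and> l \<le> K"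
    and \<pi>: "inj_on \<pi> (F\<^sub>0 ` {..<K})" and \<rho>: "bij_betw \<rho> {..<K} {..<K}"
    and cl_\<rho>: "\<And>\<kappa>. \<kappa> < K \<Longrightarrow> cl (\<rho> \<kappa>) = cl \<kappa>"
    and ev: "\<And>\<kappa>. \<kappa> < K \<Longrightarrow> eval_runs ps \<kappa> = \<pi> (F\<^sub>0 (\<rho> \<kappa>))"
    using few_runs[OF cl_mono cl_less mult_le] by metis
  have \<rho>K: "\<rho> \<kappa> < K" if "\<kappa> < K" for \<kappa> using \<rho> that by (auto simp: bij_betw_def)
  define P where "P e = eval_runs ps (key e)" for e
  have P: "P e = \<pi> (F\<^sub>0 (\<rho> (key e)))" "\<rho> (key e) < K" "kcol (\<rho> (key e)) = col e" if "e < n" for e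
    using ev[OF key_K] \<rho>K[OF key_K] kcol_cl[OF _ _ cl_\<rho>] kcol_key key_K that
    by (auto simp: P_def)
  show ?thesis
  proof (rule that[of ps, folded P_def, OF ps(1)])
    show "a \<le> n + m + 1 \<and> l \<le> n + m + 1" if "(a, l) \<in> set ps" for a l
      using ps(2)[OF that] K_le by linarith
  next
    fix \<beta>
    define A where "A = {\<kappa>. \<kappa> < K \<and> eval_runs ps \<kappa> = \<beta>}"
    have A: "finite A" by (simp add: A_def)
    have "(\<Sum>e | e < n \<and> P e = \<beta>. sz e) = (\<Sum>\<kappa>\<in>A. \<Sum>e | e \<in> {e. e < n \<and> P e = \<beta>} \<and> key e = \<kappa>. sz e)"
      by (rule sum_group_image[symmetric]) (use A key_K in \<open>auto simp: A_def P_def\<close>)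
    also have "\<dots> = (\<Sum>\<kappa>\<in>A. w \<kappa>)"
      unfolding w_def by (intro sum.cong) (auto simp: A_def P_def)
    also have "\<dots> \<le> (\<Sum>\<kappa>\<in>A. v (\<rho> \<kappa>))"
      by (intro sum_mono w_le_v) (auto simp: A_def \<rho>K cl_\<rho>)
    also have "\<dots> = (\<Sum>\<kappa>\<in>\<rho> ` A. v \<kappa>)"
      by (subst sum.reindex) (use \<rho> in \<open>auto simp: bij_betw_def A_def intro: inj_on_subset\<close>)
    also have "\<dots> \<le> 1"
    proof (cases "A = {}")
      case False
      then obtain \<kappa>\<^sub>0 where \<kappa>\<^sub>0: "\<kappa>\<^sub>0 \<in> A" by blast
      \<comment> \<open>Labels are injective on bins, so all keys with one label take places in a
        single bin of \<open>F\<^sub>0\<close>.\<close>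
      have sub: "\<rho> ` A \<subseteq> {\<kappa>. \<kappa> < K \<and> F\<^sub>0 \<kappa> = F\<^sub>0 (\<rho> \<kappa>\<^sub>0)}"
      proof
        fix x assume "x \<in> \<rho> ` A"
        then obtain \<kappa> where "\<kappa> \<in> A" "x = \<rho> \<kappa>" by blast
        then have x: "x < K" "\<pi> (F\<^sub>0 x) = \<pi> (F\<^sub>0 (\<rho> \<kappa>\<^sub>0))" "\<rho> \<kappa>\<^sub>0 < K"
          using \<kappa>\<^sub>0 ev \<rho>K by (auto simp: A_def)
        have "F\<^sub>0 x = F\<^sub>0 (\<rho> \<kappa>\<^sub>0)"
          by (rule inj_onD[OF \<pi> x(2)]) (use x in auto)
        then show "x \<in> {\<kappa>. \<kappa> < K \<and> F\<^sub>0 \<kappa> = F\<^sub>0 (\<rho> \<kappa>\<^sub>0)}" using x(1) by simp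
      qed
      have "(\<Sum>\<kappa>\<in>\<rho> ` A. v \<kappa>) \<le> (\<Sum>\<kappa> | \<kappa> < K \<and> F\<^sub>0 \<kappa> = F\<^sub>0 (\<rho> \<kappa>\<^sub>0). v \<kappa>)"
      proof (rule sum_mono2[OF _ sub])
        fix \<kappa> assume "\<kappa> \<in> {\<kappa>. \<kappa> < K \<and> F\<^sub>0 \<kappa> = F\<^sub>0 (\<rho> \<kappa>\<^sub>0)} - \<rho> ` A"
        then have "1 / real N ^ 2 \<le> v \<kappa>" by (intro v_ge) simp
        then show "0 \<le> v \<kappa>" by (rule order_trans[rotated]) simp
      qed simp
      then show ?thesis using load_le[of "F\<^sub>0 (\<rho> \<kappa>\<^sub>0)"] by linarith
    qed simp
    finally show "(\<Sum>e | e < n \<and> P e = \<beta>. sz e) \<le> 1" .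
  next
    have "P ` {..<n} \<subseteq> \<pi> ` (F\<^sub>0 ` {..<K})" using P by auto
    then have "card (P ` {..<n}) \<le> card (\<pi> ` (F\<^sub>0 ` {..<K}))" by (intro card_mono) auto
    also have "\<dots> \<le> card (F\<^sub>0 ` {..<K})" by (rule card_image_le) simp
    finally show "card (P ` {..<n}) \<le> (1 + 4 * (m + 1) / N) * card (Q ` {..<n}) + 2 * (m + 1)"
      using card_bins by (simp add: QB_def)
  next
    fix c assume c: "c \<le> m"
    have "P ` {e. e < n \<and> col e = c} \<subseteq> \<pi> ` (F\<^sub>0 ` {\<kappa>. \<kappa> < K \<and> kcol \<kappa> = c})"
      using P by (auto intro!: imageI)
    then have "card (P ` {e. e < n \<and> col e = c}) \<le> card (\<pi> ` (F\<^sub>0 ` {\<kappa>. \<kappa> < K \<and> kcol \<kappa> = c}))"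
      by (intro card_mono) auto
    also have "\<dots> \<le> card (F\<^sub>0 ` {\<kappa>. \<kappa> < K \<and> kcol \<kappa> = c})" by (rule card_image_le) simp
    finally show "card (P ` {e. e < n \<and> col e = c}) \<le> (1 + 4 / N) * card (Q ` {e. e < n \<and> col e = c}) + 2"
      using card_colour_bins[OF c] by (simp add: Qc_def)
  qed
qed

end

end

section \<open>Timed weakest preconditions\<close>

text \<open>Total correctness with a time budget. The budget is only an upper bound, so branches of
  different cost can be padded to a common one.\<close>

definition wp :: "com \<Rightarrow> nat \<Rightarrow> (state \<Rightarrow> bool) \<Rightarrow> state \<Rightarrow> bool" where
  "wp c T Q s \<longleftrightarrow> (\<exists>t s'. runs c s t s' \<and> t \<le> T \<and> Q s')"

lemma wp_mono: "wp c T Q s \<Longrightarrow> T \<le> T' \<Longrightarrow> (\<And>s'. Q s' \<Longrightarrow> Q' s') \<Longrightarrow> wp c T' Q' s"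
  unfolding wp_def by (meson le_trans)

lemma wp_Skip: "Q s \<Longrightarrow> wp Skip 1 Q s"
  unfolding wp_def using runs.Skip by blast

lemma wp_IAssign: "Q (nat_store x (ival a s) (ival e s) s) \<Longrightarrow> wp (IAssign x a e) 1 Q s"
  unfolding wp_def using runs.IAssign by blast

lemma wp_RAssign: "Q (real_store x (ival a s) (rval e s) s) \<Longrightarrow> wp (RAssign x a e) 1 Q s"
  unfolding wp_def using runs.RAssign by blast

lemma wp_Seq: "wp c1 T1 (wp c2 T2 Q) s \<Longrightarrow> wp (Seq c1 c2) (T1 + T2) Q s"
  unfolding wp_def by (meson runs.Seq add_mono)

lemma wp_Cond:
  assumes "bval b s \<Longrightarrow> wp c1 T Q s" "\<not> bval b s \<Longrightarrow> wp c2 T Q s"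
  shows "wp (Cond b c1 c2) (Suc T) Q s"
  using assms unfolding wp_def by (meson runs.CondTrue runs.CondFalse Suc_le_mono)

section \<open>Frame rule\<close>

fun nmods :: "com \<Rightarrow> vname set" where
  "nmods Skip = {}"
| "nmods (IAssign x a e) = {x}"
| "nmods (RAssign x a e) = {}"
| "nmods (Seq c1 c2) = nmods c1 \<union> nmods c2"
| "nmods (Cond b c1 c2) = nmods c1 \<union> nmods c2"
| "nmods (While b c) = nmods c"

fun rmods :: "com \<Rightarrow> vname set" where
  "rmods Skip = {}"
| "rmods (IAssign x a e) = {}"
| "rmods (RAssign x a e) = {x}"
| "rmods (Seq c1 c2) = rmods c1 \<union> rmods c2"
| "rmods (Cond b c1 c2) = rmods c1 \<union> rmods c2"
| "rmods (While b c) = rmods c"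

definition agree :: "vname set \<Rightarrow> vname set \<Rightarrow> state \<Rightarrow> state \<Rightarrow> bool" where
  "agree X Y s s' \<longleftrightarrow> (\<forall>x. x \<notin> X \<longrightarrow> nats s' x = nats s x) \<and> (\<forall>y. y \<notin> Y \<longrightarrow> reals s' y = reals s y)"

lemma nats_store [simp]:
  "nats (nat_store x i v s) = (nats s)(x := (nats s x)(i := v))"
  "reals (nat_store x i v s) = reals s"
  "nats (real_store y i r s) = nats s"
  "reals (real_store y i r s) = (reals s)(y := (reals s y)(i := r))"
  by (simp_all add: nat_store_def real_store_def)

lemma runs_frame: "runs c s t s' \<Longrightarrow> agree (nmods c) (rmods c) s s'"
  by (induction rule: runs.induct) (auto simp: agree_def)

lemma wp_frame:
  assumes "wp c T Q s"
  shows "wp c T (\<lambda>s'. Q s' \<and> agree (nmods c) (rmods c) s s') s"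
  using assms runs_frame unfolding wp_def by blast

section \<open>Loop patterns and their running times\<close>

abbreviation var :: "vname \<Rightarrow> iexp" where
  "var x \<equiv> IArr x (IConst 0)"

text \<open>The counter lives in cell d of an array, so that nested loops can count in one array and
  leave a whole tuple in it.\<close>

definition For :: "vname \<Rightarrow> nat \<Rightarrow> iexp \<Rightarrow> com \<Rightarrow> com" where
  "For x d e body = Seq (IAssign x (IConst d) (IConst 0))
     (While (ILess (IArr x (IConst d)) e)
        (Seq body (IAssign x (IConst d) (IPlus (IArr x (IConst d)) (IConst 1)))))"

lemma nmods_For [simp]: "nmods (For x d e body) = insert x (nmods body)"
  and rmods_For [simp]: "rmods (For x d e body) = rmods body"
  by (auto simp: For_def)

text \<open>The first 2 pays for the initialisation and the final failing test, the 2 added to T for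
  test and increment of a round. The invariant is required with the counter already
  advanced.\<close>

lemma wp_For:
  assumes init: "I 0 (nat_store x d 0 s)"
    and body: "\<And>i s. i < L \<Longrightarrow> I i s \<Longrightarrow> nats s x d = i \<Longrightarrow>
      wp body T (\<lambda>s'. nats s' x d = i \<and> I (Suc i) (nat_store x d (Suc i) s')) s"
    and lim: "\<And>i s. I i s \<Longrightarrow> nats s x d = i \<Longrightarrow> i \<le> L \<Longrightarrow> ival e s = L"
  shows "wp (For x d e body) (2 + L * (T + 2)) (\<lambda>s'. I L s' \<and> nats s' x d = L) s"
proof -
  let ?w = "While (ILess (IArr x (IConst d)) e)
        (Seq body (IAssign x (IConst d) (IPlus (IArr x (IConst d)) (IConst 1))))"
  have loop: "wp ?w (1 + k * (T + 2)) (\<lambda>s'. I L s' \<and> nats s' x d = L) s"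
    if "I i s" "nats s x d = i" "i \<le> L" "L - i = k" for i k s
    using that
  proof (induction k arbitrary: i s)
    case 0
    then have "i = L" by simp
    then have "\<not> bval (ILess (IArr x (IConst d)) e) s" using lim 0 by simp
    then show ?case unfolding wp_def using runs.WhileFalse 0 \<open>i = L\<close> by force
  next
    case (Suc k)
    then have i: "i < L" by simp
    then have b: "bval (ILess (IArr x (IConst d)) e) s" using lim[of i s] Suc by simp
    from body[OF i Suc.prems(1,2)] obtain t s1 where t: "runs body s t s1" "t \<le> T"
      "nats s1 x d = i" "I (Suc i) (nat_store x d (Suc i) s1)" unfolding wp_def by blast
    have r: "runs (Seq body (IAssign x (IConst d) (IPlus (IArr x (IConst d)) (IConst 1)))) s (t + 1)
        (nat_store x d (Suc i) s1)"
      using runs.Seq[OF t(1) runs.IAssign[of x "IConst d" "IPlus (IArr x (IConst d)) (IConst 1)"]] t(3) by simp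
    have "wp ?w (1 + k * (T + 2)) (\<lambda>s'. I L s' \<and> nats s' x d = L) (nat_store x d (Suc i) s1)"
      by (rule Suc.IH[OF t(4)]) (use Suc.prems i in auto)
    then obtain u s2 where "runs ?w (nat_store x d (Suc i) s1) u s2" "u \<le> 1 + k * (T + 2)"
      "I L s2" "nats s2 x d = L" unfolding wp_def by blast
    then show ?case unfolding wp_def using runs.WhileTrue[OF b r] t(2) by fastforce
  qed
  have "wp (For x d e body) (1 + (1 + L * (T + 2))) (\<lambda>s'. I L s' \<and> nats s' x d = L) s"
    unfolding For_def by (intro wp_Seq wp_IAssign loop[of 0]) (use init in auto)
  then show ?thesis by simp
qed

definition count_loop :: "vname \<Rightarrow> vname \<Rightarrow> iexp \<Rightarrow> com \<Rightarrow> bexp \<Rightarrow> com" where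
  "count_loop r f e pre b = Seq (IAssign r (IConst 0) (IConst 0))
     (For f 0 e (Seq pre (Cond b (IAssign r (IConst 0) (IPlus (var r) (IConst 1))) Skip)))"

lemma mods_count_loop [simp]:
  "nmods (count_loop r f e pre b) = {r, f} \<union> nmods pre" "rmods (count_loop r f e pre b) = rmods pre"
  by (auto simp: count_loop_def)

text \<open>One bound for counting, summing and filling loops; its constants are slack.\<close>

definition loop_time :: "nat \<Rightarrow> nat \<Rightarrow> nat" where
  "loop_time L T = 5 + L * (T + 5)"

lemma wp_count_loop:
  assumes fr: "f \<noteq> r" "r \<notin> nmods pre" "f \<notin> nmods pre"
    and e: "\<And>s'. agree ({r, f} \<union> nmods pre) (rmods pre) s s' \<Longrightarrow> ival e s' = L"
    and pre: "\<And>i s'. i < L \<Longrightarrow> agree ({r, f} \<union> nmods pre) (rmods pre) s s' \<Longrightarrow> nats s' f 0 = i \<Longrightarrow>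
      wp pre T (\<lambda>s''. bval b s'' = B i) s'"
  shows "wp (count_loop r f e pre b) (loop_time L T) (\<lambda>s'. nats s' r 0 = card {i. i < L \<and> B i}) s"
proof -
  let ?X = "{r, f} \<union> nmods pre"
  define I where "I i s' \<longleftrightarrow> agree ?X (rmods pre) s s' \<and> nats s' r 0 = card {j. j < i \<and> B j}" for i s'
  have step: "wp (Seq pre (Cond b (IAssign r (IConst 0) (IPlus (var r) (IConst 1))) Skip)) (T + Suc 1)
      (\<lambda>s''. nats s'' f 0 = i \<and> I (Suc i) (nat_store f 0 (Suc i) s'')) s'"
    if i: "i < L" "I i s'" "nats s' f 0 = i" for i s'
  proof (rule wp_Seq, rule wp_mono[OF wp_frame[OF pre]])
    show "i < L" "agree ?X (rmods pre) s s'" "nats s' f 0 = i" using i by (auto simp: I_def)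
  next
    fix s1 assume s1: "bval b s1 = B i \<and> agree (nmods pre) (rmods pre) s' s1"
    have ag: "agree ?X (rmods pre) s s1" "nats s1 f 0 = i" "nats s1 r 0 = card {j. j < i \<and> B j}"
      using s1 i fr by (auto simp: agree_def I_def)
    have "{j. j < Suc i \<and> B j} = (if B i then insert i {j. j < i \<and> B j} else {j. j < i \<and> B j})"
      by (auto simp: less_Suc_eq)
    then have "card {j. j < Suc i \<and> B j} = card {j. j < i \<and> B j} + (if B i then 1 else 0)" by simp
    then show "wp (Cond b (IAssign r (IConst 0) (IPlus (var r) (IConst 1))) Skip) (Suc 1)
       (\<lambda>s''. nats s'' f 0 = i \<and> I (Suc i) (nat_store f 0 (Suc i) s'')) s1"
      using s1 ag fr by (intro wp_Cond wp_IAssign wp_Skip) (auto simp: I_def agree_def)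
  qed simp
  have "wp (count_loop r f e pre b) (1 + (2 + L * (T + Suc 1 + 2))) (\<lambda>s'. I L s' \<and> nats s' f 0 = L) s"
    unfolding count_loop_def
    by (intro wp_Seq wp_IAssign wp_For[where I = I] step)
      (use e fr in \<open>auto simp: I_def agree_def\<close>)
  then show ?thesis by (rule wp_mono) (auto simp: I_def loop_time_def algebra_simps)
qed

definition sum_loop :: "vname \<Rightarrow> vname \<Rightarrow> iexp \<Rightarrow> bexp \<Rightarrow> rexp \<Rightarrow> com" where
  "sum_loop r f e b a = Seq (RAssign r (IConst 0) (RConst 0))
     (For f 0 e (Cond b (RAssign r (IConst 0) (RPlus (RArr r (IConst 0)) a)) Skip))"

lemma mods_sum_loop [simp]:
  "nmods (sum_loop r f e b a) = {f}" "rmods (sum_loop r f e b a) = {r}"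
  by (auto simp: sum_loop_def)

lemma wp_sum_loop:
  assumes e: "\<And>s'. agree {f} {r} s s' \<Longrightarrow> ival e s' = L"
    and b: "\<And>i s'. i < L \<Longrightarrow> agree {f} {r} s s' \<Longrightarrow> nats s' f 0 = i \<Longrightarrow>
      bval b s' = B i \<and> (B i \<longrightarrow> rval a s' = A i)"
  shows "wp (sum_loop r f e b a) (loop_time L 0) (\<lambda>s'. reals s' r 0 = (\<Sum>i | i < L \<and> B i. A i)) s"
proof -
  define I where "I i s' \<longleftrightarrow> agree {f} {r} s s' \<and> reals s' r 0 = (\<Sum>j | j < i \<and> B j. A j)" for i s'
  have step: "wp (Cond b (RAssign r (IConst 0) (RPlus (RArr r (IConst 0)) a)) Skip) (Suc 1)
      (\<lambda>s''. nats s'' f 0 = i \<and> I (Suc i) (nat_store f 0 (Suc i) s'')) s'"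
    if i: "i < L" "I i s'" "nats s' f 0 = i" for i s'
  proof -
    have "{j. j < Suc i \<and> B j} = (if B i then insert i {j. j < i \<and> B j} else {j. j < i \<and> B j})"
      by (auto simp: less_Suc_eq)
    then have "(\<Sum>j | j < Suc i \<and> B j. A j) = (\<Sum>j | j < i \<and> B j. A j) + (if B i then A i else 0)" by simp
    then show ?thesis using b[of i s'] i
      by (intro wp_Cond wp_RAssign wp_Skip) (auto simp: I_def agree_def)
  qed
  have "wp (sum_loop r f e b a) (1 + (2 + L * (Suc 1 + 2))) (\<lambda>s'. I L s' \<and> nats s' f 0 = L) s"
    unfolding sum_loop_def
    by (intro wp_Seq wp_RAssign wp_For[where I = I] step)
      (use e in \<open>auto simp: I_def agree_def\<close>)
  then show ?thesis by (rule wp_mono) (auto simp: I_def loop_time_def algebra_simps)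
qed

definition fill_loop :: "vname \<Rightarrow> vname \<Rightarrow> iexp \<Rightarrow> com \<Rightarrow> iexp \<Rightarrow> com" where
  "fill_loop y f e pre a = For f 0 e (Seq pre (IAssign y (var f) a))"

lemma mods_fill_loop [simp]:
  "nmods (fill_loop y f e pre a) = {y, f} \<union> nmods pre" "rmods (fill_loop y f e pre a) = rmods pre"
  by (auto simp: fill_loop_def)

text \<open>A round may rely on its own cell still holding the initial value, so the loop can also
  update an array in place, as when taking cellwise minima.\<close>

lemma wp_fill_loop:
  assumes fr: "f \<noteq> y" "y \<notin> nmods pre" "f \<notin> nmods pre"
    and e: "\<And>s'. agree ({y, f} \<union> nmods pre) (rmods pre) s s' \<Longrightarrow> ival e s' = L"
    and pre: "\<And>i s'. i < L \<Longrightarrow> agree ({y, f} \<union> nmods pre) (rmods pre) s s' \<Longrightarrow> nats s' f 0 = i \<Longrightarrow>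
      nats s' y i = nats s y i \<Longrightarrow> wp pre T (\<lambda>s''. ival a s'' = g i) s'"
  shows "wp (fill_loop y f e pre a) (loop_time L T) (\<lambda>s'. \<forall>i<L. nats s' y i = g i) s"
proof -
  let ?X = "{y, f} \<union> nmods pre"
  define I where "I i s' \<longleftrightarrow> agree ?X (rmods pre) s s' \<and>
     (\<forall>j. nats s' y j = (if j < i then g j else nats s y j))" for i s'
  have step: "wp (Seq pre (IAssign y (var f) a)) (T + 1)
      (\<lambda>s''. nats s'' f 0 = i \<and> I (Suc i) (nat_store f 0 (Suc i) s'')) s'"
    if i: "i < L" "I i s'" "nats s' f 0 = i" for i s'
  proof (rule wp_Seq, rule wp_mono[OF wp_frame[OF pre]])
    show "i < L" "agree ?X (rmods pre) s s'" "nats s' f 0 = i" "nats s' y i = nats s y i"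
      using i by (auto simp: I_def)
  next
    fix s1 assume s1: "ival a s1 = g i \<and> agree (nmods pre) (rmods pre) s' s1"
    then show "wp (IAssign y (var f) a) 1
       (\<lambda>s''. nats s'' f 0 = i \<and> I (Suc i) (nat_store f 0 (Suc i) s'')) s1"
      using i fr by (intro wp_IAssign) (auto simp: I_def agree_def)
  qed simp
  have "wp (fill_loop y f e pre a) (2 + L * (T + 1 + 2)) (\<lambda>s'. I L s' \<and> nats s' f 0 = L) s"
    unfolding fill_loop_def
    by (intro wp_For[where I = I] step) (use e fr in \<open>auto simp: I_def agree_def\<close>)
  then show ?thesis by (rule wp_mono) (auto simp: I_def loop_time_def algebra_simps)
qed

text \<open>The set \<open>V\<close> collects the contents of \<open>x\<close> for which \<open>leaf\<close> has been run.\<close>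

fun enum :: "vname \<Rightarrow> iexp \<Rightarrow> com \<Rightarrow> nat \<Rightarrow> com" where
  "enum x e leaf 0 = leaf"
| "enum x e leaf (Suc d) = For x d e (enum x e leaf d)"

fun enum_time :: "nat \<Rightarrow> nat \<Rightarrow> nat \<Rightarrow> nat" where
  "enum_time L T 0 = T"
| "enum_time L T (Suc d) = 2 + L * (enum_time L T d + 2)"

text \<open>The nested counters themselves form the tuple under test, so the leaf must leave
  \<open>x\<close> unchanged. On exit only the cells from d on keep their values.\<close>

lemma wp_enum:
  assumes leaf: "\<And>V s. P V s \<Longrightarrow>
      wp leaf T (\<lambda>s'. P (insert (nats s x) V) s' \<and> nats s' x = nats s x) s"
    and P_store: "\<And>V d i s. P V s \<Longrightarrow> P V (nat_store x d i s)"
    and lim: "\<And>V s. P V s \<Longrightarrow> ival e s = L"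
    and P: "P V s"
  shows "wp (enum x e leaf d) (enum_time L T d)
    (\<lambda>s'. P (V \<union> {w. (\<forall>i\<ge>d. w i = nats s x i) \<and> (\<forall>i<d. w i < L)}) s' \<and> (\<forall>i\<ge>d. nats s' x i = nats s x i)) s"
  using P
proof (induction d arbitrary: V s)
  case 0
  have "{w. \<forall>i. w i = nats s x i} = {nats s x}" by auto
  then have "V \<union> {w. \<forall>i. w i = nats s x i} = insert (nats s x) V" by auto
  then show ?case using leaf[OF 0] by (simp add: fun_eq_iff)
next
  case (Suc d)
  \<comment> \<open>The tuples already visited when the outermost counter, cell d, has reached
    i.\<close>
  define box where "box i = {w. (\<forall>j\<ge>Suc d. w j = nats s x j) \<and> (\<forall>j<d. w j < L) \<and> w d < i}" for i
  define I where "I i s' \<longleftrightarrow> P (V \<union> box i) s' \<and> (\<forall>j\<ge>Suc d. nats s' x j = nats s x j)" for i s'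
  have box0: "box 0 = {}" by (auto simp: box_def)
  have boxS: "box (Suc i) = box i \<union> {w. (\<forall>j\<ge>d. w j = nats s' x j) \<and> (\<forall>j<d. w j < L)}"
    if "nats s' x d = i" "\<forall>j\<ge>Suc d. nats s' x j = nats s x j" for i s'
  proof -
    have "(\<forall>j\<ge>d. w j = nats s' x j) \<longleftrightarrow> w d = i \<and> (\<forall>j\<ge>Suc d. w j = nats s x j)" for w
      using that by (metis Suc_leD le_antisym not_less_eq_eq)
    then show ?thesis by (auto simp: box_def less_Suc_eq)
  qed
  have step: "wp (enum x e leaf d) (enum_time L T d)
      (\<lambda>s''. nats s'' x d = i \<and> I (Suc i) (nat_store x d (Suc i) s'')) s'"
    if i: "i < L" "I i s'" "nats s' x d = i" for i s'
  proof (rule wp_mono[OF Suc.IH])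
    show "P (V \<union> box i) s'" using i by (simp add: I_def)
  next
    fix s'' assume *: "P (V \<union> box i \<union> {w. (\<forall>j\<ge>d. w j = nats s' x j) \<and> (\<forall>j<d. w j < L)}) s'' \<and>
      (\<forall>j\<ge>d. nats s'' x j = nats s' x j)"
    have "P (V \<union> box (Suc i)) s''" using * i boxS[of s' i] by (simp add: I_def Un_assoc)
    then show "nats s'' x d = i \<and> I (Suc i) (nat_store x d (Suc i) s'')"
      using * i by (auto simp: I_def P_store)
  qed simp
  have "wp (enum x e leaf (Suc d)) (enum_time L T (Suc d)) (\<lambda>s'. I L s' \<and> nats s' x d = L) s"
    unfolding enum.simps enum_time.simps
    by (rule wp_For[where I = I]) (use step lim P_store[OF Suc.prems] in \<open>auto simp: I_def box0\<close>)
  moreover have "box L = {w. (\<forall>i\<ge>Suc d. w i = nats s x i) \<and> (\<forall>i<Suc d. w i < L)}"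
    by (auto simp: box_def less_Suc_eq)
  ultimately show ?case by (elim wp_mono) (auto simp: I_def)
qed

section \<open>Computing the keys\<close>

lemma wp_Seq_frame:
  assumes "wp c1 T1 Q1 s"
    and "\<And>s'. Q1 s' \<Longrightarrow> agree (nmods c1) (rmods c1) s s' \<Longrightarrow> wp c2 T2 Q s'"
  shows "wp (Seq c1 c2) (T1 + T2) Q s"
  by (rule wp_Seq, rule wp_mono[OF wp_frame[OF assms(1)]]) (use assms(2) in auto)

abbreviation BOr :: "bexp \<Rightarrow> bexp \<Rightarrow> bexp" where
  "BOr a b \<equiv> BNot (BAnd (BNot a) (BNot b))"

abbreviation IEq :: "iexp \<Rightarrow> iexp \<Rightarrow> bexp" where
  "IEq a b \<equiv> BAnd (BNot (ILess a b)) (BNot (ILess b a))"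

text \<open>Multiplication by a constant, unfolded into additions because the machine cannot
  multiply naturals.\<close>

fun imult :: "nat \<Rightarrow> iexp \<Rightarrow> iexp" where
  "imult 0 a = IConst 0"
| "imult (Suc k) a = IPlus a (imult k a)"

lemma ival_imult [simp]: "ival (imult k a) s = k * ival a s"
  by (induction k) auto

abbreviation size_of :: "vname \<Rightarrow> rexp" where "size_of e \<equiv> RArr ''size'' (var e)"
abbreviation colour_of :: "vname \<Rightarrow> iexp" where "colour_of e \<equiv> IArr ''colour'' (var e)"

definition large_test :: "nat \<Rightarrow> vname \<Rightarrow> bexp" where
  "large_test N e = RLess (RConst (1 / of_nat N ^ 2)) (size_of e)"

definition before_test :: "vname \<Rightarrow> vname \<Rightarrow> bexp" where
  "before_test f e = BOr (ILess (colour_of f) (colour_of e))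
     (BAnd (IEq (colour_of f) (colour_of e))
        (BOr (RLess (size_of e) (size_of f))
           (BAnd (BNot (RLess (size_of f) (size_of e))) (ILess (var f) (var e)))))"

definition inp :: "nat \<Rightarrow> (nat \<Rightarrow> nat) \<Rightarrow> (nat \<Rightarrow> real) \<Rightarrow> state \<Rightarrow> bool" where
  "inp n col sz s \<longleftrightarrow> nats s ''n'' 0 = n \<and> nats s ''colour'' = col \<and> reals s ''size'' = sz"

lemma inp_agree:
  "inp n col sz s \<Longrightarrow> agree X Y s s' \<Longrightarrow> ''n'' \<notin> X \<Longrightarrow> ''colour'' \<notin> X \<Longrightarrow> ''size'' \<notin> Y \<Longrightarrow> inp n col sz s'"
  by (simp add: inp_def agree_def)

lemma bval_large_test: "inp n col sz s \<Longrightarrow> bval (large_test N e) s \<longleftrightarrow> large_item N sz (nats s e 0)"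
  by (simp add: large_test_def large_item_def inp_def of_rat_divide of_rat_power)

lemma bval_before_test:
  "inp n col sz s \<Longrightarrow> bval (before_test f e) s \<longleftrightarrow> before col sz (nats s f 0) (nats s e 0)"
  by (auto simp: before_test_def before_def inp_def)

definition rank_prog :: "nat \<Rightarrow> com" where
  "rank_prog N = fill_loop ''key'' ''e'' (var ''n'')
     (count_loop ''r'' ''f'' (var ''n'') Skip (BAnd (large_test N ''f'') (before_test ''f'' ''e''))) (var ''r'')"

lemma wp_rank_prog:
  assumes "inp n col sz s"
  shows "wp (rank_prog N) (loop_time n (loop_time n 1))
    (\<lambda>s'. \<forall>e<n. nats s' ''key'' e = card {f. f < n \<and> large_item N sz f \<and> before col sz f e}) s"
  unfolding rank_prog_def
proof (rule wp_fill_loop)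
  fix i s1 assume s1: "agree ({''key'', ''e''} \<union> nmods (count_loop ''r'' ''f'' (var ''n'') Skip (BAnd (large_test N ''f'') (before_test ''f'' ''e''))))
      (rmods (count_loop ''r'' ''f'' (var ''n'') Skip (BAnd (large_test N ''f'') (before_test ''f'' ''e'')))) s s1" "nats s1 ''e'' 0 = i"
  have inp1: "inp n col sz s1" using inp_agree[OF assms s1(1)] by simp
  show "wp (count_loop ''r'' ''f'' (var ''n'') Skip (BAnd (large_test N ''f'') (before_test ''f'' ''e''))) (loop_time n 1)
     (\<lambda>s'. ival (var ''r'') s' = card {f. f < n \<and> large_item N sz f \<and> before col sz f i}) s1"
    unfolding ival.simps
  proof (rule wp_count_loop)
    fix j s2 assume s2: "agree ({''r'', ''f''} \<union> nmods Skip) (rmods Skip) s1 s2" "nats s2 ''f'' 0 = j"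
    have "inp n col sz s2" using inp_agree[OF inp1 s2(1)] by simp
    moreover have "nats s2 ''e'' 0 = i" using s1(2) s2(1) by (simp add: agree_def)
    ultimately show "wp Skip 1 (\<lambda>s'. bval (BAnd (large_test N ''f'') (before_test ''f'' ''e'')) s' =
        (large_item N sz j \<and> before col sz j i)) s2"
      using s2(2) by (intro wp_Skip) (simp add: bval_large_test bval_before_test)
  qed (use inp1 in \<open>auto simp: inp_def agree_def\<close>)
qed (use assms in \<open>auto simp: inp_def agree_def\<close>)

section \<open>Greedy blocks of small items\<close>

definition block_step :: "nat \<Rightarrow> com" where
  "block_step N = Cond (BAnd (BNot (large_test N ''e'')) (IEq (colour_of ''e'') (var ''c'')))
     (Seq (Cond (RLess (RConst (1 / of_nat N)) (RPlus (RArr ''load'' (IConst 0)) (size_of ''e'')))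
             (Seq (IAssign ''blk'' (IConst 0) (IPlus (var ''blk'') (IConst 1))) (RAssign ''load'' (IConst 0) (RConst 0)))
             Skip)
        (Seq (RAssign ''load'' (IConst 0) (RPlus (RArr ''load'' (IConst 0)) (size_of ''e'')))
           (IAssign ''key'' (var ''e'') (var ''blk''))))
     Skip"

definition colour_blocks_prog :: "nat \<Rightarrow> com" where
  "colour_blocks_prog N = Seq (RAssign ''load'' (IConst 0) (RConst 0))
     (Seq (For ''e'' 0 (var ''n'') (block_step N))
        (IAssign ''blk'' (IConst 0) (IPlus (var ''blk'') (IConst 1))))"

definition block_load ::
  "nat \<Rightarrow> (nat \<Rightarrow> real) \<Rightarrow> (nat \<Rightarrow> nat) \<Rightarrow> nat \<Rightarrow> nat \<Rightarrow> (nat \<Rightarrow> nat) \<Rightarrow> nat \<Rightarrow> real" where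
  "block_load N sz col c i key \<kappa> = (\<Sum>e | e < i \<and> \<not> large_item N sz e \<and> col e = c \<and> key e = \<kappa>. sz e)"

lemma block_load_skip:
  assumes "large_item N sz i \<or> col i \<noteq> c"
  shows "block_load N sz col c (Suc i) key \<kappa> = block_load N sz col c i key \<kappa>"
  unfolding block_load_def by (rule sum.cong) (use assms in \<open>auto simp: less_Suc_eq\<close>)

lemma block_load_Suc:
  assumes "\<not> large_item N sz i" "col i = c"
  shows "block_load N sz col c (Suc i) (key(i := k)) \<kappa> =
    block_load N sz col c i key \<kappa> + (if \<kappa> = k then sz i else 0)"
proof -
  have "{e. e < Suc i \<and> \<not> large_item N sz e \<and> col e = c \<and> (key(i := k)) e = \<kappa>} =
    (if \<kappa> = k then insert i else id) {e. e < i \<and> \<not> large_item N sz e \<and> col e = c \<and> key e = \<kappa>}"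
    using assms by (auto simp: less_Suc_eq)
  then show ?thesis by (simp add: block_load_def add.commute)
qed

text \<open>The block being filled has number \<open>blk\<close>, so the bounds on keys include it;
  it alone may be underfull. The old keys \<open>k\<^sub>0\<close> survive everywhere else, so
  passes for different colours do not interfere.\<close>

definition block_inv where
  "block_inv N sz col c k\<^sub>0 b\<^sub>0 i key blk load \<longleftrightarrow>
     b\<^sub>0 \<le> blk \<and> load = block_load N sz col c i key blk \<and> load \<le> 1 / real N \<and>
     (\<forall>e. \<not> (e < i \<and> \<not> large_item N sz e \<and> col e = c) \<longrightarrow> key e = k\<^sub>0 e) \<and>
     (\<forall>e<i. \<not> large_item N sz e \<and> col e = c \<longrightarrow> b\<^sub>0 \<le> key e \<and> key e \<le> blk) \<and>
     (\<forall>\<kappa>. b\<^sub>0 \<le> \<kappa> \<and> \<kappa> < blk \<longrightarrow> block_load N sz col c i key \<kappa> \<le> 1 / N \<and>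
        1 / N - 1 / real N ^ 2 \<le> block_load N sz col c i key \<kappa>)"

lemma block_inv_skip:
  assumes "block_inv N sz col c k\<^sub>0 b\<^sub>0 i key blk load" "large_item N sz i \<or> col i \<noteq> c"
  shows "block_inv N sz col c k\<^sub>0 b\<^sub>0 (Suc i) key blk load"
  using assms(1) unfolding block_inv_def block_load_skip[where N = N and sz = sz and col = col and c = c and i = i, OF assms(2)]
  using assms(2) by (auto simp: less_Suc_eq)

lemma block_inv_same:
  assumes inv: "block_inv N sz col c k\<^sub>0 b\<^sub>0 i key blk load"
    and i: "\<not> large_item N sz i" "col i = c" and fits: "load + sz i \<le> 1 / N"
  shows "block_inv N sz col c k\<^sub>0 b\<^sub>0 (Suc i) (key(i := blk)) blk (load + sz i)"
  using inv fits i unfolding block_inv_def block_load_Suc[where N = N and sz = sz and col = col and c = c and i = i, OF i] by (auto simp: less_Suc_eq)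

text \<open>A small item is at most 1 / N^2; if it overflows a block, that block already has load
  above 1 / N - 1 / N^2. The next block is still empty, since keys given in this pass do not exceed
  \<open>blk\<close>.\<close>

lemma block_inv_new:
  assumes inv: "block_inv N sz col c k\<^sub>0 b\<^sub>0 i key blk load" and N: "0 < N"
    and i: "\<not> large_item N sz i" "col i = c" and full: "1 / N < load + sz i"
  shows "block_inv N sz col c k\<^sub>0 b\<^sub>0 (Suc i) (key(i := Suc blk)) (Suc blk) (sz i)"
proof -
  have small: "sz i \<le> 1 / real N ^ 2" using i by (simp add: large_item_def)
  also have "\<dots> \<le> 1 / real N" using N by (simp add: field_simps power2_eq_square)
  finally have "sz i \<le> 1 / N" .
  moreover have "{e. e < i \<and> \<not> large_item N sz e \<and> col e = c \<and> key e = Suc blk} = {}"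
    using inv by (fastforce simp: block_inv_def)
  then have "block_load N sz col c i key (Suc blk) = 0" by (simp add: block_load_def del: Collect_empty_eq)
  moreover have "1 / N - 1 / real N ^ 2 \<le> load" using full small by linarith
  ultimately show ?thesis
    using inv i unfolding block_inv_def block_load_Suc[where N = N and sz = sz and col = col and c = c and i = i, OF i]
    by (auto simp: less_Suc_eq le_Suc_eq)
qed

lemma wp_block_step:
  assumes "inp n col sz s" "nats s ''e'' 0 = i" "nats s ''c'' 0 = c" "0 < N"
    and "block_inv N sz col c k\<^sub>0 b\<^sub>0 i (nats s ''key'') (nats s ''blk'' 0) (reals s ''load'' 0)"
  shows "wp (block_step N) 6
    (\<lambda>s'. block_inv N sz col c k\<^sub>0 b\<^sub>0 (Suc i) (nats s' ''key'') (nats s' ''blk'' 0) (reals s' ''load'' 0)) s"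
proof -
  have "wp (block_step N) (Suc (Suc (1 + 1) + (1 + 1)))
    (\<lambda>s'. block_inv N sz col c k\<^sub>0 b\<^sub>0 (Suc i) (nats s' ''key'') (nats s' ''blk'' 0) (reals s' ''load'' 0)) s"
  proof (cases "\<not> large_item N sz i \<and> col i = c")
    case True
    then have b: "bval (BAnd (BNot (large_test N ''e'')) (IEq (colour_of ''e'') (var ''c''))) s"
      using assms by (auto simp: bval_large_test[OF assms(1)] inp_def)
    show ?thesis unfolding block_step_def
    proof (rule wp_Cond, goal_cases)
      case 1
      have r: "reals s ''size'' (nats s ''e'' 0) = sz i" using assms by (simp add: inp_def)
      show ?case
      proof (rule wp_Seq, rule wp_Cond, goal_cases)
        case 1
        then have full: "1 / N < reals s ''load'' 0 + sz i" using r by (simp add: of_rat_divide)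
        show ?case
          using block_inv_new[OF assms(5,4) _ _ full] True assms(2) r
          by (intro wp_Seq wp_IAssign wp_RAssign) (simp add: fun_upd_def)
      next
        case 2
        then have full: "reals s ''load'' 0 + sz i \<le> 1 / N" using r by (simp add: of_rat_divide)
        have "wp Skip 1 (wp (Seq (RAssign ''load'' (IConst 0) (RPlus (RArr ''load'' (IConst 0)) (size_of ''e'')))
           (IAssign ''key'' (var ''e'') (var ''blk''))) (1 + 1)
           (\<lambda>s'. block_inv N sz col c k\<^sub>0 b\<^sub>0 (Suc i) (nats s' ''key'') (nats s' ''blk'' 0) (reals s' ''load'' 0))) s"
          using block_inv_same[OF assms(5) _ _ full] True assms(2) r
          by (intro wp_Skip wp_Seq wp_IAssign wp_RAssign) (simp add: fun_upd_def)
        then show ?case by (rule wp_mono) auto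
      qed
    next
      case 2
      then show ?case using b by blast
    qed
  next
    case False
    then have b: "\<not> bval (BAnd (BNot (large_test N ''e'')) (IEq (colour_of ''e'') (var ''c''))) s"
      using assms by (auto simp: bval_large_test[OF assms(1)] inp_def)
    have "wp Skip 1 (\<lambda>s'. block_inv N sz col c k\<^sub>0 b\<^sub>0 (Suc i) (nats s' ''key'') (nats s' ''blk'' 0) (reals s' ''load'' 0)) s"
      by (rule wp_Skip) (use block_inv_skip[OF assms(5)] False in auto)
    then show ?thesis unfolding block_step_def
      by (intro wp_Cond, use b in blast) (erule wp_mono, auto)
  qed
  then show ?thesis by (rule wp_mono) auto
qed

lemma nmods_block_step [simp]: "nmods (block_step N) = {''blk'', ''key''}"
  and rmods_block_step [simp]: "rmods (block_step N) = {''load''}"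
  by (auto simp: block_step_def)

lemma wp_colour_blocks_prog:
  assumes inp: "inp n col sz s" and c: "nats s ''c'' 0 = c" and N: "0 < N"
  shows "wp (colour_blocks_prog N) (4 + n * 8)
    (\<lambda>s'. block_keys N n col sz (nats s' ''key'') c (nats s ''blk'' 0) (nats s' ''blk'' 0) \<and>
       (\<forall>e. \<not> (\<not> large_item N sz e \<and> col e = c) \<longrightarrow> nats s' ''key'' e = nats s ''key'' e)) s"
proof -
  define k\<^sub>0 b\<^sub>0 where "k\<^sub>0 = nats s ''key''" and "b\<^sub>0 = nats s ''blk'' 0"
  define I where "I i s' \<longleftrightarrow> inp n col sz s' \<and> nats s' ''c'' 0 = c \<and>
    block_inv N sz col c k\<^sub>0 b\<^sub>0 i (nats s' ''key'') (nats s' ''blk'' 0) (reals s' ''load'' 0)" for i s'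
  have loop: "wp (For ''e'' 0 (var ''n'') (block_step N)) (2 + n * (6 + 2)) (\<lambda>s'. I n s' \<and> nats s' ''e'' 0 = n)
     (real_store ''load'' 0 0 s)"
  proof (rule wp_For)
    show "I 0 (nat_store ''e'' 0 0 (real_store ''load'' 0 0 s))"
      using inp c by (simp add: I_def inp_def block_inv_def block_load_def k\<^sub>0_def b\<^sub>0_def)
    fix i s' assume *: "I i s'" "nats s' ''e'' 0 = i"
    show "ival (var ''n'') s' = n" using * by (simp add: I_def inp_def)
    show "wp (block_step N) 6 (\<lambda>s''. nats s'' ''e'' 0 = i \<and> I (Suc i) (nat_store ''e'' 0 (Suc i) s'')) s'"
    proof (rule wp_mono[OF wp_frame[OF wp_block_step[where c = c and k\<^sub>0 = k\<^sub>0 and b\<^sub>0 = b\<^sub>0]]])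
      show "inp n col sz s'" "nats s' ''e'' 0 = i" "nats s' ''c'' 0 = c"
        "block_inv N sz col c k\<^sub>0 b\<^sub>0 i (nats s' ''key'') (nats s' ''blk'' 0) (reals s' ''load'' 0)"
        using * by (auto simp: I_def)
    qed (use * N in \<open>auto simp: I_def inp_def agree_def\<close>)
  qed
  have "wp (colour_blocks_prog N) (1 + ((2 + n * (6 + 2)) + 1))
    (\<lambda>s'. block_keys N n col sz (nats s' ''key'') c (nats s ''blk'' 0) (nats s' ''blk'' 0) \<and>
       (\<forall>e. \<not> (\<not> large_item N sz e \<and> col e = c) \<longrightarrow> nats s' ''key'' e = nats s ''key'' e)) s"
    unfolding colour_blocks_prog_def
  proof (intro wp_Seq wp_RAssign, goal_cases)
    case 1
    have "wp (For ''e'' 0 (var ''n'') (block_step N)) (2 + n * (6 + 2)) (\<lambda>s'. I n s' \<and> nats s' ''e'' 0 = n)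
      (real_store ''load'' (ival (IConst 0) s) (rval (RConst 0) s) s)" using loop by simp
    then show ?case
    proof (rule wp_mono)
      fix s' assume "I n s' \<and> nats s' ''e'' 0 = n"
      then have inv: "block_inv N sz col c k\<^sub>0 b\<^sub>0 n (nats s' ''key'') (nats s' ''blk'' 0) (reals s' ''load'' 0)"
        by (simp add: I_def)
      \<comment> \<open>The final increment turns the inclusive number of the last block into the
        exclusive end of the interval, where the next colour starts.\<close>
      have "block_keys N n col sz (nats s' ''key'') c b\<^sub>0 (Suc (nats s' ''blk'' 0))"
        unfolding block_keys_def block_load_def[symmetric]
      proof (intro conjI allI impI)
        fix \<kappa> assume \<kappa>: "b\<^sub>0 \<le> \<kappa> \<and> \<kappa> < Suc (nats s' ''blk'' 0)"
        then show "block_load N sz col c n (nats s' ''key'') \<kappa> \<le> 1 / N"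
          using inv by (cases "\<kappa> = nats s' ''blk'' 0") (auto simp: block_inv_def)
        assume "Suc \<kappa> < Suc (nats s' ''blk'' 0)"
        then show "1 / N - 1 / real N ^ 2 \<le> block_load N sz col c n (nats s' ''key'') \<kappa>"
          using inv \<kappa> by (auto simp: block_inv_def)
      qed (use inv in \<open>auto simp: block_inv_def\<close>)
      then show "wp (IAssign ''blk'' (IConst 0) (IPlus (var ''blk'') (IConst 1))) 1
         (\<lambda>s'. block_keys N n col sz (nats s' ''key'') c (nats s ''blk'' 0) (nats s' ''blk'' 0) \<and>
       (\<forall>e. \<not> (\<not> large_item N sz e \<and> col e = c) \<longrightarrow> nats s' ''key'' e = nats s ''key'' e)) s'"
        by (intro wp_IAssign) (use inv in \<open>simp add: block_inv_def k\<^sub>0_def b\<^sub>0_def\<close>)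
    qed simp
  qed
  then show ?thesis by (rule wp_mono) auto
qed

definition keys_prog :: "nat \<Rightarrow> nat \<Rightarrow> com" where
  "keys_prog N m = Seq (rank_prog N)
     (Seq (count_loop ''blk'' ''e'' (var ''n'') Skip (large_test N ''e''))
        (For ''c'' 0 (IConst (Suc m)) (colour_blocks_prog N)))"

text \<open>Lets the result for a colour survive the passes for later colours, which change no key
  of its small items.\<close>

lemma block_keys_cong:
  assumes "\<And>e. e < n \<Longrightarrow> \<not> large_item N sz e \<Longrightarrow> col e = c \<Longrightarrow> key e = key' e"
  shows "block_keys N n col sz key c a b = block_keys N n col sz key' c a b"
proof -
  have "{e. e < n \<and> \<not> large_item N sz e \<and> col e = c \<and> key e = \<kappa>} =
     {e. e < n \<and> \<not> large_item N sz e \<and> col e = c \<and> key' e = \<kappa>}" for \<kappa> using assms by auto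
  moreover have "(\<forall>e<n. \<not> large_item N sz e \<and> col e = c \<longrightarrow> a \<le> key e \<and> key e < b) \<longleftrightarrow>
    (\<forall>e<n. \<not> large_item N sz e \<and> col e = c \<longrightarrow> a \<le> key' e \<and> key' e < b)" using assms by auto
  ultimately show ?thesis unfolding block_keys_def by simp
qed

lemma nmods_colour_blocks [simp]: "nmods (colour_blocks_prog N) = {''e'', ''blk'', ''key''}"
  and rmods_colour_blocks [simp]: "rmods (colour_blocks_prog N) = {''load''}"
  by (auto simp: colour_blocks_prog_def)

lemma mods_rank_prog [simp]: "nmods (rank_prog N) = {''key'', ''e'', ''r'', ''f''}" "rmods (rank_prog N) = {}"
  by (auto simp: rank_prog_def)

lemma nmods_keys_prog [simp]: "nmods (keys_prog N m) = {''key'', ''e'', ''r'', ''f'', ''blk'', ''c''}"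
  and rmods_keys_prog [simp]: "rmods (keys_prog N m) = {''load''}"
  by (auto simp: keys_prog_def)

definition keys_time :: "nat \<Rightarrow> nat \<Rightarrow> nat" where
  "keys_time m n = loop_time n (loop_time n 1) + (loop_time n 1 + (2 + Suc m * (4 + n * 8 + 2)))"

lemma wp_keys_prog:
  assumes inp: "inp n col sz s" and N: "0 < N"
  shows "wp (keys_prog N m) (keys_time m n) (\<lambda>s'. \<exists>st. valid_keys N m n col sz (nats s' ''key'') st) s"
  unfolding keys_prog_def keys_time_def
proof (rule wp_Seq_frame[OF wp_rank_prog[OF inp]])
  fix s1 assume rank: "\<forall>e<n. nats s1 ''key'' e = card {f. f < n \<and> large_item N sz f \<and> before col sz f e}"
    and "agree (nmods (rank_prog N)) (rmods (rank_prog N)) s s1"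
  from inp_agree[OF inp this(2)] have inp1: "inp n col sz s1" by simp
  show "wp (Seq (count_loop ''blk'' ''e'' (var ''n'') Skip (large_test N ''e''))
        (For ''c'' 0 (IConst (Suc m)) (colour_blocks_prog N))) (loop_time n 1 + (2 + Suc m * (4 + n * 8 + 2)))
      (\<lambda>s'. \<exists>st. valid_keys N m n col sz (nats s' ''key'') st) s1"
  proof (rule wp_Seq_frame)
    show "wp (count_loop ''blk'' ''e'' (var ''n'') Skip (large_test N ''e'')) (loop_time n 1)
      (\<lambda>s'. nats s' ''blk'' 0 = card {e. e < n \<and> large_item N sz e}) s1"
    proof (rule wp_count_loop)
      fix j s2 assume s2: "agree ({''blk'', ''e''} \<union> nmods Skip) (rmods Skip) s1 s2" "nats s2 ''e'' 0 = j"
      have "inp n col sz s2" using inp_agree[OF inp1 s2(1)] by simp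
      then show "wp Skip 1 (\<lambda>s'. bval (large_test N ''e'') s' = large_item N sz j) s2"
        using s2(2) by (intro wp_Skip) (simp add: bval_large_test)
    qed (use inp1 in \<open>auto simp: inp_def agree_def\<close>)
  next
    fix s2 assume blk: "nats s2 ''blk'' 0 = card {e. e < n \<and> large_item N sz e}"
      and ag: "agree (nmods (count_loop ''blk'' ''e'' (var ''n'') Skip (large_test N ''e'')))
        (rmods (count_loop ''blk'' ''e'' (var ''n'') Skip (large_test N ''e''))) s1 s2"
    from inp_agree[OF inp1 ag] have inp2: "inp n col sz s2" by simp
    have key2: "nats s2 ''key'' = nats s1 ''key''" using ag by (simp add: agree_def)
    \<comment> \<open>Large keys stay pinned to the ranks computed first, while \<open>st\<close> is
      built one boundary at a time from the values of \<open>blk\<close> between passes.\<close>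
    define I where "I c s' \<longleftrightarrow> inp n col sz s' \<and> (\<forall>e. large_item N sz e \<longrightarrow> nats s' ''key'' e = nats s1 ''key'' e) \<and>
      (\<exists>st. st 0 = card {e. e < n \<and> large_item N sz e} \<and> st c = nats s' ''blk'' 0 \<and>
         (\<forall>c'<c. block_keys N n col sz (nats s' ''key'') c' (st c') (st (Suc c'))))" for c s'
    have "wp (For ''c'' 0 (IConst (Suc m)) (colour_blocks_prog N)) (2 + Suc m * (4 + n * 8 + 2))
      (\<lambda>s'. I (Suc m) s' \<and> nats s' ''c'' 0 = Suc m) s2"
    proof (rule wp_For)
      show "I 0 (nat_store ''c'' 0 0 s2)"
        unfolding I_def using inp2 blk key2 by (auto simp: inp_def intro!: exI[of _ "\<lambda>_. nats s2 ''blk'' 0"])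
      fix c s' assume *: "I c s'" "nats s' ''c'' 0 = c"
      then have inp': "inp n col sz s'" by (simp add: I_def)
      from * obtain st where st: "st 0 = card {e. e < n \<and> large_item N sz e}" "st c = nats s' ''blk'' 0"
        "\<And>c'. c' < c \<Longrightarrow> block_keys N n col sz (nats s' ''key'') c' (st c') (st (Suc c'))"
        by (auto simp: I_def)
      show "wp (colour_blocks_prog N) (4 + n * 8)
        (\<lambda>s''. nats s'' ''c'' 0 = c \<and> I (Suc c) (nat_store ''c'' 0 (Suc c) s'')) s'"
      proof (rule wp_mono[OF wp_frame[OF wp_colour_blocks_prog[OF inp' *(2) N]]])
        fix s'' assume a: "(block_keys N n col sz (nats s'' ''key'') c (nats s' ''blk'' 0) (nats s'' ''blk'' 0) \<and>
            (\<forall>e. \<not> (\<not> large_item N sz e \<and> col e = c) \<longrightarrow> nats s'' ''key'' e = nats s' ''key'' e)) \<and>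
            agree (nmods (colour_blocks_prog N)) (rmods (colour_blocks_prog N)) s' s''"
        have inp'': "inp n col sz s''"
          by (rule inp_agree[OF inp' conjunct2[OF a]]) simp_all
        define st' where "st' = st(Suc c := nats s'' ''blk'' 0)"
        have "block_keys N n col sz (nats s'' ''key'') c' (st' c') (st' (Suc c'))" if "c' < Suc c" for c'
        proof (cases "c' = c")
          case True
          then show ?thesis using a st(2) by (simp add: st'_def)
        next
          case False
          then have "c' < c" using that by simp
          then have "block_keys N n col sz (nats s' ''key'') c' (st' c') (st' (Suc c'))"
            using st(3)[of c'] by (simp add: st'_def)
          then show ?thesis using a False by (subst block_keys_cong[where key' = "nats s' ''key''"]) auto
        qed
        then have "\<exists>st. st 0 = card {e. e < n \<and> large_item N sz e} \<and> st (Suc c) = nats s'' ''blk'' 0 \<and>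
          (\<forall>c'<Suc c. block_keys N n col sz (nats s'' ''key'') c' (st c') (st (Suc c')))"
          by (intro exI[of _ st']) (auto simp: st'_def st)
        then show "nats s'' ''c'' 0 = c \<and> I (Suc c) (nat_store ''c'' 0 (Suc c) s'')"
          using a * inp'' unfolding I_def by (simp add: agree_def inp_def)
      qed simp
    qed simp
    then show "wp (For ''c'' 0 (IConst (Suc m)) (colour_blocks_prog N)) (2 + Suc m * (4 + n * 8 + 2))
      (\<lambda>s'. \<exists>st. valid_keys N m n col sz (nats s' ''key'') st) s2"
    proof (rule wp_mono)
      fix s' assume "I (Suc m) s' \<and> nats s' ''c'' 0 = Suc m"
      then show "\<exists>st. valid_keys N m n col sz (nats s' ''key'') st"
        using rank unfolding I_def valid_keys_def by (auto simp: less_Suc_eq_le)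
    qed simp
  qed
qed

section \<open>Evaluating a guess\<close>

definition guess :: "nat \<Rightarrow> (nat \<Rightarrow> nat) \<Rightarrow> (nat \<times> nat) list" where
  "guess D x = map (\<lambda>u. (x (2 * u), x (2 * u + 1))) [0..<D]"

text \<open>D is constant, so the lookup is unrolled in the program text with literal indices.
  Subtraction happens only when q is at least the run length and is therefore exact.\<close>

fun runs_prog :: "nat \<Rightarrow> nat \<Rightarrow> com" where
  "runs_prog u 0 = IAssign ''v'' (IConst 0) (IConst 0)"
| "runs_prog u (Suc D) = Cond (ILess (var ''q'') (IArr ''x'' (IConst (2 * u + 1))))
     (IAssign ''v'' (IConst 0) (IPlus (IArr ''x'' (IConst (2 * u))) (var ''q'')))
     (Seq (IAssign ''q'' (IConst 0) (IMinus (var ''q'') (IArr ''x'' (IConst (2 * u + 1)))))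
        (runs_prog (Suc u) D))"

lemma nmods_runs_prog [simp]: "y \<noteq> ''v'' \<Longrightarrow> y \<noteq> ''q'' \<Longrightarrow> y \<notin> nmods (runs_prog u D)"
  and rmods_runs_prog [simp]: "rmods (runs_prog u D) = {}"
  by (induction u D rule: runs_prog.induct) auto

lemma wp_runs_prog:
  "nats s ''x'' = x \<Longrightarrow> wp (runs_prog u D) (2 * D + 1)
     (\<lambda>s'. nats s' ''v'' 0 = eval_runs (map (\<lambda>u. (x (2 * u), x (2 * u + 1))) [u..<u + D]) (nats s ''q'' 0)) s"
proof (induction D arbitrary: u s)
  case 0
  have "wp (runs_prog u 0) 1 (\<lambda>s'. nats s' ''v'' 0 = 0) s"
    unfolding runs_prog.simps by (rule wp_IAssign) simp
  then show ?case by simp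
next
  case (Suc D)
  have "[u..<u + Suc D] = u # [Suc u..<Suc u + D]" by (simp add: upt_conv_Cons)
  then have l: "map (\<lambda>u. (x (2 * u), x (2 * u + 1))) [u..<u + Suc D] =
      (x (2 * u), x (2 * u + 1)) # map (\<lambda>u. (x (2 * u), x (2 * u + 1))) [Suc u..<Suc u + D]"
    by (simp only: list.map)
  have "wp (runs_prog u (Suc D)) (Suc (1 + (2 * D + 1)))
     (\<lambda>s'. nats s' ''v'' 0 = eval_runs (map (\<lambda>u. (x (2 * u), x (2 * u + 1))) [u..<u + Suc D]) (nats s ''q'' 0)) s"
    unfolding runs_prog.simps l
  proof (rule wp_Cond, goal_cases)
    case 1
    have "wp (IAssign ''v'' (IConst 0) (IPlus (IArr ''x'' (IConst (2 * u))) (var ''q''))) 1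
     (\<lambda>s'. nats s' ''v'' 0 = eval_runs ((x (2 * u), x (2 * u + 1)) #
        map (\<lambda>u. (x (2 * u), x (2 * u + 1))) [Suc u..<Suc u + D]) (nats s ''q'' 0)) s"
      by (rule wp_IAssign) (use 1 Suc.prems in simp)
    then show ?case by (rule wp_mono) auto
  next
    case 2
    show ?case
    proof (intro wp_Seq wp_IAssign, rule wp_mono[OF Suc.IH])
      show "nats (nat_store ''q'' (ival (IConst 0) s) (ival (IMinus (var ''q'') (IArr ''x'' (IConst (2 * u + 1)))) s) s) ''x'' = x"
        using Suc.prems by simp
    qed (use 2 Suc.prems in simp_all)
  qed
  then show ?case by (rule wp_mono) auto
qed

definition assign_prog :: "nat \<Rightarrow> com" where
  "assign_prog D = fill_loop ''b'' ''e'' (var ''n'')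
     (Seq (IAssign ''q'' (IConst 0) (IArr ''key'' (var ''e''))) (runs_prog 0 D)) (var ''v'')"

lemma nmods_assign_prog [simp]:
    "y \<notin> {''b'', ''e'', ''q'', ''v''} \<Longrightarrow> y \<notin> nmods (assign_prog D)"
  and rmods_assign_prog [simp]: "rmods (assign_prog D) = {}"
  by (auto simp: assign_prog_def)

lemma wp_assign_prog:
  assumes "nats s ''n'' 0 = n"
  shows "wp (assign_prog D) (loop_time n (2 * D + 2))
    (\<lambda>s'. \<forall>e<n. nats s' ''b'' e = eval_runs (guess D (nats s ''x'')) (nats s ''key'' e)) s"
  unfolding assign_prog_def
proof (rule wp_fill_loop)
  let ?pre = "Seq (IAssign ''q'' (IConst 0) (IArr ''key'' (var ''e''))) (runs_prog 0 D)"
  fix i s' assume *: "agree ({''b'', ''e''} \<union> nmods ?pre) (rmods ?pre) s s'" "nats s' ''e'' 0 = i"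
  from * have 1: "nats s' ''x'' = nats s ''x''" "nats s' ''key'' = nats s ''key''"
    by (simp_all add: agree_def)
  have "wp ?pre (1 + (2 * D + 1))
      (\<lambda>s''. nats s'' ''v'' 0 = eval_runs (guess D (nats s ''x'')) (nats s ''key'' i)) s'"
  proof (intro wp_Seq wp_IAssign, rule wp_mono[OF wp_runs_prog])
    show "nats (nat_store ''q'' (ival (IConst 0) s') (ival (IArr ''key'' (var ''e'')) s') s') ''x'' = nats s ''x''"
      using 1 by simp
  qed (use * 1 in \<open>simp_all add: guess_def\<close>)
  then show "wp ?pre (2 * D + 2) (\<lambda>s''. ival (var ''v'') s'' =
      eval_runs (guess D (nats s ''x'')) (nats s ''key'' i)) s'" by (rule wp_mono) auto
next
  let ?pre = "Seq (IAssign ''q'' (IConst 0) (IArr ''key'' (var ''e''))) (runs_prog 0 D)"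
  fix s' assume "agree ({''b'', ''e''} \<union> nmods ?pre) (rmods ?pre) s s'"
  then show "ival (var ''n'') s' = n"
    using assms by (simp add: agree_def)
qed simp_all

section \<open>Feasibility and bin counts\<close>

definition bins_of :: "nat \<Rightarrow> (nat \<Rightarrow> nat) \<Rightarrow> (nat \<Rightarrow> nat) \<Rightarrow> nat \<Rightarrow> nat" where
  "bins_of n col b c = card (b ` {e. e < n \<and> (c = 0 \<or> col e = c)})"

text \<open>Labels without items carry no load, so testing the bins of items suffices.\<close>

definition feasible :: "nat \<Rightarrow> (nat \<Rightarrow> real) \<Rightarrow> (nat \<Rightarrow> nat) \<Rightarrow> bool" where
  "feasible n sz b \<longleftrightarrow> (\<forall>e<n. (\<Sum>f | f < n \<and> b f = b e. sz f) \<le> 1)"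

text \<open>Counting each bin at its first item avoids a table indexed by labels. Colour numbers
  start at 1, which frees c = 0 to select all items.\<close>

lemma bins_of_first:
  "bins_of n col b c = card {e. e < n \<and> (c = 0 \<or> col e = c) \<and>
     card {f. f < n \<and> f < e \<and> b f = b e \<and> (c = 0 \<or> col f = c)} = 0}" (is "_ = card ?A")
proof -
  define M where "M e \<longleftrightarrow> e < n \<and> (c = 0 \<or> col e = c)" for e
  have A: "?A = {e. M e \<and> (\<forall>f<e. M f \<longrightarrow> b f \<noteq> b e)}" by (auto simp: M_def)
  have "b ` {e. M e} = b ` {e. M e \<and> (\<forall>f<e. M f \<longrightarrow> b f \<noteq> b e)}"
  proof (rule equalityI, rule subsetI)
    fix y assume "y \<in> b ` {e. M e}"
    then have ex: "\<exists>e. M e \<and> b e = y" by auto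
    define e where "e = (LEAST e. M e \<and> b e = y)"
    have "M e \<and> b e = y" unfolding e_def by (rule LeastI_ex[OF ex])
    moreover have "b f \<noteq> y" if "f < e" "M f" for f
      using not_less_Least[of f "\<lambda>e. M e \<and> b e = y", folded e_def] that by blast
    ultimately show "y \<in> b ` {e. M e \<and> (\<forall>f<e. M f \<longrightarrow> b f \<noteq> b e)}" by blast
  qed auto
  moreover have "inj_on b {e. M e \<and> (\<forall>f<e. M f \<longrightarrow> b f \<noteq> b e)}"
    by (rule inj_onI) (metis (mono_tags, lifting) linorder_neqE_nat mem_Collect_eq)
  ultimately show ?thesis unfolding bins_of_def A M_def[symmetric] by (simp add: card_image)
qed

definition bad_prog :: com where
  "bad_prog = count_loop ''bad'' ''e'' (var ''n'')
     (sum_loop ''load'' ''f'' (var ''n'') (IEq (IArr ''b'' (var ''f'')) (IArr ''b'' (var ''e''))) (size_of ''f''))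
     (RLess (RConst 1) (RArr ''load'' (IConst 0)))"

lemma mods_bad_prog [simp]: "nmods bad_prog = {''bad'', ''e'', ''f''}" "rmods bad_prog = {''load''}"
  by (auto simp: bad_prog_def)

lemma wp_bad_prog:
  assumes inp: "inp n col sz s"
  shows "wp bad_prog (loop_time n (loop_time n 0)) (\<lambda>s'. nats s' ''bad'' 0 = 0 \<longleftrightarrow> feasible n sz (nats s ''b'')) s"
proof -
  let ?pre = "sum_loop ''load'' ''f'' (var ''n'') (IEq (IArr ''b'' (var ''f'')) (IArr ''b'' (var ''e''))) (size_of ''f'')"
  let ?L = "\<lambda>i. \<Sum>f | f < n \<and> nats s ''b'' f = nats s ''b'' i. sz f"
  have "wp bad_prog (loop_time n (loop_time n 0)) (\<lambda>s'. nats s' ''bad'' 0 = card {i. i < n \<and> 1 < ?L i}) s"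
    unfolding bad_prog_def
  proof (rule wp_count_loop)
    fix i s' assume *: "agree ({''bad'', ''e''} \<union> nmods ?pre) (rmods ?pre) s s'" "nats s' ''e'' 0 = i"
    have inp': "inp n col sz s'" using inp_agree[OF inp *(1)] by simp
    have b': "nats s' ''b'' = nats s ''b''" using * by (simp add: agree_def)
    have "wp ?pre (loop_time n 0) (\<lambda>s''. reals s'' ''load'' 0 = ?L i) s'"
      by (rule wp_sum_loop) (use inp' b' *(2) in \<open>auto simp: agree_def inp_def\<close>)
    then show "wp ?pre (loop_time n 0) (\<lambda>s''. bval (RLess (RConst 1) (RArr ''load'' (IConst 0))) s'' = (1 < ?L i)) s'"
      by (rule wp_mono) auto
  qed (use inp in \<open>auto simp: agree_def inp_def\<close>)
  moreover have "card {i. i < n \<and> 1 < ?L i} = 0 \<longleftrightarrow> feasible n sz (nats s ''b'')"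
    unfolding feasible_def by (subst card_0_eq) (auto simp: not_less simp del: Collect_empty_eq)
  ultimately show ?thesis by (elim wp_mono) simp_all
qed

definition match_test :: "vname \<Rightarrow> bexp" where
  "match_test e = BOr (ILess (var ''c'') (IConst 1)) (IEq (colour_of e) (var ''c''))"

lemma bval_match_test: "inp n col sz s \<Longrightarrow>
  bval (match_test e) s \<longleftrightarrow> nats s ''c'' 0 = 0 \<or> col (nats s e 0) = nats s ''c'' 0"
  by (auto simp: match_test_def inp_def)

definition dup_prog :: com where
  "dup_prog = count_loop ''r'' ''f'' (var ''n'') Skip (BAnd (ILess (var ''f'') (var ''e''))
     (BAnd (IEq (IArr ''b'' (var ''f'')) (IArr ''b'' (var ''e''))) (match_test ''f'')))"

lemma mods_dup_prog [simp]: "nmods dup_prog = {''r'', ''f''}" "rmods dup_prog = {}"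
  by (auto simp: dup_prog_def)

lemma wp_dup_prog:
  assumes inp: "inp n col sz s" and "nats s ''b'' = b" "nats s ''c'' 0 = c" "nats s ''e'' 0 = e"
  shows "wp dup_prog (loop_time n 1)
    (\<lambda>s'. nats s' ''r'' 0 = card {f. f < n \<and> f < e \<and> b f = b e \<and> (c = 0 \<or> col f = c)}) s"
  unfolding dup_prog_def
proof (rule wp_count_loop)
  fix j s' assume *: "agree ({''r'', ''f''} \<union> nmods Skip) (rmods Skip) s s'" "nats s' ''f'' 0 = j"
  have "inp n col sz s'" using inp_agree[OF inp *(1)] by simp
  moreover have "nats s' ''b'' = b" "nats s' ''c'' 0 = c" "nats s' ''e'' 0 = e"
    using * assms by (auto simp: agree_def)
  ultimately show "wp Skip 1 (\<lambda>s'. bval (BAnd (ILess (var ''f'') (var ''e''))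
     (BAnd (IEq (IArr ''b'' (var ''f'')) (IArr ''b'' (var ''e''))) (match_test ''f''))) s' =
     (j < e \<and> b j = b e \<and> (c = 0 \<or> col j = c))) s'"
    using *(2) by (intro wp_Skip) (auto simp: bval_match_test)
qed (use inp in \<open>auto simp: agree_def inp_def\<close>)

definition cnt_prog :: "nat \<Rightarrow> com" where
  "cnt_prog m = fill_loop ''cnt'' ''c'' (IConst (Suc m))
     (count_loop ''t'' ''e'' (var ''n'') dup_prog (BAnd (IEq (var ''r'') (IConst 0)) (match_test ''e''))) (var ''t'')"

lemma mods_cnt_prog [simp]: "nmods (cnt_prog m) = {''cnt'', ''c'', ''t'', ''e'', ''r'', ''f''}" "rmods (cnt_prog m) = {}"
  by (auto simp: cnt_prog_def)

lemma wp_cnt_prog: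
  assumes inp: "inp n col sz s"
  shows "wp (cnt_prog m) (loop_time (Suc m) (loop_time n (loop_time n 1)))
    (\<lambda>s'. \<forall>c<Suc m. nats s' ''cnt'' c = bins_of n col (nats s ''b'') c) s"
  unfolding cnt_prog_def
proof (rule wp_fill_loop)
  let ?cl = "count_loop ''t'' ''e'' (var ''n'') dup_prog (BAnd (IEq (var ''r'') (IConst 0)) (match_test ''e''))"
  let ?b = "nats s ''b''"
  fix c s1 assume *: "agree ({''cnt'', ''c''} \<union> nmods ?cl) (rmods ?cl) s s1" "nats s1 ''c'' 0 = c"
  have inp1: "inp n col sz s1" using inp_agree[OF inp *(1)] by simp
  have b1: "nats s1 ''b'' = ?b" using * by (simp add: agree_def)
  let ?B = "\<lambda>e. (c = 0 \<or> col e = c) \<and> card {f. f < n \<and> f < e \<and> ?b f = ?b e \<and> (c = 0 \<or> col f = c)} = 0"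
  have "wp ?cl (loop_time n (loop_time n 1)) (\<lambda>s'. nats s' ''t'' 0 = card {e. e < n \<and> ?B e}) s1"
  proof (rule wp_count_loop)
    fix e s2 assume **: "agree ({''t'', ''e''} \<union> nmods dup_prog) (rmods dup_prog) s1 s2" "nats s2 ''e'' 0 = e"
    have inp2: "inp n col sz s2" using inp_agree[OF inp1 **(1)] by simp
    have 2: "nats s2 ''b'' = ?b" "nats s2 ''c'' 0 = c" using ** b1 *(2) by (auto simp: agree_def)
    show "wp dup_prog (loop_time n 1)
      (\<lambda>s'. bval (BAnd (IEq (var ''r'') (IConst 0)) (match_test ''e'')) s' = ?B e) s2"
    proof (rule wp_mono[OF wp_frame[OF wp_dup_prog[OF inp2 2 **(2)]]])
      fix s3 assume a: "nats s3 ''r'' 0 = card {f. f < n \<and> f < e \<and> ?b f = ?b e \<and> (c = 0 \<or> col f = c)} \<and>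
        agree (nmods dup_prog) (rmods dup_prog) s2 s3"
      have "inp n col sz s3" by (rule inp_agree[OF inp2 conjunct2[OF a]]) simp_all
      moreover have "nats s3 ''c'' 0 = c" "nats s3 ''e'' 0 = e" using a 2 ** by (auto simp: agree_def)
      ultimately show "bval (BAnd (IEq (var ''r'') (IConst 0)) (match_test ''e'')) s3 = ?B e"
        using conjunct1[OF a] by (auto simp: bval_match_test)
    qed simp
  qed (use inp1 in \<open>auto simp: agree_def inp_def\<close>)
  then show "wp ?cl (loop_time n (loop_time n 1)) (\<lambda>s'. ival (var ''t'') s' = bins_of n col ?b c) s1"
    by (rule wp_mono) (auto simp: bins_of_first)
qed auto

definition eval_prog :: "nat \<Rightarrow> nat \<Rightarrow> com" where
  "eval_prog m D = Seq (assign_prog D) (Seq bad_prog (cnt_prog m))"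

definition eval_time :: "nat \<Rightarrow> nat \<Rightarrow> nat \<Rightarrow> nat" where
  "eval_time m D n = loop_time n (2 * D + 2) +
     (loop_time n (loop_time n 0) + loop_time (Suc m) (loop_time n (loop_time n 1)))"

lemma mods_eval_prog [simp]:
  "y \<notin> {''b'', ''e'', ''q'', ''v'', ''bad'', ''f'', ''cnt'', ''c'', ''t'', ''r''} \<Longrightarrow> y \<notin> nmods (eval_prog m D)"
  "rmods (eval_prog m D) = {''load''}"
  by (auto simp: eval_prog_def)

definition guessed_packing :: "nat \<Rightarrow> (nat \<Rightarrow> nat) \<Rightarrow> (nat \<Rightarrow> nat) \<Rightarrow> nat \<Rightarrow> nat" where
  "guessed_packing D key x e = eval_runs (guess D x) (key e)"

lemma bins_of_cong: "(\<And>e. e < n \<Longrightarrow> b e = b' e) \<Longrightarrow> bins_of n col b c = bins_of n col b' c"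
  unfolding bins_of_def by (intro arg_cong[of _ _ card] image_cong) auto

lemma feasible_cong:
  assumes "\<And>e. e < n \<Longrightarrow> b e = b' e" shows "feasible n sz b = feasible n sz b'"
proof -
  have "{f. f < n \<and> b f = b e} = {f. f < n \<and> b' f = b' e}" if "e < n" for e using assms that by auto
  then show ?thesis by (simp add: feasible_def)
qed

lemma wp_eval_prog:
  assumes inp: "inp n col sz s" and key: "nats s ''key'' = key"
  shows "wp (eval_prog m D) (eval_time m D n) (\<lambda>s'.
    let b = guessed_packing D key (nats s ''x'') in
      (\<forall>e<n. nats s' ''b'' e = b e) \<and> (nats s' ''bad'' 0 = 0 \<longleftrightarrow> feasible n sz b) \<and>
      (\<forall>c\<le>m. nats s' ''cnt'' c = bins_of n col b c)) s"
  unfolding eval_prog_def eval_time_def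
proof (rule wp_Seq_frame[OF wp_assign_prog])
  show "nats s ''n'' 0 = n" using inp by (simp add: inp_def)
next
  define b where "b = guessed_packing D key (nats s ''x'')"
  fix s1 assume b1: "\<forall>e<n. nats s1 ''b'' e = eval_runs (guess D (nats s ''x'')) (nats s ''key'' e)"
    and ag: "agree (nmods (assign_prog D)) (rmods (assign_prog D)) s s1"
  have inp1: "inp n col sz s1"
    by (rule inp_agree[OF inp ag]) simp_all
  have b: "nats s1 ''b'' e = b e" if "e < n" for e using b1 that by (simp add: b_def guessed_packing_def key)
  show "wp (Seq bad_prog (cnt_prog m)) (loop_time n (loop_time n 0) + loop_time (Suc m) (loop_time n (loop_time n 1)))
    (\<lambda>s'. let b = guessed_packing D key (nats s ''x'') in
      (\<forall>e<n. nats s' ''b'' e = b e) \<and> (nats s' ''bad'' 0 = 0 \<longleftrightarrow> feasible n sz b) \<and>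
      (\<forall>c\<le>m. nats s' ''cnt'' c = bins_of n col b c)) s1"
    unfolding b_def[symmetric] Let_def
  proof (rule wp_Seq_frame[OF wp_bad_prog[OF inp1]])
    fix s2 assume bad: "(nats s2 ''bad'' 0 = 0) = feasible n sz (nats s1 ''b'')"
      and ag2: "agree (nmods bad_prog) (rmods bad_prog) s1 s2"
    have inp2: "inp n col sz s2" by (rule inp_agree[OF inp1 ag2]) simp_all
    have b2: "nats s2 ''b'' = nats s1 ''b''" using ag2 by (simp add: agree_def)
    show "wp (cnt_prog m) (loop_time (Suc m) (loop_time n (loop_time n 1)))
      (\<lambda>s'. (\<forall>e<n. nats s' ''b'' e = b e) \<and> (nats s' ''bad'' 0 = 0) = feasible n sz b \<and>
      (\<forall>c\<le>m. nats s' ''cnt'' c = bins_of n col b c)) s2"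
    proof (rule wp_mono[OF wp_frame[OF wp_cnt_prog[OF inp2]]])
      fix s3 assume "(\<forall>c<Suc m. nats s3 ''cnt'' c = bins_of n col (nats s2 ''b'') c) \<and>
        agree (nmods (cnt_prog m)) (rmods (cnt_prog m)) s2 s3"
      then show "(\<forall>e<n. nats s3 ''b'' e = b e) \<and> (nats s3 ''bad'' 0 = 0) = feasible n sz b \<and>
        (\<forall>c\<le>m. nats s3 ''cnt'' c = bins_of n col b c)"
        using bad b b2 bins_of_cong[of n "nats s1 ''b''" b col] feasible_cong[of n "nats s1 ''b''" b sz]
        by (auto simp: agree_def less_Suc_eq_le)
    qed simp
  qed
qed

section \<open>The search over all guesses\<close>

definition est_prog :: "nat \<Rightarrow> com" where
  "est_prog m = fill_loop ''est'' ''c'' (IConst (Suc m)) Skip (IPlus (var ''n'') (IConst 1))"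

definition min_leaf :: "nat \<Rightarrow> nat \<Rightarrow> com" where
  "min_leaf m D = Seq (eval_prog m D) (Cond (IEq (var ''bad'') (IConst 0))
     (fill_loop ''est'' ''c'' (IConst (Suc m))
        (Cond (ILess (IArr ''cnt'' (var ''c'')) (IArr ''est'' (var ''c'')))
           (IAssign ''v'' (IConst 0) (IArr ''cnt'' (var ''c'')))
           (IAssign ''v'' (IConst 0) (IArr ''est'' (var ''c''))))
        (var ''v''))
     Skip)"

text \<open>\<open>ok\<close> counts violated colour bounds, so 0 means success. The bound with
  ratio num / den is cross-multiplied, which leaves only multiplications by constants.\<close>

definition best_leaf :: "nat \<Rightarrow> nat \<Rightarrow> nat \<Rightarrow> nat \<Rightarrow> nat \<Rightarrow> com" where
  "best_leaf m D num den A = Seq (eval_prog m D)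
     (Seq (count_loop ''ok'' ''c'' (IConst m) Skip
            (ILess (IPlus (imult num (IArr ''est'' (IPlus (var ''c'') (IConst 1)))) (IConst A))
                   (imult den (IArr ''cnt'' (IPlus (var ''c'') (IConst 1))))))
        (Cond (BAnd (IEq (var ''bad'') (IConst 0))
                (BAnd (IEq (var ''ok'') (IConst 0)) (ILess (var ''cnt'') (var ''best''))))
           (Seq (IAssign ''best'' (IConst 0) (var ''cnt''))
              (fill_loop ''bin'' ''e'' (var ''n'') Skip (IArr ''b'' (var ''e''))))
           Skip))"

text \<open>Loop limits are exclusive, and the entries of the relevant runs are at most n + m +
  1.\<close>

definition bound_exp :: "nat \<Rightarrow> iexp" where
  "bound_exp m = IPlus (var ''n'') (IConst (m + 2))"

definition solve_prog :: "nat \<Rightarrow> nat \<Rightarrow> nat \<Rightarrow> nat \<Rightarrow> nat \<Rightarrow> nat \<Rightarrow> com" where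
  "solve_prog N m D num den A = Seq (keys_prog N m) (Seq (est_prog m)
     (Seq (enum ''x'' (bound_exp m) (min_leaf m D) (2 * D))
     (Seq (IAssign ''best'' (IConst 0) (IPlus (var ''n'') (IConst 1)))
        (enum ''x'' (bound_exp m) (best_leaf m D num den A) (2 * D)))))"

definition min_leaf_time :: "nat \<Rightarrow> nat \<Rightarrow> nat \<Rightarrow> nat" where
  "min_leaf_time m D n = eval_time m D n + Suc (loop_time (Suc m) 2)"

definition best_leaf_time :: "nat \<Rightarrow> nat \<Rightarrow> nat \<Rightarrow> nat" where
  "best_leaf_time m D n = eval_time m D n + (loop_time m 1 + Suc (1 + loop_time n 1))"

definition solve_time :: "nat \<Rightarrow> nat \<Rightarrow> nat \<Rightarrow> nat" where
  "solve_time m D n = keys_time m n + (loop_time (Suc m) 1 +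
     (enum_time (n + (m + 2)) (min_leaf_time m D n) (2 * D) +
       (1 + enum_time (n + (m + 2)) (best_leaf_time m D n) (2 * D))))"

text \<open>\<open>opt c\<close> is meant as a lower bound for every feasible packing, so no update
  can undercut it, while each visited feasible guess bounds \<open>est\<close> from above.\<close>

definition est_inv where
  "est_inv m n col sz D key opt V s \<longleftrightarrow> inp n col sz s \<and> nats s ''key'' = key \<and>
     (\<forall>c\<le>m. opt c \<le> nats s ''est'' c) \<and>
     (\<forall>x\<in>V. feasible n sz (guessed_packing D key x) \<longrightarrow>
        (\<forall>c\<le>m. nats s ''est'' c \<le> bins_of n col (guessed_packing D key x) c))"

lemma wp_min_leaf:
  assumes inv: "est_inv m n col sz D key opt V s"
    and opt: "\<And>b c. feasible n sz b \<Longrightarrow> c \<le> m \<Longrightarrow> opt c \<le> bins_of n col b c"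
  shows "wp (min_leaf m D) (min_leaf_time m D n)
     (\<lambda>s'. est_inv m n col sz D key opt (insert (nats s ''x'') V) s' \<and> nats s' ''x'' = nats s ''x'') s"
  unfolding min_leaf_def min_leaf_time_def
proof (rule wp_Seq_frame[OF wp_eval_prog[where key = key and n = n and col = col and sz = sz]])
  show inp: "inp n col sz s" and key: "nats s ''key'' = key" using inv by (auto simp: est_inv_def)
  define b where "b = guessed_packing D key (nats s ''x'')"
  fix s1 assume "let b = guessed_packing D key (nats s ''x'')
    in (\<forall>e<n. nats s1 ''b'' e = b e) \<and> (nats s1 ''bad'' 0 = 0) = feasible n sz b \<and>
      (\<forall>c\<le>m. nats s1 ''cnt'' c = bins_of n col b c)"
    and ag: "agree (nmods (eval_prog m D)) (rmods (eval_prog m D)) s s1"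
  then have ev: "(nats s1 ''bad'' 0 = 0) = feasible n sz b"
    "\<And>c. c \<le> m \<Longrightarrow> nats s1 ''cnt'' c = bins_of n col b c" by (auto simp: Let_def b_def)
  have inp1: "inp n col sz s1" by (rule inp_agree[OF inp ag]) simp_all
  have s1: "nats s1 ''key'' = key" "nats s1 ''est'' = nats s ''est''" "nats s1 ''x'' = nats s ''x''"
    using ag key by (simp_all add: agree_def)
  let ?pre = "Cond (ILess (IArr ''cnt'' (var ''c'')) (IArr ''est'' (var ''c'')))
           (IAssign ''v'' (IConst 0) (IArr ''cnt'' (var ''c'')))
           (IAssign ''v'' (IConst 0) (IArr ''est'' (var ''c'')))"
  show "wp (Cond (IEq (var ''bad'') (IConst 0)) (fill_loop ''est'' ''c'' (IConst (Suc m)) ?pre (var ''v'')) Skip)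
     (Suc (loop_time (Suc m) 2))
     (\<lambda>s'. est_inv m n col sz D key opt (insert (nats s ''x'') V) s' \<and> nats s' ''x'' = nats s ''x'') s1"
  proof (rule wp_Cond, goal_cases)
    case 1
    then have feas: "feasible n sz b" using ev(1) by simp
    have "wp (fill_loop ''est'' ''c'' (IConst (Suc m)) ?pre (var ''v'')) (loop_time (Suc m) 2)
      (\<lambda>s'. \<forall>c<Suc m. nats s' ''est'' c = min (nats s1 ''cnt'' c) (nats s1 ''est'' c)) s1"
    proof (rule wp_fill_loop)
      fix c s2 assume s2: "agree ({''est'', ''c''} \<union> nmods ?pre) (rmods ?pre) s1 s2" "nats s2 ''c'' 0 = c"
        "nats s2 ''est'' c = nats s1 ''est'' c"
      have "wp ?pre (Suc 1) (\<lambda>s'. ival (var ''v'') s' = min (nats s1 ''cnt'' c) (nats s1 ''est'' c)) s2"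
        by (rule wp_Cond; rule wp_IAssign) (use s2 in \<open>auto simp: agree_def\<close>)
      then show "wp ?pre 2 (\<lambda>s'. ival (var ''v'') s' = min (nats s1 ''cnt'' c) (nats s1 ''est'' c)) s2"
        by (rule wp_mono) auto
    qed simp_all
    from wp_frame[OF this] show ?case
    proof (rule wp_mono)
      fix s2 assume s2: "(\<forall>c<Suc m. nats s2 ''est'' c = min (nats s1 ''cnt'' c) (nats s1 ''est'' c)) \<and>
        agree (nmods (fill_loop ''est'' ''c'' (IConst (Suc m)) ?pre (var ''v'')))
          (rmods (fill_loop ''est'' ''c'' (IConst (Suc m)) ?pre (var ''v''))) s1 s2"
      have "inp n col sz s2" by (rule inp_agree[OF inp1 conjunct2[OF s2]]) simp_all
      moreover have "nats s2 ''key'' = key" "nats s2 ''x'' = nats s ''x''" using s2 s1 by (auto simp: agree_def)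
      moreover have est: "nats s2 ''est'' c = min (bins_of n col b c) (nats s ''est'' c)" if "c \<le> m" for c
        using s2 that ev(2) s1(2) by simp
      ultimately show "est_inv m n col sz D key opt (insert (nats s ''x'') V) s2 \<and> nats s2 ''x'' = nats s ''x''"
        using inv opt[OF feas] by (auto simp: est_inv_def b_def min_le_iff_disj)
    qed simp
  next
    case 2
    then have "\<not> feasible n sz b" using ev(1) by simp
    have "wp Skip 1 (\<lambda>s'. est_inv m n col sz D key opt (insert (nats s ''x'') V) s' \<and> nats s' ''x'' = nats s ''x'') s1"
      by (rule wp_Skip) (use inv inp1 s1 \<open>\<not> feasible n sz b\<close> in \<open>auto simp: est_inv_def b_def\<close>)
    then show ?case by (rule wp_mono) (auto simp: loop_time_def)
  qed
qed

definition admissible where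
  "admissible m n col sz est num den A b \<longleftrightarrow> feasible n sz b \<and>
     (\<forall>c<m. den * bins_of n col b (Suc c) \<le> num * est (Suc c) + A)"

text \<open>The value \<open>Suc n\<close> marks that no admissible guess has been met; the count of
  a packing never exceeds n.\<close>

definition best_inv where
  "best_inv m n col sz D key est num den A V s \<longleftrightarrow> inp n col sz s \<and> nats s ''key'' = key \<and>
     nats s ''est'' = est \<and>
     (nats s ''best'' 0 = Suc n \<or> admissible m n col sz est num den A (nats s ''bin'') \<and>
        bins_of n col (nats s ''bin'') 0 = nats s ''best'' 0) \<and>
     (\<forall>x\<in>V. admissible m n col sz est num den A (guessed_packing D key x) \<longrightarrow>
        nats s ''best'' 0 \<le> bins_of n col (guessed_packing D key x) 0)"

lemma admissible_cong:
  assumes "\<And>e. e < n \<Longrightarrow> b e = b' e"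
  shows "admissible m n col sz est num den A b = admissible m n col sz est num den A b'"
proof -
  have "bins_of n col b c = bins_of n col b' c" for c by (rule bins_of_cong) (rule assms)
  moreover have "feasible n sz b = feasible n sz b'" by (rule feasible_cong) (rule assms)
  ultimately show ?thesis by (simp add: admissible_def)
qed

lemma wp_best_leaf:
  assumes inv: "best_inv m n col sz D key est num den A V s"
  shows "wp (best_leaf m D num den A) (best_leaf_time m D n)
     (\<lambda>s'. best_inv m n col sz D key est num den A (insert (nats s ''x'') V) s' \<and> nats s' ''x'' = nats s ''x'') s"
  unfolding best_leaf_def best_leaf_time_def
proof (rule wp_Seq_frame[OF wp_eval_prog[where key = key and n = n and col = col and sz = sz]])
  show inp: "inp n col sz s" and key: "nats s ''key'' = key" using inv by (auto simp: best_inv_def)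
  define b where "b = guessed_packing D key (nats s ''x'')"
  let ?v = "ILess (IPlus (imult num (IArr ''est'' (IPlus (var ''c'') (IConst 1)))) (IConst A))
                   (imult den (IArr ''cnt'' (IPlus (var ''c'') (IConst 1))))"
  fix s1 assume "let b = guessed_packing D key (nats s ''x'')
    in (\<forall>e<n. nats s1 ''b'' e = b e) \<and> (nats s1 ''bad'' 0 = 0) = feasible n sz b \<and>
      (\<forall>c\<le>m. nats s1 ''cnt'' c = bins_of n col b c)"
    and ag: "agree (nmods (eval_prog m D)) (rmods (eval_prog m D)) s s1"
  then have ev: "\<And>e. e < n \<Longrightarrow> nats s1 ''b'' e = b e" "(nats s1 ''bad'' 0 = 0) = feasible n sz b"
    "\<And>c. c \<le> m \<Longrightarrow> nats s1 ''cnt'' c = bins_of n col b c" by (auto simp: Let_def b_def)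
  have inp1: "inp n col sz s1" by (rule inp_agree[OF inp ag]) simp_all
  have s1: "nats s1 ''key'' = key" "nats s1 ''est'' = est" "nats s1 ''x'' = nats s ''x''"
    "nats s1 ''best'' = nats s ''best''" "nats s1 ''bin'' = nats s ''bin''"
    using ag key inv by (simp_all add: agree_def best_inv_def)
  show "wp (Seq (count_loop ''ok'' ''c'' (IConst m) Skip ?v)
     (Cond (BAnd (IEq (var ''bad'') (IConst 0))
                (BAnd (IEq (var ''ok'') (IConst 0)) (ILess (var ''cnt'') (var ''best''))))
           (Seq (IAssign ''best'' (IConst 0) (var ''cnt''))
              (fill_loop ''bin'' ''e'' (var ''n'') Skip (IArr ''b'' (var ''e''))))
           Skip)) (loop_time m 1 + Suc (1 + loop_time n 1))
     (\<lambda>s'. best_inv m n col sz D key est num den A (insert (nats s ''x'') V) s' \<and> nats s' ''x'' = nats s ''x'') s1"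
  proof (rule wp_Seq_frame)
    show "wp (count_loop ''ok'' ''c'' (IConst m) Skip ?v) (loop_time m 1)
      (\<lambda>s'. nats s' ''ok'' 0 = card {c. c < m \<and> num * est (Suc c) + A < den * bins_of n col b (Suc c)}) s1"
    proof (rule wp_count_loop)
      fix c s2 assume c: "c < m" and s2: "agree ({''ok'', ''c''} \<union> nmods Skip) (rmods Skip) s1 s2" "nats s2 ''c'' 0 = c"
      then have "nats s2 ''est'' = est" "nats s2 ''cnt'' = nats s1 ''cnt''" using s1 by (auto simp: agree_def)
      then show "wp Skip 1 (\<lambda>s'. bval ?v s' = (num * est (Suc c) + A < den * bins_of n col b (Suc c))) s2"
        using s2(2) ev(3)[of "Suc c"] c by (intro wp_Skip) simp
    qed simp_all
  next
    fix s2 assume ok: "nats s2 ''ok'' 0 = card {c. c < m \<and> num * est (Suc c) + A < den * bins_of n col b (Suc c)}"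
      and ag2: "agree (nmods (count_loop ''ok'' ''c'' (IConst m) Skip ?v))
        (rmods (count_loop ''ok'' ''c'' (IConst m) Skip ?v)) s1 s2"
    have inp2: "inp n col sz s2" by (rule inp_agree[OF inp1 ag2]) simp_all
    have s2: "nats s2 ''key'' = key" "nats s2 ''est'' = est" "nats s2 ''x'' = nats s ''x''"
      "nats s2 ''best'' = nats s ''best''" "nats s2 ''bin'' = nats s ''bin''" "nats s2 ''b'' = nats s1 ''b''"
      "nats s2 ''bad'' = nats s1 ''bad''" "nats s2 ''cnt'' 0 = bins_of n col b 0"
      using ag2 s1 ev(3)[of 0] by (simp_all add: agree_def)
    have "nats s2 ''ok'' 0 = 0 \<longleftrightarrow> (\<forall>c<m. den * bins_of n col b (Suc c) \<le> num * est (Suc c) + A)"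
      unfolding ok by (subst card_0_eq) (auto simp: not_less simp del: Collect_empty_eq)
    then have test: "bval (BAnd (IEq (var ''bad'') (IConst 0))
                (BAnd (IEq (var ''ok'') (IConst 0)) (ILess (var ''cnt'') (var ''best'')))) s2 \<longleftrightarrow>
        admissible m n col sz est num den A b \<and> bins_of n col b 0 < nats s ''best'' 0"
      using ev(2) s2 by (auto simp: admissible_def)
    show "wp (Cond (BAnd (IEq (var ''bad'') (IConst 0))
                (BAnd (IEq (var ''ok'') (IConst 0)) (ILess (var ''cnt'') (var ''best''))))
           (Seq (IAssign ''best'' (IConst 0) (var ''cnt''))
              (fill_loop ''bin'' ''e'' (var ''n'') Skip (IArr ''b'' (var ''e''))))
           Skip) (Suc (1 + loop_time n 1))
     (\<lambda>s'. best_inv m n col sz D key est num den A (insert (nats s ''x'') V) s' \<and> nats s' ''x'' = nats s ''x'') s2"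
    proof (rule wp_Cond, unfold test, goal_cases)
      case 1
      show ?case
      proof (intro wp_Seq wp_IAssign)
        let ?s = "nat_store ''best'' (ival (IConst 0) s2) (ival (var ''cnt'') s2) s2"
        have "wp (fill_loop ''bin'' ''e'' (var ''n'') Skip (IArr ''b'' (var ''e''))) (loop_time n 1)
          (\<lambda>s'. \<forall>e<n. nats s' ''bin'' e = b e) ?s"
        proof (rule wp_fill_loop)
          fix i s' assume i: "i < n" "nats s' ''e'' 0 = i"
            and ag': "agree ({''bin'', ''e''} \<union> nmods Skip) (rmods Skip) ?s s'"
          have "nats s' ''b'' = nats s1 ''b''" using ag' s2(6) by (simp add: agree_def)
          then show "wp Skip 1 (\<lambda>s''. ival (IArr ''b'' (var ''e'')) s'' = b i) s'"
            using i ev(1) by (intro wp_Skip) simp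
        qed (use inp2 in \<open>simp_all add: agree_def inp_def\<close>)
        from wp_frame[OF this]
        show "wp (fill_loop ''bin'' ''e'' (var ''n'') Skip (IArr ''b'' (var ''e''))) (loop_time n 1)
          (\<lambda>s'. best_inv m n col sz D key est num den A (insert (nats s ''x'') V) s' \<and> nats s' ''x'' = nats s ''x'') ?s"
        proof (rule wp_mono)
          fix s3 assume s3: "(\<forall>e<n. nats s3 ''bin'' e = b e) \<and>
            agree (nmods (fill_loop ''bin'' ''e'' (var ''n'') Skip (IArr ''b'' (var ''e''))))
              (rmods (fill_loop ''bin'' ''e'' (var ''n'') Skip (IArr ''b'' (var ''e'')))) ?s s3"
          have "inp n col sz ?s" using inp2 by (simp add: inp_def)
          then have "inp n col sz s3" by (rule inp_agree[OF _ conjunct2[OF s3]]) simp_all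
          moreover have "nats s3 ''key'' = key" "nats s3 ''est'' = est" "nats s3 ''x'' = nats s ''x''"
            "nats s3 ''best'' 0 = bins_of n col b 0"
            using s3 s2 by (auto simp: agree_def)
          moreover have "admissible m n col sz est num den A (nats s3 ''bin'')"
            using 1 s3 admissible_cong[of n "nats s3 ''bin''" b] by blast
          moreover have "bins_of n col (nats s3 ''bin'') 0 = bins_of n col b 0"
            by (rule bins_of_cong) (use s3 in blast)
          ultimately show "best_inv m n col sz D key est num den A (insert (nats s ''x'') V) s3 \<and>
              nats s3 ''x'' = nats s ''x''"
            using inv 1 unfolding best_inv_def by (auto simp: b_def[symmetric])
        qed simp
      qed
    next
      case 2
      have "wp Skip 1 (\<lambda>s'. best_inv m n col sz D key est num den A (insert (nats s ''x'') V) s' \<and>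
          nats s' ''x'' = nats s ''x'') s2"
        by (rule wp_Skip) (use inv inp2 s2 2 in \<open>auto simp: best_inv_def b_def[symmetric]\<close>)
      then show ?case by (rule wp_mono) (auto simp: loop_time_def)
    qed
  qed
qed

lemma bins_of_le: "bins_of n col b c \<le> n"
proof -
  have "bins_of n col b c \<le> card {e. e < n \<and> (c = 0 \<or> col e = c)}"
    unfolding bins_of_def by (intro card_image_le) simp
  also have "\<dots> \<le> card {..<n}" by (intro card_mono) auto
  finally show ?thesis by simp
qed

text \<open>\<open>opt\<close> stays abstract, as only its being a lower bound counts. The estimates
  are existential: all that later arguments use is that they lie between \<open>opt\<close> and the
  count of every feasible guess.\<close>

lemma wp_solve_prog:
  fixes opt :: "nat \<Rightarrow> nat" and n m D :: nat
  assumes inp: "inp n col sz s" and N: "0 < N" and x: "\<And>i. nats s ''x'' i = 0"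
    and opt: "\<And>b c. feasible n sz b \<Longrightarrow> c \<le> m \<Longrightarrow> opt c \<le> bins_of n col b c" "\<And>c. c \<le> m \<Longrightarrow> opt c \<le> n"
  defines "X \<equiv> {x. (\<forall>i\<ge>2 * D. x i = 0) \<and> (\<forall>i<2 * D. x i < n + (m + 2))}"
  shows "wp (solve_prog N m D num den A) (solve_time m D n) (\<lambda>s'. \<exists>key st est.
     valid_keys N m n col sz key st \<and> (\<forall>c\<le>m. opt c \<le> est c) \<and>
     (\<forall>x\<in>X. feasible n sz (guessed_packing D key x) \<longrightarrow>
        (\<forall>c\<le>m. est c \<le> bins_of n col (guessed_packing D key x) c)) \<and>
     (\<forall>x\<in>X. admissible m n col sz est num den A (guessed_packing D key x) \<longrightarrow>
        admissible m n col sz est num den A (nats s' ''bin'') \<and>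
        bins_of n col (nats s' ''bin'') 0 \<le> bins_of n col (guessed_packing D key x) 0)) s"
    (is "wp _ _ ?R s")
  unfolding solve_prog_def solve_time_def
proof (rule wp_Seq_frame[OF wp_keys_prog[OF inp N]])
  fix s1 assume "\<exists>st. valid_keys N m n col sz (nats s1 ''key'') st"
    and ag1: "agree (nmods (keys_prog N m)) (rmods (keys_prog N m)) s s1"
  then obtain st where st: "valid_keys N m n col sz (nats s1 ''key'') st" by blast
  define key where "key = nats s1 ''key''"
  have inp1: "inp n col sz s1" by (rule inp_agree[OF inp ag1]) simp_all
  have x1: "nats s1 ''x'' i = 0" for i using ag1 x by (simp add: agree_def)
  let ?e1 = "enum ''x'' (bound_exp m) (min_leaf m D) (2 * D)"
  let ?e2 = "enum ''x'' (bound_exp m) (best_leaf m D num den A) (2 * D)"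
  show "wp (Seq (est_prog m) (Seq ?e1
      (Seq (IAssign ''best'' (IConst 0) (IPlus (var ''n'') (IConst 1))) ?e2)))
      (loop_time (Suc m) 1 + (enum_time (n + (m + 2)) (min_leaf_time m D n) (2 * D) +
       (1 + enum_time (n + (m + 2)) (best_leaf_time m D n) (2 * D)))) ?R s1"
  proof (rule wp_Seq_frame)
    show "wp (est_prog m) (loop_time (Suc m) 1) (\<lambda>s'. \<forall>c<Suc m. nats s' ''est'' c = Suc n) s1"
      unfolding est_prog_def
    proof (rule wp_fill_loop)
      fix s' assume "agree ({''est'', ''c''} \<union> nmods Skip) (rmods Skip) s1 s'"
      then have "nats s' ''n'' 0 = n" using inp1 by (simp add: agree_def inp_def)
      then show "wp Skip 1 (\<lambda>s''. ival (IPlus (var ''n'') (IConst 1)) s'' = Suc n) s'"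
        by (intro wp_Skip) simp
    qed simp_all
  next
    fix s2 assume est: "\<forall>c<Suc m. nats s2 ''est'' c = Suc n"
      and ag2: "agree (nmods (est_prog m)) (rmods (est_prog m)) s1 s2"
    have inp2: "inp n col sz s2" by (rule inp_agree[OF inp1 ag2]) (simp_all add: est_prog_def)
    have inv2: "est_inv m n col sz D key opt {} s2"
      using inp2 est opt(2) ag2 by (auto simp: est_inv_def key_def agree_def est_prog_def less_Suc_eq_le intro: le_SucI)
    have x2: "nats s2 ''x'' i = 0" for i using ag2 x1 by (simp add: agree_def est_prog_def)
    show "wp (Seq ?e1 (Seq (IAssign ''best'' (IConst 0) (IPlus (var ''n'') (IConst 1))) ?e2))
      (enum_time (n + (m + 2)) (min_leaf_time m D n) (2 * D) +
       (1 + enum_time (n + (m + 2)) (best_leaf_time m D n) (2 * D))) ?R s2"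
    proof (rule wp_Seq_frame)
      show "wp ?e1 (enum_time (n + (m + 2)) (min_leaf_time m D n) (2 * D))
        (\<lambda>s'. est_inv m n col sz D key opt ({} \<union> {w. (\<forall>i\<ge>2 * D. w i = nats s2 ''x'' i) \<and> (\<forall>i<2 * D. w i < n + (m + 2))}) s' \<and>
          (\<forall>i\<ge>2 * D. nats s' ''x'' i = nats s2 ''x'' i)) s2"
      proof (rule wp_enum)
        show "wp (min_leaf m D) (min_leaf_time m D n) (\<lambda>s'. est_inv m n col sz D key opt (insert (nats s ''x'') V) s' \<and>
          nats s' ''x'' = nats s ''x'') s" if "est_inv m n col sz D key opt V s" for V s
          by (rule wp_min_leaf[OF that opt(1)])
      qed (use inv2 in \<open>auto simp: est_inv_def inp_def bound_exp_def\<close>)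
    next
      fix s3 assume "est_inv m n col sz D key opt ({} \<union> {w. (\<forall>i\<ge>2 * D. w i = nats s2 ''x'' i) \<and> (\<forall>i<2 * D. w i < n + (m + 2))}) s3 \<and>
          (\<forall>i\<ge>2 * D. nats s3 ''x'' i = nats s2 ''x'' i)"
      \<comment> \<open>The first search leaves values in the cells below 2 D; the loops of the
        second start them again from 0, so only the zeros beyond matter.\<close>
      then have inv3: "est_inv m n col sz D key opt X s3" and x3: "\<And>i. i \<ge> 2 * D \<Longrightarrow> nats s3 ''x'' i = 0"
        by (simp_all add: X_def x2)
      define est where "est = nats s3 ''est''"
      let ?s = "nat_store ''best'' 0 (Suc n) s3"
      have inv4: "best_inv m n col sz D key est num den A {} ?s"
        using inv3 by (simp add: best_inv_def est_inv_def est_def inp_def)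
      have "wp ?e2 (enum_time (n + (m + 2)) (best_leaf_time m D n) (2 * D))
        (\<lambda>s'. best_inv m n col sz D key est num den A ({} \<union> {w. (\<forall>i\<ge>2 * D. w i = nats ?s ''x'' i) \<and> (\<forall>i<2 * D. w i < n + (m + 2))}) s' \<and>
          (\<forall>i\<ge>2 * D. nats s' ''x'' i = nats ?s ''x'' i)) ?s"
      proof (rule wp_enum)
        show "wp (best_leaf m D num den A) (best_leaf_time m D n)
          (\<lambda>s'. best_inv m n col sz D key est num den A (insert (nats s ''x'') V) s' \<and> nats s' ''x'' = nats s ''x'') s"
          if "best_inv m n col sz D key est num den A V s" for V s
          by (rule wp_best_leaf[OF that])
      qed (use inv4 in \<open>auto simp: best_inv_def inp_def bound_exp_def\<close>)
      then have "wp ?e2 (enum_time (n + (m + 2)) (best_leaf_time m D n) (2 * D)) ?R ?s"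
      proof (rule wp_mono)
        fix s4 assume "best_inv m n col sz D key est num den A ({} \<union> {w. (\<forall>i\<ge>2 * D. w i = nats ?s ''x'' i) \<and> (\<forall>i<2 * D. w i < n + (m + 2))}) s4 \<and>
          (\<forall>i\<ge>2 * D. nats s4 ''x'' i = nats ?s ''x'' i)"
        then have inv5: "best_inv m n col sz D key est num den A X s4" by (simp add: X_def x3)
        have "admissible m n col sz est num den A (nats s4 ''bin'') \<and>
            bins_of n col (nats s4 ''bin'') 0 \<le> bins_of n col (guessed_packing D key x) 0"
          if x: "x \<in> X" "admissible m n col sz est num den A (guessed_packing D key x)" for x
        proof -
          have "nats s4 ''best'' 0 \<le> bins_of n col (guessed_packing D key x) 0"
            using inv5 x by (auto simp: best_inv_def)
          moreover from this have "nats s4 ''best'' 0 \<noteq> Suc n"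
            using bins_of_le[of n col "guessed_packing D key x" 0] by linarith
          ultimately show ?thesis using inv5 by (auto simp: best_inv_def)
        qed
        then show "?R s4" using st inv3 unfolding est_inv_def est_def[symmetric] key_def by blast
      qed simp
      then show "wp (Seq (IAssign ''best'' (IConst 0) (IPlus (var ''n'') (IConst 1))) ?e2)
        (1 + enum_time (n + (m + 2)) (best_leaf_time m D n) (2 * D)) ?R s3"
        by (intro wp_Seq wp_IAssign) (use inv3 in \<open>simp add: est_inv_def inp_def\<close>)
    qed
  qed
qed

section \<open>Polynomial time bounds\<close>

definition poly_bounded :: "(nat \<Rightarrow> nat) \<Rightarrow> bool" where
  "poly_bounded f \<longleftrightarrow> (\<exists>p :: nat poly. \<forall>n. f n \<le> poly p n)"

lemma poly_bounded_const: "poly_bounded (\<lambda>n. k)"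
  unfolding poly_bounded_def by (rule exI[of _ "[:k:]"]) simp

lemma poly_bounded_id: "poly_bounded (\<lambda>n. n)"
  unfolding poly_bounded_def by (rule exI[of _ "[:0, 1:]"]) simp

lemma poly_bounded_add: "poly_bounded f \<Longrightarrow> poly_bounded g \<Longrightarrow> poly_bounded (\<lambda>n. f n + g n)"
  unfolding poly_bounded_def by (metis add_mono poly_add)

lemma poly_bounded_mult: "poly_bounded f \<Longrightarrow> poly_bounded g \<Longrightarrow> poly_bounded (\<lambda>n. f n * g n)"
  unfolding poly_bounded_def by (metis mult_le_mono poly_mult)

lemma poly_bounded_Suc: "poly_bounded f \<Longrightarrow> poly_bounded (\<lambda>n. Suc (f n))"
  using poly_bounded_add[OF _ poly_bounded_const[of 1]] by simp

lemmas poly_bounded_intros =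
  poly_bounded_const poly_bounded_id poly_bounded_add poly_bounded_mult poly_bounded_Suc

lemma poly_bounded_loop_time:
  "poly_bounded f \<Longrightarrow> poly_bounded g \<Longrightarrow> poly_bounded (\<lambda>n. loop_time (f n) (g n))"
  unfolding loop_time_def by (intro poly_bounded_intros)

text \<open>The nesting depth d is fixed, so each level contributes just one more polynomial
  factor.\<close>

lemma poly_bounded_enum_time:
  "poly_bounded f \<Longrightarrow> poly_bounded g \<Longrightarrow> poly_bounded (\<lambda>n. enum_time (f n) (g n) d)"
  by (induction d) (auto intro!: poly_bounded_intros)

lemma poly_bounded_solve_time: "poly_bounded (solve_time m D)"
proof -
  have "poly_bounded (\<lambda>n. solve_time m D n)"
    unfolding solve_time_def keys_time_def min_leaf_time_def best_leaf_time_def eval_time_def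
    by (intro poly_bounded_intros poly_bounded_loop_time poly_bounded_enum_time)
  then show ?thesis .
qed

section \<open>The approximation guarantee\<close>

text \<open>The count H ((R + 1)^H R) with H = (m + 1) (N^3 + 1) classes and multiplicity R =
  N^2.\<close>

definition num_runs :: "nat \<Rightarrow> nat \<Rightarrow> nat" where
  "num_runs N m = ((m + 1) * N ^ 3 + (m + 1)) * ((N ^ 2 + 1) ^ ((m + 1) * N ^ 3 + (m + 1)) * N ^ 2)"

lemma feasible_load: assumes "feasible n sz b" shows "(\<Sum>e | e < n \<and> b e = \<beta>. sz e) \<le> 1"
proof (cases "\<exists>e<n. b e = \<beta>")
  case False
  then have "{e. e < n \<and> b e = \<beta>} = {}" by auto
  then show ?thesis by (simp del: Collect_empty_eq)
qed (use assms in \<open>auto simp: feasible_def\<close>)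

lemma approx_by_guess:
  fixes N m n :: nat
  assumes N: "2 \<le> N" and sz: "\<forall>e<n. 0 < sz e \<and> sz e \<le> 1" and col: "\<forall>e<n. col e \<le> m"
    and keys: "valid_keys N m n col sz key st" and Q: "feasible n sz Q"
  defines "D \<equiv> num_runs N m"
  obtains x where "\<forall>i\<ge>2 * D. x i = 0" "\<forall>i<2 * D. x i < n + (m + 2)"
    "feasible n sz (guessed_packing D key x)"
    "bins_of n col (guessed_packing D key x) 0 \<le> (1 + 4 * (real m + 1) / N) * bins_of n col Q 0 + 2 * (real m + 1)"
    "\<And>c. c \<in> {1..m} \<Longrightarrow>
       bins_of n col (guessed_packing D key x) c \<le> (1 + 4 / N) * bins_of n col Q c + 2"
proof -
  interpret keyed_instance N m n col sz key st
    by unfold_locales (use assms in auto)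
  from run_packing[OF feasible_load[OF Q]] obtain ps where ps: "length ps = D"
    "\<And>a l. (a, l) \<in> set ps \<Longrightarrow> a \<le> n + m + 1 \<and> l \<le> n + m + 1"
    "\<And>b. (\<Sum>e | e < n \<and> eval_runs ps (key e) = b. sz e) \<le> 1"
    "card ((\<lambda>e. eval_runs ps (key e)) ` {..<n}) \<le> (1 + 4 * (m + 1) / N) * card (Q ` {..<n}) + 2 * (m + 1)"
    "\<And>c. c \<le> m \<Longrightarrow> card ((\<lambda>e. eval_runs ps (key e)) ` {e. e < n \<and> col e = c})
        \<le> (1 + 4 / N) * card (Q ` {e. e < n \<and> col e = c}) + 2"
    unfolding G_def D_def num_runs_def by blast
  \<comment> \<open>Starts go to even and lengths to odd cells, as \<open>guess\<close> decodes
    them; the zeros beyond put x into the searched box.\<close>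
  define x where "x i = (if i < 2 * D then if even i then fst (ps ! (i div 2)) else snd (ps ! (i div 2)) else 0)" for i
  have "guess D x = ps"
    unfolding guess_def by (rule nth_equalityI) (auto simp: ps(1) x_def)
  then have g: "guessed_packing D key x e = eval_runs ps (key e)" for e
    by (simp add: guessed_packing_def)
  show ?thesis
  proof (rule that[of x])
    show "\<forall>i\<ge>2 * D. x i = 0" by (simp add: x_def)
    show "\<forall>i<2 * D. x i < n + (m + 2)"
    proof (intro allI impI)
      fix i assume i: "i < 2 * D"
      then have "ps ! (i div 2) \<in> set ps" using ps(1) by (intro nth_mem) auto
      then show "x i < n + (m + 2)" using ps(2)[of "fst (ps ! (i div 2))" "snd (ps ! (i div 2))"] i
        by (auto simp: x_def)
    qed
    show "feasible n sz (guessed_packing D key x)" unfolding feasible_def g using ps(3) by blast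
    have "{e. e < n} = {..<n}" by auto
    then show "bins_of n col (guessed_packing D key x) 0 \<le> (1 + 4 * (real m + 1) / N) * bins_of n col Q 0 + 2 * (real m + 1)"
      using ps(4) by (simp add: bins_of_def g add.commute)
    show "bins_of n col (guessed_packing D key x) c \<le> (1 + 4 / N) * bins_of n col Q c + 2"
      if "c \<in> {1..m}" for c
      using ps(5)[of c] that by (simp add: bins_of_def g)
  qed
qed

section \<open>Instances as arrays of sizes and colours\<close>

context
  fixes I :: "nat bp_instance" and n :: nat and col :: "nat \<Rightarrow> nat" and sz :: "nat \<Rightarrow> real"
  assumes items: "items I = {..<n}"
    and sz: "\<And>e. e < n \<Longrightarrow> sz e = item_size I e" and col: "\<And>e. e < n \<Longrightarrow> col e = item_colour I e"
    and sz_bounds: "\<And>e. e < n \<Longrightarrow> 0 < sz e \<and> sz e \<le> 1"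
begin

lemma packing_iff_feasible: "packing I b \<longleftrightarrow> feasible n sz b"
proof -
  have s: "(\<Sum>e\<in>{e \<in> items I. b e = \<beta>}. item_size I e) = (\<Sum>f | f < n \<and> b f = \<beta>. sz f)" for \<beta>
    by (rule sum.cong) (auto simp: items sz)
  show ?thesis unfolding packing_def s using feasible_load[of n sz b] by (auto simp: feasible_def)
qed

lemma num_bins_eq: "num_bins I b = bins_of n col b 0"
proof -
  have "{e. e < n} = {..<n}" by auto
  then show ?thesis by (simp add: num_bins_def bins_of_def items)
qed

lemma num_bins_colour_eq: "0 < c \<Longrightarrow> num_bins_colour I c b = bins_of n col b c"
  unfolding num_bins_colour_def bins_of_def
  by (rule arg_cong[of _ _ card]) (auto simp: items col image_def)

lemma num_bins_part_eq: "0 < c \<Longrightarrow> num_bins (colour_part I c) b = bins_of n col b c"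
  unfolding num_bins_def bins_of_def colour_part_def
  by (rule arg_cong[of _ _ card]) (auto simp: items col image_def)

lemma packing_part: "packing (colour_part I c) b \<longleftrightarrow>
    (\<forall>\<beta>. (\<Sum>e | e < n \<and> col e = c \<and> b e = \<beta>. sz e) \<le> 1)"
proof -
  have "(\<Sum>e\<in>{e \<in> items (colour_part I c). b e = \<beta>}. item_size (colour_part I c) e) =
     (\<Sum>e | e < n \<and> col e = c \<and> b e = \<beta>. sz e)" for \<beta>
    by (rule sum.cong) (auto simp: colour_part_def items col sz)
  then show ?thesis by (simp add: packing_def)
qed

lemma feasible_part: assumes "feasible n sz b" shows "packing (colour_part I c) b"
  unfolding packing_part
proof
  fix \<beta>
  have "(\<Sum>e | e < n \<and> col e = c \<and> b e = \<beta>. sz e) \<le> (\<Sum>e | e < n \<and> b e = \<beta>. sz e)"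
    by (intro sum_mono2) (use sz_bounds in \<open>auto simp: less_imp_le\<close>)
  also have "\<dots> \<le> 1" by (rule feasible_load[OF assms])
  finally show "(\<Sum>e | e < n \<and> col e = c \<and> b e = \<beta>. sz e) \<le> 1" .
qed

lemma OPT_part_le: assumes "feasible n sz b" "0 < c" shows "OPT (colour_part I c) \<le> bins_of n col b c"
  unfolding OPT_def num_bins_part_eq[OF assms(2), symmetric]
  by (rule Least_le) (use feasible_part[OF assms(1)] in blast)

text \<open>The estimates range over packings of all items, so an optimal packing of one colour has
  to be extended: all other items get bins of their own, which does not affect the count for
  c.\<close>

lemma feasible_opt_colour:
  assumes "feasible n sz b\<^sub>0" "0 < c"
  obtains b where "feasible n sz b" "bins_of n col b c = OPT (colour_part I c)"
proof -
  have "\<exists>k P. packing (colour_part I c) P \<and> num_bins (colour_part I c) P = k"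
    using feasible_part[OF assms(1)] by blast
  then have "\<exists>P. packing (colour_part I c) P \<and> num_bins (colour_part I c) P = OPT (colour_part I c)"
    unfolding OPT_def by (rule LeastI_ex)
  then obtain P where P: "packing (colour_part I c) P" "bins_of n col P c = OPT (colour_part I c)"
    using num_bins_part_eq[OF assms(2)] by metis
  \<comment> \<open>Larger than every label that \<open>P\<close> uses on items, so the private
    labels M + e are new.\<close>
  define M where "M = Suc (\<Sum>e<n. P e)"
  define b where "b e = (if col e = c then P e else M + e)" for e
  have M: "P e < M" if "e < n" for e
    unfolding M_def less_Suc_eq_le by (rule member_le_sum) (use that in auto)
  have "feasible n sz b"
    unfolding feasible_def
  proof (intro allI impI)
    fix e assume e: "e < n"
    show "(\<Sum>f | f < n \<and> b f = b e. sz f) \<le> 1"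
    proof (cases "col e = c")
      case True
      have "{f. f < n \<and> b f = b e} = {f. f < n \<and> col f = c \<and> P f = P e}"
        using True M[OF e] by (auto simp: b_def split: if_splits)
      then show ?thesis using P(1) by (simp add: packing_part)
    next
      case False
      have "{f. f < n \<and> b f = b e} = {e}"
        using False M e by (fastforce simp: b_def split: if_splits)
      then show ?thesis using sz_bounds[OF e] by simp
    qed
  qed
  moreover have "bins_of n col b c = bins_of n col P c"
    using assms(2) unfolding bins_of_def by (intro arg_cong[of _ _ card] image_cong) (auto simp: b_def)
  ultimately show ?thesis using that P(2) by simp
qed

end

theorem theorem8:
  fixes m :: nat and \<beta> :: real
  assumes "\<beta> > 1"
  shows "\<exists>K::real. K > 0 \<and> (\<forall>\<epsilon>::real. \<epsilon> > 0 \<longrightarrow>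
    (\<exists>(prog :: com) (p :: nat poly) (C :: real).
      \<forall>(n :: nat) (I :: nat bp_instance).
        valid_instance m I \<and> items I = {..<n} \<and>
        (\<exists>Q. packing I Q \<and> colour_stretch_le m I Q \<beta>) \<longrightarrow>
        (\<exists>t s. runs prog (input_state \<beta> \<epsilon> n I) t s \<and> t \<le> poly p n \<and>
           packing I (output_packing s) \<and>
           real (num_bins I (output_packing s))
             \<le> (1 + K * \<epsilon>) * real (OPT_stretch m \<beta> I) + C \<and>
           (\<forall>c\<in>{1..m}. real (num_bins_colour I c (output_packing s))
             \<le> \<beta> * (1 + K * \<epsilon>) * real (OPT (colour_part I c)) + C))))"
\<comment> \<open>The term 4 (m + 1) comes from the total number of bins. The 29 comes from (1 + 5
  \<delta>) (1 + 4 \<delta>) \<le> 1 + 29 \<delta> for \<delta> \<le> 1, the joint loss of the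
  rounded stretch and of the estimates.\<close>
proof (rule exI[of _ "29 + 4 * (real m + 1)"], intro conjI allI impI)
  show "0 < 29 + 4 * (real m + 1)" by simp
next
  fix \<epsilon> :: real assume \<epsilon>: "0 < \<epsilon>"
  \<comment> \<open>The ceiling ensures 1 / N \<le> \<epsilon>, and the summand 2 ensures N \<ge> 2
    also for large \<epsilon>.\<close>
  define N where "N = nat \<lceil>1 / \<epsilon>\<rceil> + 2"
  define \<delta> where "\<delta> = 1 / real N"
  have N: "2 \<le> N" by (simp add: N_def)
  have "1 / \<epsilon> \<le> real N" unfolding N_def by linarith
  then have \<delta>: "0 < \<delta>" "\<delta> \<le> 1" "\<delta> \<le> \<epsilon>" using \<epsilon> N by (auto simp: \<delta>_def field_simps)
  \<comment> \<open>Admissibility is tested on naturals, so the factor (1 + 4 \<delta>) \<beta>,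
    possibly irrational, is rounded up to a fraction num / den; this choice of den keeps the
    rounding error below \<delta> \<beta>.\<close>
  obtain den :: nat where den: "1 < real den * (\<delta> * \<beta>)"
    using ex_less_of_nat_mult[of "\<delta> * \<beta>" 1] \<delta> assms by auto
  define num where "num = nat \<lceil>real den * ((1 + 4 * \<delta>) * \<beta>)\<rceil>"
  define \<gamma> where "\<gamma> = real num / real den"
  have den_pos: "0 < real den" using den by (cases den) auto
  have pos: "0 \<le> real den * ((1 + 4 * \<delta>) * \<beta>)" using \<delta> assms by simp
  have "real den * ((1 + 4 * \<delta>) * \<beta>) \<le> num" unfolding num_def by linarith
  then have \<gamma>1: "(1 + 4 * \<delta>) * \<beta> \<le> \<gamma>" using den_pos by (simp add: \<gamma>_def field_simps)
  have "real num \<le> real den * ((1 + 4 * \<delta>) * \<beta>) + 1" unfolding num_def using pos by linarith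
  also have "\<dots> \<le> real den * ((1 + 5 * \<delta>) * \<beta>)" using den by (simp add: algebra_simps)
  finally have \<gamma>2: "\<gamma> \<le> (1 + 5 * \<delta>) * \<beta>" using den_pos by (simp add: \<gamma>_def field_simps)
  have \<gamma>_pos: "0 \<le> \<gamma>" by (simp add: \<gamma>_def)
  define D where "D = num_runs N m"
  \<comment> \<open>The last argument 2 den is the additive 2 of the approximation after
    cross-multiplication.\<close>
  define prog where "prog = solve_prog N m D num den (2 * den)"
  obtain p :: "nat poly" where p: "\<And>n. solve_time m D n \<le> poly p n"
    using poly_bounded_solve_time unfolding poly_bounded_def by blast
  \<comment> \<open>The total count costs 2 (m + 1). A colour costs 2 in the admissibility test and
    another 2 in its estimate, the latter multiplied by \<gamma>.\<close>
  define C where "C = 2 * (real m + 1) + 2 * \<gamma> + 2"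
  show "\<exists>(prog :: com) (p :: nat poly) (C :: real). \<forall>(n :: nat) (I :: nat bp_instance).
        valid_instance m I \<and> items I = {..<n} \<and>
        (\<exists>Q. packing I Q \<and> colour_stretch_le m I Q \<beta>) \<longrightarrow>
        (\<exists>t s. runs prog (input_state \<beta> \<epsilon> n I) t s \<and> t \<le> poly p n \<and>
           packing I (output_packing s) \<and>
           real (num_bins I (output_packing s))
             \<le> (1 + (29 + 4 * (real m + 1)) * \<epsilon>) * real (OPT_stretch m \<beta> I) + C \<and>
           (\<forall>c\<in>{1..m}. real (num_bins_colour I c (output_packing s))
             \<le> \<beta> * (1 + (29 + 4 * (real m + 1)) * \<epsilon>) * real (OPT (colour_part I c)) + C))"
  proof (rule exI[of _ prog], rule exI[of _ p], rule exI[of _ C], intro allI impI)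
    fix n :: nat and I :: "nat bp_instance"
    assume "valid_instance m I \<and> items I = {..<n} \<and> (\<exists>Q. packing I Q \<and> colour_stretch_le m I Q \<beta>)"
    then have valid: "valid_instance m I" and items: "items I = {..<n}"
      and ex_Q: "\<exists>Q. packing I Q \<and> colour_stretch_le m I Q \<beta>" by auto
    let ?s = "input_state \<beta> \<epsilon> n I"
    define col where "col = nats ?s ''colour''"
    define sz where "sz = reals ?s ''size''"
    have col_eq: "col e = item_colour I e" and sz_eq: "sz e = item_size I e"
      and sz_b: "0 < sz e \<and> sz e \<le> 1" and col_le: "col e \<le> m" if "e < n" for e
      using that valid items by (auto simp: col_def sz_def input_state_def valid_instance_def)
    have inp: "inp n col sz ?s" by (simp add: inp_def col_def sz_def input_state_def)
    have sz_all: "\<forall>e<n. 0 < sz e \<and> sz e \<le> 1" and col_all: "\<forall>e<n. col e \<le> m"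
      using sz_b col_le by blast+
    note ctx = items sz_eq col_eq sz_b
    \<comment> \<open>Index 0 counts all items; 0 is a trivial lower bound there, and the estimates
      serve only the colours from 1 on.\<close>
    define opt where "opt c = (if c = 0 then 0 else OPT (colour_part I c))" for c
    define X where "X = {x :: nat \<Rightarrow> nat. (\<forall>i\<ge>2 * D. x i = 0) \<and> (\<forall>i<2 * D. x i < n + (m + 2))}"
    have "\<exists>k P. packing I P \<and> colour_stretch_le m I P \<beta> \<and> num_bins I P = k" using ex_Q by blast
    then have "\<exists>P. packing I P \<and> colour_stretch_le m I P \<beta> \<and> num_bins I P = OPT_stretch m \<beta> I"
      unfolding OPT_stretch_def by (rule LeastI_ex)
    then obtain Q where Q: "packing I Q" "colour_stretch_le m I Q \<beta>" "num_bins I Q = OPT_stretch m \<beta> I"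
      by blast
    have feasQ: "feasible n sz Q" using Q(1) packing_iff_feasible[OF ctx] by blast
    have opt_le: "opt c \<le> bins_of n col b c" if "feasible n sz b" for b c
      using OPT_part_le[OF ctx that] by (simp add: opt_def)
    have opt_n: "opt c \<le> n" for c using opt_le[OF feasQ] bins_of_le le_trans by blast
    have N0: "0 < N" using N by simp
    have x0: "nats ?s ''x'' i = 0" for i by (simp add: input_state_def)
    note wp = wp_solve_prog[where opt = opt and D = D and num = num and den = den and A = "2 * den" and m = m,
      OF inp N0 x0 opt_le opt_n, folded X_def prog_def]
    obtain t s where "runs prog ?s t s \<and> t \<le> solve_time m D n \<and> (\<exists>key st est.
       valid_keys N m n col sz key st \<and> (\<forall>c\<le>m. opt c \<le> est c) \<and>
       (\<forall>x\<in>X. feasible n sz (guessed_packing D key x) \<longrightarrow>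
          (\<forall>c\<le>m. est c \<le> bins_of n col (guessed_packing D key x) c)) \<and>
       (\<forall>x\<in>X. admissible m n col sz est num den (2 * den) (guessed_packing D key x) \<longrightarrow>
          admissible m n col sz est num den (2 * den) (nats s ''bin'') \<and>
          bins_of n col (nats s ''bin'') 0 \<le> bins_of n col (guessed_packing D key x) 0))"
      by (rule exE[OF wp[unfolded wp_def]], assumption, elim exE) (rule that)
    then obtain key st est where run: "runs prog ?s t s" "t \<le> solve_time m D n"
      and keys: "valid_keys N m n col sz key st"
      and est_ge': "\<forall>c\<le>m. opt c \<le> est c"
      and est_le': "\<forall>x\<in>X. feasible n sz (guessed_packing D key x) \<longrightarrow>
          (\<forall>c\<le>m. est c \<le> bins_of n col (guessed_packing D key x) c)"
      and best': "\<forall>x\<in>X. admissible m n col sz est num den (2 * den) (guessed_packing D key x) \<longrightarrow>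
          admissible m n col sz est num den (2 * den) (nats s ''bin'') \<and>
          bins_of n col (nats s ''bin'') 0 \<le> bins_of n col (guessed_packing D key x) 0"
      by (elim exE conjE) (rule that)
    note est_ge = est_ge'[rule_format] and est_le = est_le'[rule_format] and best = best'[rule_format]
    \<comment> \<open>The upper bound follows from the guess that approximates a packing optimal for
      colour c alone.\<close>
    have est: "OPT (colour_part I c) \<le> est c" "est c \<le> (1 + 4 * \<delta>) * OPT (colour_part I c) + 2"
      if c: "c \<in> {1..m}" for c
    proof -
      show "OPT (colour_part I c) \<le> est c" using est_ge[of c] c by (simp add: opt_def)
      obtain b where b: "feasible n sz b" "bins_of n col b c = OPT (colour_part I c)"
        using feasible_opt_colour[OF ctx feasQ, of c] c by auto
      obtain x where x: "\<forall>i\<ge>2 * D. x i = 0" "\<forall>i<2 * D. x i < n + (m + 2)"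
        "feasible n sz (guessed_packing D key x)"
        "bins_of n col (guessed_packing D key x) 0 \<le> (1 + 4 * (real m + 1) / N) * bins_of n col b 0 + 2 * (real m + 1)"
        "\<And>c. c \<in> {1..m} \<Longrightarrow> bins_of n col (guessed_packing D key x) c \<le> (1 + 4 / N) * bins_of n col b c + 2"
        by (rule approx_by_guess[OF N sz_all col_all keys b(1), folded D_def]) (rule that)
      have "est c \<le> bins_of n col (guessed_packing D key x) c"
        by (rule est_le) (use x(1-3) c in \<open>auto simp: X_def\<close>)
      then show "est c \<le> (1 + 4 * \<delta>) * OPT (colour_part I c) + 2"
        using x(5)[OF c] by (simp add: b(2) \<delta>_def)
    qed
    obtain x where x: "\<forall>i\<ge>2 * D. x i = 0" "\<forall>i<2 * D. x i < n + (m + 2)"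
      "feasible n sz (guessed_packing D key x)"
      "bins_of n col (guessed_packing D key x) 0 \<le> (1 + 4 * (real m + 1) / N) * bins_of n col Q 0 + 2 * (real m + 1)"
      "\<And>c. c \<in> {1..m} \<Longrightarrow> bins_of n col (guessed_packing D key x) c \<le> (1 + 4 / N) * bins_of n col Q c + 2"
      by (rule approx_by_guess[OF N sz_all col_all keys feasQ, folded D_def]) (rule that)
    \<comment> \<open>\<open>Q\<close> has stretch \<beta> relative to the optimum of each colour,
      which is at most the estimate. So the guess approximating \<open>Q\<close> passes a test that
      knows only estimates, and the search returns a packing with no more bins.\<close>
    have "admissible m n col sz est num den (2 * den) (guessed_packing D key x)"
      unfolding admissible_def
    proof (intro conjI allI impI)
      fix c assume "c < m"
      then have c: "Suc c \<in> {1..m}" by simp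
      have "bins_of n col Q (Suc c) \<le> \<beta> * OPT (colour_part I (Suc c))"
        using bspec[OF Q(2)[unfolded colour_stretch_le_def] c] num_bins_colour_eq[OF ctx, of "Suc c" Q]
        by simp
      also have "\<dots> \<le> \<beta> * est (Suc c)" using est(1)[OF c] assms by simp
      finally have "(1 + 4 * \<delta>) * bins_of n col Q (Suc c) \<le> (1 + 4 * \<delta>) * (\<beta> * est (Suc c))"
        using \<delta> by (intro mult_left_mono) auto
      also have "\<dots> \<le> \<gamma> * est (Suc c)"
        using mult_right_mono[OF \<gamma>1, of "real (est (Suc c))"] by (simp add: mult.assoc)
      finally have "bins_of n col (guessed_packing D key x) (Suc c) \<le> \<gamma> * est (Suc c) + 2"
        using x(5)[OF c] by (simp add: \<delta>_def)
      then have "real den * bins_of n col (guessed_packing D key x) (Suc c) \<le> real den * (\<gamma> * est (Suc c) + 2)"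
        using den_pos by simp
      also have "\<dots> = num * est (Suc c) + 2 * den"
        using den_pos by (simp add: \<gamma>_def field_simps)
      finally show "den * bins_of n col (guessed_packing D key x) (Suc c) \<le> num * est (Suc c) + 2 * den"
        by (simp flip: of_nat_mult of_nat_add)
    qed (rule x(3))
    with best[of x] x(1,2) have adm: "admissible m n col sz est num den (2 * den) (nats s ''bin'')"
      and total: "bins_of n col (nats s ''bin'') 0 \<le> bins_of n col (guessed_packing D key x) 0"
      by (auto simp: X_def)
    have out: "output_packing s = nats s ''bin''" by (simp add: output_packing_def fun_eq_iff)
    have "real (num_bins I (output_packing s)) \<le> (1 + (29 + 4 * (real m + 1)) * \<epsilon>) * real (OPT_stretch m \<beta> I) + C"
    proof -
      have "real (num_bins I (output_packing s)) \<le> (1 + 4 * (real m + 1) * \<delta>) * OPT_stretch m \<beta> I + 2 * (real m + 1)"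
        using total x(4) num_bins_eq[OF ctx] Q(3) by (simp add: out \<delta>_def add.commute)
      also have "4 * (real m + 1) * \<delta> \<le> (29 + 4 * (real m + 1)) * \<epsilon>"
        using \<delta> by (intro mult_mono) auto
      then have "(1 + 4 * (real m + 1) * \<delta>) * OPT_stretch m \<beta> I \<le>
          (1 + (29 + 4 * (real m + 1)) * \<epsilon>) * OPT_stretch m \<beta> I"
        by (intro mult_right_mono) auto
      finally show ?thesis using \<gamma>_pos by (simp add: C_def)
    qed
    moreover have "real (num_bins_colour I c (output_packing s))
        \<le> \<beta> * (1 + (29 + 4 * (real m + 1)) * \<epsilon>) * real (OPT (colour_part I c)) + C" if c: "c \<in> {1..m}" for c
    proof -
      let ?o = "real (OPT (colour_part I c))"
      obtain c' where c': "c = Suc c'" "c' < m" using c by (cases c) auto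
      have "den * bins_of n col (nats s ''bin'') c \<le> num * est c + 2 * den"
        using adm c' by (simp add: admissible_def)
      then have "real den * bins_of n col (nats s ''bin'') c \<le> real num * est c + 2 * real den"
        by (simp flip: of_nat_mult of_nat_add)
      then have "bins_of n col (nats s ''bin'') c \<le> \<gamma> * est c + 2"
        using den_pos by (simp add: \<gamma>_def field_simps)
      also have "\<gamma> * est c \<le> \<gamma> * ((1 + 4 * \<delta>) * ?o + 2)"
        using est(2)[OF c] \<gamma>_pos by (intro mult_left_mono) auto
      also have "\<dots> = \<gamma> * ((1 + 4 * \<delta>) * ?o) + 2 * \<gamma>" by (simp add: algebra_simps)
      also have "\<gamma> * ((1 + 4 * \<delta>) * ?o) \<le> ((1 + 5 * \<delta>) * \<beta>) * ((1 + 4 * \<delta>) * ?o)"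
        using \<gamma>2 \<delta> by (intro mult_right_mono) auto
      also have "\<dots> = \<beta> * ((1 + 5 * \<delta>) * (1 + 4 * \<delta>)) * ?o" by (simp add: algebra_simps)
      also have "\<dots> \<le> \<beta> * (1 + (29 + 4 * (real m + 1)) * \<epsilon>) * ?o"
      proof (intro mult_right_mono mult_left_mono)
        have "\<delta> * \<delta> \<le> \<delta>" using \<delta> by (simp add: mult_left_le)
        then have "(1 + 5 * \<delta>) * (1 + 4 * \<delta>) \<le> 1 + 29 * \<delta>" by (simp add: algebra_simps)
        also have "29 * \<delta> \<le> (29 + 4 * (real m + 1)) * \<epsilon>" using \<delta> by (intro mult_mono) auto
        finally show "(1 + 5 * \<delta>) * (1 + 4 * \<delta>) \<le> 1 + (29 + 4 * (real m + 1)) * \<epsilon>" by simp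
      qed (use assms in auto)
      finally have "real (bins_of n col (nats s ''bin'') c) \<le>
          \<beta> * (1 + (29 + 4 * (real m + 1)) * \<epsilon>) * ?o + (2 * \<gamma> + 2)" by simp
      moreover have "num_bins_colour I c (output_packing s) = bins_of n col (nats s ''bin'') c"
        using num_bins_colour_eq[OF ctx, of c] c by (simp add: out)
      ultimately show ?thesis by (simp add: C_def)
    qed
    moreover have "packing I (output_packing s)"
      using adm packing_iff_feasible[OF ctx] by (simp add: admissible_def out)
    ultimately show "\<exists>t s. runs prog ?s t s \<and> t \<le> poly p n \<and> packing I (output_packing s) \<and>
           real (num_bins I (output_packing s))
             \<le> (1 + (29 + 4 * (real m + 1)) * \<epsilon>) * real (OPT_stretch m \<beta> I) + C \<and>
           (\<forall>c\<in>{1..m}. real (num_bins_colour I c (output_packing s))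
             \<le> \<beta> * (1 + (29 + 4 * (real m + 1)) * \<epsilon>) * real (OPT (colour_part I c)) + C)"
      using run p[of n] le_trans by blast
  qed
qed

end
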